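(* Let $\nu,d\in\mathbb{N}$, let $\Psi$ be a real symmetric positive definite $\nu\times\nu$ matrix, let $\Sigma$ be a real symmetric positive definite $d\times d$ matrix, and let $X_0\in\mathbb{R}^{\nu\times d}$. Let $(\mathfrak{X}_t)_{t\ge 0}$ be the $\mathbb{R}^{\nu\times d}$-valued matrix Ornstein--Uhlenbeck process solving $$\mathrm{d}\mathfrak{X}_t=-\mathfrak{X}_t\,\mathrm{d}t+\sqrt{2}\,\Psi^{1/2}\,\mathrm{d}\mathfrak{B}_t\,\Sigma^{1/2},\qquad \mathfrak{X}_0=X_0,$$ where $(\mathfrak{B}_t)_{t\ge 0}$ is a $\nu\times d$ matrix of independent standard Brownian motions. Then for every $f\in C^2(\mathbb{R}^{\nu\times d})$ the extended generator $\mathcal{A}^{\mathrm{OU}}$ of $(\mathfrak{X}_t)_{t\ge0}$ satisfies $$\mathcal{A}^{\mathrm{OU}}f(X)=-\mathrm{tr}\{X^{\top}\nabla f(X)\}+\mathrm{tr}\{\Sigma\nabla^{\top}\Psi\nabla f(X)\},\qquad X\in\mathbb{R}^{\nu\times d}.$$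
   Context: $\nabla=(\partial/\partial X_{ij})_{1\le i\le\nu,1\le j\le d}$ is the $\nu\times d$ matrix of first-order partial derivatives, so that $\mathrm{tr}\{X^\top\nabla f(X)\}=\sum_{i,j}X_{ij}\,\partial f(X)/\partial X_{ij}$ and $\mathrm{tr}\{\Sigma\nabla^{\top}\Psi\nabla f(X)\}=\sum_{i,k=1}^{\nu}\sum_{j,\ell=1}^{d}\Psi_{ik}\Sigma_{j\ell}\,\partial^2 f(X)/(\partial X_{ij}\partial X_{k\ell})$. $S^{1/2}$ denotes the symmetric square root of a nonnegative definite matrix $S$. Extended generator: for a diffusion $(\mathfrak{M}_t)_{t\ge0}$ on $\mathbb{R}^{\nu\times d}$ and sufficiently smooth $f$, one writes $\mathcal{A}f=g$ if $g$ is a measurable function such that $\big(f(\mathfrak{M}_t)-f(\mathfrak{M}_0)-\int_0^t g(\mathfrak{M}_s)\,\mathrm{d}s\big)_{t\ge0}$ is a local martingale; equivalently (It\^o's formula) $\mathcal{A}f$ is the drift term in the stochastic differential of $f(\mathfrak{M}_t)$. *)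

theory Defs
  imports "HOL-Probability.Probability"
begin

section \<open>Matrices and differential operators\<close>

text \<open>The type \<open>real^'d^'n\<close> is the space of real matrices with rows indexed by \<open>'n\<close>
  and columns indexed by \<open>'d\<close>; here \<open>CARD('n)\<close> is \<open>\<nu>\<close> and \<open>CARD('d)\<close> is \<open>d\<close>.\<close>

definition sym_matrix :: "real^'n^'n \<Rightarrow> bool" where
  "sym_matrix S \<longleftrightarrow> transpose S = S"

definition pos_def :: "real^'n^'n \<Rightarrow> bool" where
  "pos_def S \<longleftrightarrow> sym_matrix S \<and> (\<forall>x. x \<noteq> 0 \<longrightarrow> 0 < x \<bullet> (S *v x))"

definition nonneg_def :: "real^'n^'n \<Rightarrow> bool" where
  "nonneg_def S \<longleftrightarrow> sym_matrix S \<and> (\<forall>x. 0 \<le> x \<bullet> (S *v x))"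

text \<open>Among the symmetric solutions \<open>R\<close> of \<open>R ** R = S\<close>, the nonnegative definite one is the
  unique canonical choice (for nonnegative definite \<open>S\<close>).\<close>

definition matrix_sqrt :: "real^'n^'n \<Rightarrow> real^'n^'n" where
  "matrix_sqrt S = (THE R. nonneg_def R \<and> R ** R = S)"

definition partial :: "'n \<Rightarrow> 'd \<Rightarrow> (real^'d^'n \<Rightarrow> real) \<Rightarrow> real^'d^'n \<Rightarrow> real" where
  "partial i j f X = deriv (\<lambda>h. f (X + h *\<^sub>R axis i (axis j 1))) 0"

definition nabla :: "(real^'d^'n \<Rightarrow> real) \<Rightarrow> real^'d^'n \<Rightarrow> real^'d^'n" where
  "nabla f X = (\<chi> i j. partial i j f X)"

text \<open>The \<open>d \<times> d\<close> matrix obtained from the formal matrix product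
  \<open>\<nabla>\<^sup>T \<Psi> \<nabla>\<close> of operators, applied to \<open>f\<close>.\<close>

definition nabla_quad :: "real^'n^'n \<Rightarrow> (real^'d^'n \<Rightarrow> real) \<Rightarrow> real^'d^'n \<Rightarrow> real^'d^'d" where
  "nabla_quad \<Psi> f X = (\<chi> j l. \<Sum>i\<in>UNIV. \<Sum>k\<in>UNIV. \<Psi> $ i $ k * partial i j (partial k l f) X)"

lemma trace_nabla:
  "trace (transpose X ** nabla f X) = (\<Sum>i\<in>UNIV. \<Sum>j\<in>UNIV. X $ i $ j * partial i j f X)"
  unfolding trace_def matrix_matrix_mult_def transpose_def nabla_def
  by (simp, rule sum.swap)

lemma trace_nabla_quad:
  assumes "sym_matrix \<Sigma>"
  shows "trace (\<Sigma> ** nabla_quad \<Psi> f X) =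
    (\<Sum>i\<in>UNIV. \<Sum>k\<in>UNIV. \<Sum>j\<in>UNIV. \<Sum>l\<in>UNIV.
      \<Psi> $ i $ k * \<Sigma> $ j $ l * partial i j (partial k l f) X)"
proof -
  let ?p = "\<lambda>i k j l. partial i j (partial k l f) X"
  have sym: "\<Sigma> $ l $ j = \<Sigma> $ j $ l" for j l
    using assms unfolding sym_matrix_def transpose_def vec_eq_iff by simp
  have "trace (\<Sigma> ** nabla_quad \<Psi> f X) =
      (\<Sum>l\<in>UNIV. \<Sum>j\<in>UNIV. \<Sum>i\<in>UNIV. \<Sum>k\<in>UNIV. \<Psi> $ i $ k * \<Sigma> $ j $ l * ?p i k j l)"
    unfolding trace_def matrix_matrix_mult_def nabla_quad_def
    by (simp add: sum_distrib_left sym mult_ac)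
  also have "\<dots> = (\<Sum>j\<in>UNIV. \<Sum>l\<in>UNIV. \<Sum>i\<in>UNIV. \<Sum>k\<in>UNIV. \<Psi> $ i $ k * \<Sigma> $ j $ l * ?p i k j l)"
    by (rule sum.swap)
  also have "\<dots> = (\<Sum>j\<in>UNIV. \<Sum>i\<in>UNIV. \<Sum>l\<in>UNIV. \<Sum>k\<in>UNIV. \<Psi> $ i $ k * \<Sigma> $ j $ l * ?p i k j l)"
    by (intro sum.cong refl) (rule sum.swap)
  also have "\<dots> = (\<Sum>i\<in>UNIV. \<Sum>j\<in>UNIV. \<Sum>l\<in>UNIV. \<Sum>k\<in>UNIV. \<Psi> $ i $ k * \<Sigma> $ j $ l * ?p i k j l)"
    by (rule sum.swap)
  also have "\<dots> = (\<Sum>i\<in>UNIV. \<Sum>j\<in>UNIV. \<Sum>k\<in>UNIV. \<Sum>l\<in>UNIV. \<Psi> $ i $ k * \<Sigma> $ j $ l * ?p i k j l)"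
    by (intro sum.cong refl) (rule sum.swap)
  also have "\<dots> = (\<Sum>i\<in>UNIV. \<Sum>k\<in>UNIV. \<Sum>j\<in>UNIV. \<Sum>l\<in>UNIV. \<Psi> $ i $ k * \<Sigma> $ j $ l * ?p i k j l)"
    by (intro sum.cong refl) (rule sum.swap)
  finally show ?thesis .
qed

definition C2_function :: "('a::real_normed_vector \<Rightarrow> real) \<Rightarrow> bool" where
  "C2_function f \<longleftrightarrow>
    (\<exists>(f' :: 'a \<Rightarrow> 'a \<Rightarrow>\<^sub>L real) (f'' :: 'a \<Rightarrow> 'a \<Rightarrow>\<^sub>L ('a \<Rightarrow>\<^sub>L real)).
      (\<forall>x. (f has_derivative blinfun_apply (f' x)) (at x)) \<and>
      (\<forall>x. (f' has_derivative blinfun_apply (f'' x)) (at x)) \<and>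
      continuous_on UNIV f'')"


section \<open>Stochastic processes\<close>

text \<open>Processes are indexed by type \<open>real\<close>, but only times \<open>t \<ge> 0\<close> matter. The \<open>\<sigma>\<close>-algebras
  \<open>F t\<close> with \<open>t < 0\<close> play no role; any filtration on \<open>[0,\<infinity>)\<close> extends by \<open>F t = F 0\<close>.
  Neither completeness nor right-continuity of the filtration is required.\<close>

locale filtered_prob_space = prob_space M + filtration "space M" F
  for M :: "'w measure" and F :: "real \<Rightarrow> 'w measure" +
  assumes subalgebra_F: "\<And>t. subalgebra M (F t)"

definition adapted ::
    "(real \<Rightarrow> 'w measure) \<Rightarrow> (real \<Rightarrow> 'w \<Rightarrow> 'a::topological_space) \<Rightarrow> bool" where
  "adapted F Y \<longleftrightarrow> (\<forall>t\<ge>0. Y t \<in> borel_measurable (F t))"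

text \<open>A \<open>\<nu> \<times> d\<close> matrix of independent standard Brownian motions relative to \<open>F\<close>: each
  increment is independent of the past, and its entries are independent centred normal
  variables with variance \<open>t - s\<close>.\<close>

definition matrix_brownian_motion ::
    "'w measure \<Rightarrow> (real \<Rightarrow> 'w measure) \<Rightarrow> (real \<Rightarrow> 'w \<Rightarrow> real^'d^'n) \<Rightarrow> bool" where
  "matrix_brownian_motion M F B \<longleftrightarrow>
    adapted F B \<and>
    (AE \<omega> in M. B 0 \<omega> = 0) \<and>
    (AE \<omega> in M. continuous_on {0..} (\<lambda>t. B t \<omega>)) \<and>
    (\<forall>s t. 0 \<le> s \<longrightarrow> s < t \<longrightarrow>
      prob_space.indep_set M (sets (F s))
        (sets (vimage_algebra (space M) (\<lambda>\<omega>. B t \<omega> - B s \<omega>) borel)) \<and>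
      prob_space.indep_vars M (\<lambda>_. borel) (\<lambda>(i, j) \<omega>. (B t \<omega> - B s \<omega>) $ i $ j) UNIV \<and>
      (\<forall>i j. distributed M lborel (\<lambda>\<omega>. (B t \<omega> - B s \<omega>) $ i $ j)
        (normal_density 0 (sqrt (t - s)))))"

definition continuous_time_martingale ::
    "'w measure \<Rightarrow> (real \<Rightarrow> 'w measure) \<Rightarrow> (real \<Rightarrow> 'w \<Rightarrow> real) \<Rightarrow> bool" where
  "continuous_time_martingale M F N \<longleftrightarrow>
    adapted F N \<and>
    (\<forall>t\<ge>0. integrable M (N t)) \<and>
    (\<forall>s t. 0 \<le> s \<longrightarrow> s \<le> t \<longrightarrow> (AE \<omega> in M. real_cond_exp M (F s) (N t) \<omega> = N s \<omega>))"

definition cadlag :: "(real \<Rightarrow> real) \<Rightarrow> bool" where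
  "cadlag p \<longleftrightarrow> (\<forall>t\<ge>0. continuous (at_right t) p) \<and> (\<forall>t>0. \<exists>l. (p \<longlongrightarrow> l) (at_left t))"

text \<open>Requiring the stopping times to be finite is no restriction: \<open>\<tau> n\<close> can be replaced
  by \<open>min (\<tau> n) n\<close>.\<close>

definition local_martingale ::
    "'w measure \<Rightarrow> (real \<Rightarrow> 'w measure) \<Rightarrow> (real \<Rightarrow> 'w \<Rightarrow> real) \<Rightarrow> bool" where
  "local_martingale M F N \<longleftrightarrow>
    adapted F N \<and>
    (\<forall>\<omega>\<in>space M. cadlag (\<lambda>t. N t \<omega>)) \<and>
    (\<exists>\<tau> :: nat \<Rightarrow> 'w \<Rightarrow> real.
      (\<forall>n. stopping_time F (\<tau> n) \<and> (\<forall>\<omega>\<in>space M. 0 \<le> \<tau> n \<omega>)) \<and>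
      (AE \<omega> in M. incseq (\<lambda>n. \<tau> n \<omega>) \<and> filterlim (\<lambda>n. \<tau> n \<omega>) at_top sequentially) \<and>
      (\<forall>n. continuous_time_martingale M F (\<lambda>t \<omega>. N (min t (\<tau> n \<omega>)) \<omega>)))"

text \<open>The relation \<open>\<A>f = g\<close> for the extended generator \<open>\<A>\<close> of the process \<open>X\<close>.\<close>

definition extended_generator ::
    "'w measure \<Rightarrow> (real \<Rightarrow> 'w measure) \<Rightarrow> (real \<Rightarrow> 'w \<Rightarrow> 'a::topological_space) \<Rightarrow>
      ('a \<Rightarrow> real) \<Rightarrow> ('a \<Rightarrow> real) \<Rightarrow> bool" where
  "extended_generator M F X f g \<longleftrightarrow>
    g \<in> borel_measurable borel \<and>
    (AE \<omega> in M. \<forall>t\<ge>0. set_integrable lborel {0..t} (\<lambda>s. g (X s \<omega>))) \<and>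
    local_martingale M F
      (\<lambda>t \<omega>. f (X t \<omega>) - f (X 0 \<omega>) - (LINT s:{0..t}|lborel. g (X s \<omega>)))"

text \<open>The stochastic differential equation
  \<open>dX = - X dt + \<surd>2 \<Psi>\<^sup>1\<^sup>/\<^sup>2 dB \<Sigma>\<^sup>1\<^sup>/\<^sup>2\<close>, \<open>X 0 = X0\<close> in integrated form. The diffusion
  coefficient is constant, so its stochastic integral over \<open>[0,t]\<close> is the coefficient applied
  to the increment of \<open>B\<close>.\<close>

definition matrix_OU_process ::
    "'w measure \<Rightarrow> (real \<Rightarrow> 'w measure) \<Rightarrow> (real \<Rightarrow> 'w \<Rightarrow> real^'d^'n) \<Rightarrow>
      real^'n^'n \<Rightarrow> real^'d^'d \<Rightarrow> real^'d^'n \<Rightarrow> (real \<Rightarrow> 'w \<Rightarrow> real^'d^'n) \<Rightarrow> bool" where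
  "matrix_OU_process M F B \<Psi> \<Sigma> X0 X \<longleftrightarrow>
    adapted F X \<and>
    (\<forall>\<omega>\<in>space M. continuous_on {0..} (\<lambda>t. X t \<omega>)) \<and>
    (AE \<omega> in M. X 0 \<omega> = X0) \<and>
    (AE \<omega> in M. \<forall>t\<ge>0. X t \<omega> = X 0 \<omega> + (LINT s:{0..t}|lborel. - X s \<omega>) +
      sqrt 2 *\<^sub>R (matrix_sqrt \<Psi> ** (B t \<omega> - B 0 \<omega>) ** matrix_sqrt \<Sigma>))"

end

theory Submission
  imports Defs
begin

text \<open>No stochastic integral is needed, since the noise is additive. Stop \<open>X\<close> at the first time \<open>\<tau>\<close> its
  norm reaches \<open>r\<close> and expand \<open>f\<close> to second order over a grid of mesh \<open>h\<close> on \<open>[s, t]\<close>, keeping only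
  the steps that start before \<open>\<tau>\<close>. On an event of the past, the first and second order terms in the
  Gaussian increment have the expectation predicted by the generator exactly, because increments are
  independent of the past with covariance \<open>h\<close> times the identity; the remainder of one step is at most
  \<open>\<epsilon> h + K h\<^sup>2\<close> in expectation. Along every path the sum of the steps converges boundedly to the
  increment of the stopped compensated process, whose expectation on past events is therefore \<open>0\<close>.\<close>

section \<open>Square roots of positive definite matrices\<close>

text \<open>A plain expansion of \<open>f (X v)\<close> meets two obstacles. \<open>f\<close> may
  grow arbitrarily fast and the last step that starts before the stopping time may leave the ball of
  radius \<open>r\<close>, so \<open>f (X v)\<close> need not be integrable; and the drift of
  \<open>X\<close> is not bounded inside that step. Both are cured by passing to a process with
  bounded drift and the same noise, and to a cut-off \<open>f\<close>: each step is then dominated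
  by Gaussian moments, nothing changes up to the stopping time, and the overshoot disappears with
  the mesh. The second order term is taken in the Gaussian part \<open>w\<close> alone, where its
  mean is known. The drift enters through its exact integral, because it depends on the path inside
  the step and so is not an event of the past. The remainder has the shape \<epsilon> |w|^2 + C
  |w|^4 + O(h^2) since E |w|^2 is of order h and E |w|^4 of order h^2. The matrix square root is a
  definite description, so existence and uniqueness must be shown before its square, which turns the
  noise covariance into \<Psi> and \<Sigma>, is available.\<close>

lemma sym_matrix_inner:
  fixes S :: "real^'n^'n"
  assumes "sym_matrix S"
  shows "x \<bullet> (S *v y) = (S *v x) \<bullet> y"
proof -
  have "x \<bullet> (S *v y) = (x v* transpose S) \<bullet> y"
    using assms by (simp add: dot_lmul_matrix sym_matrix_def)
  then show ?thesis by (simp only: vector_transpose_matrix)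
qed

text \<open>The root comes from a contraction. With \<open>A = I - S / c\<close> of norm below 1, a
  fixed point of \<open>Y = (A + Y Y) / 2\<close> satisfies
  \<open>(I - Y)^2 = I - A = S / c\<close>, so \<open>sqrt c\<close> times \<open>I - Y\<close>
  squares to \<open>S\<close>; it is nonnegative because \<open>Y\<close> has norm below 1.\<close>

lemma pos_def_sqrt_exists:
  fixes S :: "real^'n^'n"
  assumes "pos_def S"
  shows "\<exists>R. nonneg_def R \<and> R ** R = S"
proof -
  have symS: "x \<bullet> (S *v y) = (S *v x) \<bullet> y" for x y
    using assms unfolding pos_def_def by (blast intro: sym_matrix_inner)
  define T where "T = Blinfun ((*v) S)"
  have T: "blinfun_apply T x = S *v x" for x
    unfolding T_def by (simp add: bounded_linear_Blinfun_apply)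
  have "compact (sphere (0::real^'n) 1)" "sphere (0::real^'n) 1 \<noteq> {}"
    by auto
  moreover have "continuous_on (sphere 0 1) (\<lambda>x. x \<bullet> (S *v x))"
    by (intro continuous_intros matrix_vector_mult_linear_continuous_on)
  ultimately obtain e where e: "norm e = 1" "\<And>x. norm x = 1 \<Longrightarrow> e \<bullet> (S *v e) \<le> x \<bullet> (S *v x)"
    using continuous_attains_inf[of "sphere (0::real^'n) 1" "\<lambda>x. x \<bullet> (S *v x)"] by auto
  define \<mu> where "\<mu> = e \<bullet> (S *v e)"
  have "e \<noteq> 0" using e(1) by auto
  then have \<mu>: "\<mu> > 0" using assms unfolding \<mu>_def pos_def_def by blast
  have low: "\<mu> * (norm x)\<^sup>2 \<le> x \<bullet> (S *v x)" for x
  proof (cases "x = 0")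
    case False
    let ?y = "x /\<^sub>R norm x"
    have "\<mu> \<le> ?y \<bullet> (S *v ?y)" unfolding \<mu>_def by (rule e(2)) (use False in simp)
    also have "\<dots> = (x \<bullet> (S *v x)) / (norm x)\<^sup>2"
      by (simp add: matrix_vector_mult_scaleR power2_eq_square field_simps)
    finally show ?thesis using False by (simp add: field_simps)
  qed simp
  define l where "l = norm T"
  have up: "norm (S *v x) \<le> l * norm x" for x
    using norm_blinfun[of T x] by (simp add: T l_def)
  have "\<mu> \<le> norm e * norm (S *v e)"
    unfolding \<mu>_def by (rule norm_cauchy_schwarz)
  also have "\<dots> \<le> l" using up[of e] e(1) by simp
  finally have \<mu>l: "\<mu> \<le> l" .
  then have l: "l > 0" using \<mu> by simp
  \<comment> \<open>On unit vectors \<open>|A x|^2 \<le> 1 - 2 \<mu> / c + l^2 / c^2\<close>. This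
    bound is smallest at the present \<open>c\<close>, and its minimum
    \<open>1 - \<mu>^2 / l^2\<close> is \<open>q^2\<close>.\<close>
  define c where "c = l\<^sup>2 / \<mu>"
  have c: "c > 0" using \<mu> l by (simp add: c_def)
  define q where "q = sqrt (1 - \<mu>\<^sup>2 / l\<^sup>2)"
  have q0: "1 - \<mu>\<^sup>2 / l\<^sup>2 \<ge> 0" using \<mu>l \<mu> l by (simp add: field_simps)
  have q: "0 \<le> q" "q < 1" "q\<^sup>2 = 1 - \<mu>\<^sup>2 / l\<^sup>2"
    using q0 \<mu> l by (auto simp: q_def)
  define A where "A = id_blinfun - (1 / c) *\<^sub>R T"
  have A: "blinfun_apply A x = x - (1 / c) *\<^sub>R (S *v x)" for x
    by (simp add: A_def blinfun.diff_left blinfun.scaleR_left T)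
  have "norm A \<le> q"
  proof (rule norm_blinfun_bound[OF q(1)])
    fix x
    have "(norm (blinfun_apply A x))\<^sup>2 = (norm x)\<^sup>2 - 2 / c * (x \<bullet> (S *v x)) + (norm (S *v x))\<^sup>2 / c\<^sup>2"
      unfolding A power2_norm_eq_inner
      by (simp add: inner_diff_left inner_diff_right power2_eq_square inner_commute)
    also have "\<dots> \<le> (norm x)\<^sup>2 - 2 / c * (\<mu> * (norm x)\<^sup>2) + (l * norm x)\<^sup>2 / c\<^sup>2"
      by (intro add_mono diff_mono mult_left_mono low divide_right_mono power_mono up) (use c in auto)
    also have "\<dots> = q\<^sup>2 * (norm x)\<^sup>2"
      unfolding q(3) c_def using \<mu> l by (simp add: field_simps power2_eq_square)
    finally show "norm (blinfun_apply A x) \<le> q * norm x"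
      by (metis power_mult_distrib power2_le_imp_le mult_nonneg_nonneg norm_ge_zero q(1))
  qed
  \<comment> \<open>The ball of radius \<open>q\<close> makes \<open>\<Phi>\<close> a contraction
    with constant \<open>q\<close>. Symmetry is a closed condition that \<open>\<Phi>\<close>
    preserves, so the fixed point inherits it.\<close>
  define K where "K = {Y :: (real^'n) \<Rightarrow>\<^sub>L (real^'n).
     norm Y \<le> q \<and> (\<forall>x y. x \<bullet> blinfun_apply Y y = blinfun_apply Y x \<bullet> y)}"
  define \<Phi> where "\<Phi> Y = (1 / 2) *\<^sub>R (A + (Y o\<^sub>L Y))" for Y
  have "K = {Y. norm Y \<le> q} \<inter> (\<Inter>x. \<Inter>y. {Y. x \<bullet> blinfun_apply Y y = blinfun_apply Y x \<bullet> y})"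
    by (auto simp: K_def)
  moreover have "closed \<dots>"
    by (intro closed_Int closed_INT closed_Collect_le closed_Collect_eq continuous_intros ballI)
  ultimately have "closed K" by simp
  note complK = complete_eq_closed[THEN iffD2, OF this]
  have K0: "K \<noteq> {}" using q by (auto simp: K_def intro!: exI[of _ 0])
  have \<Phi>K: "\<Phi> ` K \<subseteq> K"
  proof safe
    fix Y assume Y: "Y \<in> K"
    have "norm (Y o\<^sub>L Y) \<le> q * q"
      using Y q by (intro order_trans[OF norm_blinfun_compose] mult_mono) (auto simp: K_def)
    also have "\<dots> \<le> q" using q by (simp add: mult_left_le)
    finally have "norm (A + (Y o\<^sub>L Y)) \<le> 2 * q"
      using norm_triangle_ineq[of A "Y o\<^sub>L Y"] \<open>norm A \<le> q\<close> by simp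
    moreover have "x \<bullet> blinfun_apply (\<Phi> Y) y = blinfun_apply (\<Phi> Y) x \<bullet> y" for x y
      using Y unfolding K_def
      by (auto simp: \<Phi>_def blinfun.scaleR_left blinfun.add_left A inner_add_left inner_add_right
          inner_diff_left inner_diff_right symS)
    ultimately show "\<Phi> Y \<in> K" by (auto simp: K_def \<Phi>_def)
  qed
  have lip: "dist (\<Phi> Y) (\<Phi> Z) \<le> q * dist Y Z" if Y: "Y \<in> K" and Z: "Z \<in> K" for Y Z
  proof -
    have "\<Phi> Y - \<Phi> Z = (1/2) *\<^sub>R ((Y o\<^sub>L (Y - Z)) + ((Y - Z) o\<^sub>L Z))"
      by (rule blinfun_eqI) (simp add: \<Phi>_def blinfun.bilinear_simps algebra_simps)
    also have "norm \<dots> \<le> (1/2) * (norm Y * norm (Y - Z) + norm (Y - Z) * norm Z)"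
      by (simp del: divide_le_eq_numeral1) (intro order_trans[OF norm_triangle_ineq] add_mono norm_blinfun_compose)
    also have "\<dots> \<le> (1/2) * (q * norm (Y - Z) + norm (Y - Z) * q)"
      using Y Z by (intro mult_left_mono add_mono mult_right_mono) (auto simp: K_def)
    finally show ?thesis by (simp add: dist_norm)
  qed
  obtain Y where Y: "Y \<in> K" "\<Phi> Y = Y"
    using Banach_fix[OF complK K0 q(1,2) \<Phi>K lip] by auto
  define R where "R = matrix (\<lambda>x. sqrt c *\<^sub>R (x - blinfun_apply Y x))"
  have R: "R *v x = sqrt c *\<^sub>R (x - blinfun_apply Y x)" for x
  proof -
    have "linear (\<lambda>x. sqrt c *\<^sub>R (x - blinfun_apply Y x))"
      by (intro linearI) (simp_all add: blinfun.bilinear_simps algebra_simps)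
    then show ?thesis unfolding R_def by (rule fun_cong[OF matrix_vector_mul(2)])
  qed
  have YY: "blinfun_apply Y (blinfun_apply Y x) = 2 *\<^sub>R blinfun_apply Y x - blinfun_apply A x" for x
  proof -
    have "blinfun_apply Y x = (1/2) *\<^sub>R (blinfun_apply A x + blinfun_apply Y (blinfun_apply Y x))"
      by (subst (1) Y(2)[symmetric]) (simp add: \<Phi>_def blinfun.bilinear_simps)
    then have "2 *\<^sub>R blinfun_apply Y x = 2 *\<^sub>R ((1/2) *\<^sub>R (blinfun_apply A x + blinfun_apply Y (blinfun_apply Y x)))"
      by (rule arg_cong)
    then show ?thesis by (simp add: algebra_simps)
  qed
  have "R ** R = S"
  proof (subst matrix_eq, rule allI)
    fix x
    have "(R ** R) *v x = R *v (R *v x)" by (simp add: matrix_vector_mul_assoc)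
    also have "\<dots> = c *\<^sub>R (x - blinfun_apply A x)"
    proof -
      have "sqrt c * sqrt c = c" using c by simp
      then show ?thesis
        by (simp add: R blinfun.bilinear_simps YY scaleR_2 flip: scaleR_diff_right)
    qed
    also have "\<dots> = S *v x" using c by (simp add: A)
    finally show "(R ** R) *v x = S *v x" .
  qed
  moreover have "nonneg_def R"
    unfolding nonneg_def_def sym_matrix_def
  proof (intro conjI allI)
    have "x \<bullet> (R *v y) = (R *v x) \<bullet> y" for x y
      using Y(1) by (simp add: R K_def inner_diff_left inner_diff_right)
    then have "(transpose R *v x) \<bullet> y = (R *v x) \<bullet> y" for x y
      by (simp only: transpose_matrix_vector dot_lmul_matrix)
    then have "transpose R *v x = R *v x" for x
      by (blast intro: vector_eq_rdot[THEN iffD1])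
    then show "transpose R = R" by (subst matrix_eq) simp
  next
    fix x
    have "x \<bullet> blinfun_apply Y x \<le> norm x * norm (blinfun_apply Y x)"
      by (rule norm_cauchy_schwarz)
    also have "\<dots> \<le> norm x * (norm Y * norm x)"
      by (intro mult_left_mono norm_blinfun) auto
    also have "\<dots> \<le> norm x * (1 * norm x)"
      using Y(1) q by (intro mult_left_mono mult_right_mono) (auto simp: K_def)
    finally show "0 \<le> x \<bullet> (R *v x)"
      using c by (simp add: R inner_diff_right power2_norm_eq_inner flip: power2_eq_square)
  qed
  ultimately show ?thesis by blast
qed

text \<open>Along \<open>x + t R x\<close> the form is nonnegative for every \<open>t\<close>,
  vanishes at \<open>t = 0\<close> and has slope \<open>2 |R x|^2\<close> there; a nonzero slope
  would make it negative for small negative \<open>t\<close>.\<close>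

lemma nonneg_def_null:
  assumes "nonneg_def R" "x \<bullet> (R *v x) = 0"
  shows "R *v x = 0"
proof -
  have sym: "y \<bullet> (R *v z) = (R *v y) \<bullet> z" for y z
    using assms unfolding nonneg_def_def by (blast intro: sym_matrix_inner)
  let ?y = "R *v x"
  have quad: "0 \<le> 2 * t * (norm ?y)\<^sup>2 + t\<^sup>2 * (?y \<bullet> (R *v ?y))" for t
  proof -
    have "0 \<le> (x + t *\<^sub>R ?y) \<bullet> (R *v (x + t *\<^sub>R ?y))"
      using assms unfolding nonneg_def_def by blast
    also have "\<dots> = 2 * t * (norm ?y)\<^sup>2 + t\<^sup>2 * (?y \<bullet> (R *v ?y))"
      using assms(2) sym[of x ?y]
      by (simp add: matrix_vector_right_distrib matrix_vector_mult_scaleR inner_add_left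
          inner_add_right power2_norm_eq_inner power2_eq_square[of t] algebra_simps)
    finally show ?thesis .
  qed
  define a b where "a = (norm ?y)\<^sup>2" and "b = ?y \<bullet> (R *v ?y)"
  have ab: "b \<ge> 0" "a \<ge> 0" using assms unfolding nonneg_def_def a_def b_def by auto
  \<comment> \<open>The test point is \<open>t = - r\<close>; the \<open>+ 1\<close> keeps the
    denominator positive when \<open>b = 0\<close>.\<close>
  define r where "r = a / (b + 1)"
  have ar: "a = r * (b + 1)" using ab by (simp add: r_def)
  have "0 \<le> 2 * (- r) * a + (- r)\<^sup>2 * b" unfolding a_def b_def by (rule quad)
  also have "\<dots> = - (r\<^sup>2 * (b + 2))"
    unfolding ar by (simp add: algebra_simps power2_eq_square)
  finally have "r\<^sup>2 * (b + 2) \<le> 0" by simp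
  then have "r = 0" using ab by (auto simp: mult_le_0_iff)
  then have "a = 0" using ar by simp
  then show ?thesis by (simp add: a_def)
qed

text \<open>For square roots \<open>R\<close>, \<open>R'\<close> of \<open>S\<close> and \<open>D = R - R'\<close> one has \<open>R D + D R' = 0\<close>, so the
  nonnegative numbers \<open>tr (D\<^sup>T R D)\<close> and \<open>tr (D R' D\<^sup>T)\<close> add up to \<open>0\<close>.\<close>

lemma pos_def_sqrt_unique:
  fixes S :: "real^'n^'n"
  assumes "pos_def S" "nonneg_def R" "R ** R = S" "nonneg_def Q" "Q ** Q = S"
  shows "R = Q"
proof -
  \<comment> \<open>A nonnegative definite root of \<open>S\<close> is itself definite: a null
    vector of its form lies in its kernel, hence in the kernel of \<open>S\<close>.\<close>
  have null: "x = 0" if "nonneg_def T" "T ** T = S" "x \<bullet> (T *v x) = 0" for x T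
  proof (rule ccontr)
    have "T *v x = 0" using nonneg_def_null that(1,3) by blast
    then have "S *v x = 0" by (metis that(2) matrix_vector_mul_assoc matrix_vector_mult_0_right)
    moreover assume "x \<noteq> 0"
    ultimately show False using assms(1) unfolding pos_def_def by (metis inner_zero_right less_irrefl)
  qed
  define D where "D = R - Q"
  have entry: "(transpose A ** T ** A) $ i $ i = column i A \<bullet> (T *v column i A)" for A T :: "real^'n^'n" and i
  proof -
    have "(transpose A ** T ** A) $ i $ i = (transpose A ** (T ** A)) $ i $ i"
      by (simp add: matrix_mul_assoc)
    also have "\<dots> = column i A \<bullet> column i (T ** A)"
      by (simp add: matrix_matrix_mult_def transpose_def column_def inner_vec_def)
    also have "column i (T ** A) = T *v column i A"
      by (simp add: matrix_matrix_mult_def matrix_vector_mult_def column_def vec_eq_iff)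
    finally show ?thesis .
  qed
  have tr: "trace (transpose A ** T ** A) \<ge> 0" if "nonneg_def T" for A T :: "real^'n^'n"
    unfolding trace_def entry using that by (intro sum_nonneg) (auto simp: nonneg_def_def)
  have "R ** D + D ** Q = 0"
    using assms(3,5) 
    by (simp add: D_def matrix_eq matrix_vector_mult_add_rdistrib matrix_vector_mult_diff_rdistrib
        matrix_vector_mult_diff_distrib flip: matrix_vector_mul_assoc)
  then have "transpose D ** (R ** D + D ** Q) = 0"
    by (simp add: matrix_matrix_mult_def vec_eq_iff)
  then have "transpose D ** (R ** D) + transpose D ** (D ** Q) = 0"
    by (simp add: matrix_add_ldistrib)
  then have "trace (transpose D ** (R ** D) + transpose D ** (D ** Q)) = 0"
    by (simp only: trace_def zero_index sum.neutral_const)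
  then have "trace (transpose D ** R ** D) + trace (transpose D ** (D ** Q)) = 0"
    by (simp only: trace_add matrix_mul_assoc)
  moreover have "trace (transpose D ** (D ** Q)) = trace (transpose (transpose D) ** Q ** transpose D)"
    using trace_mul_sym[of "transpose D" "D ** Q"] by simp
  ultimately have 0: "trace (transpose D ** R ** D) = 0"
    using tr[OF assms(2), of D] tr[OF assms(4), of "transpose D"] by linarith
  have "column i D = 0" for i
  proof (rule null[OF assms(2,3)])
    have "(\<Sum>i\<in>UNIV. column i D \<bullet> (R *v column i D)) = 0"
      using 0 unfolding trace_def entry .
    then show "column i D \<bullet> (R *v column i D) = 0"
      using assms(2) by (subst (asm) sum_nonneg_eq_0_iff) (auto simp: nonneg_def_def)
  qed
  then have "D = 0" by (simp add: vec_eq_iff column_def)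
  then show ?thesis by (simp add: D_def)
qed

lemma matrix_sqrt:
  assumes "pos_def S"
  shows "transpose (matrix_sqrt S) = matrix_sqrt S" "matrix_sqrt S ** matrix_sqrt S = S"
proof -
  have "\<exists>!R. nonneg_def R \<and> R ** R = S"
    using pos_def_sqrt_exists[OF assms] pos_def_sqrt_unique[OF assms] by blast
  from theI'[OF this] show "transpose (matrix_sqrt S) = matrix_sqrt S"
    "matrix_sqrt S ** matrix_sqrt S = S"
    by (auto simp: matrix_sqrt_def nonneg_def_def sym_matrix_def)
qed

section \<open>Second-order Taylor expansion\<close>

lemma continuous_bounded_cball:
  fixes g :: "'a::euclidean_space \<Rightarrow> real"
  assumes "continuous_on UNIV g"
  shows "\<exists>K\<ge>0. \<forall>x. norm x \<le> r \<longrightarrow> \<bar>g x\<bar> \<le> K"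
proof -
  have "compact (g ` cball 0 r)"
    by (intro compact_continuous_image continuous_on_subset[OF assms]) auto
  then obtain K where K: "K > 0" "\<forall>x\<in>cball 0 r. \<bar>g x\<bar> \<le> K"
    using compact_imp_bounded[of "g ` cball 0 r"] by (auto simp: bounded_pos)
  then have "\<forall>x. norm x \<le> r \<longrightarrow> \<bar>g x\<bar> \<le> K" by simp
  then show ?thesis using K(1) by (intro exI[of _ K]) auto
qed

lemma abs_blinfun2_le:
  fixes T :: "'a::real_normed_vector \<Rightarrow>\<^sub>L 'b::real_normed_vector \<Rightarrow>\<^sub>L real"
  shows "\<bar>T v w\<bar> \<le> norm T * norm v * norm w"
proof -
  have "\<bar>T v w\<bar> \<le> norm (T v) * norm w" using norm_blinfun[of "T v" w] by simp
  also have "\<dots> \<le> norm T * norm v * norm w" by (intro mult_right_mono norm_blinfun) auto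
  finally show ?thesis .
qed

text \<open>The function is restricted to the segment from \<open>x\<close> to \<open>x + v\<close>,
  where the Maclaurin formula with Lagrange remainder applies.\<close>

lemma taylor_second_order:
  fixes f :: "'a::real_normed_vector \<Rightarrow> real" and f' :: "'a \<Rightarrow> 'a \<Rightarrow>\<^sub>L real"
  assumes f': "\<And>x. (f has_derivative blinfun_apply (f' x)) (at x)"
    and f'': "\<And>x. (f' has_derivative blinfun_apply (f'' x)) (at x)"
  shows "\<exists>\<theta>. 0 < \<theta> \<and> \<theta> < 1 \<and> f (x + v) = f x + f' x v + f'' (x + \<theta> *\<^sub>R v) v v / 2"
proof -
  define diff where "diff m t = (if m = 0 then f (x + t *\<^sub>R v) else
    if m = 1 then f' (x + t *\<^sub>R v) v else f'' (x + t *\<^sub>R v) v v)" for m :: nat and t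
  have line: "((\<lambda>t. x + t *\<^sub>R v) has_derivative (\<lambda>h. h *\<^sub>R v)) (at t)" for t
    by (auto intro!: derivative_eq_intros)
  have d0: "((\<lambda>t. f (x + t *\<^sub>R v)) has_real_derivative f' (x + t *\<^sub>R v) v) (at t)" for t
    using has_derivative_compose[OF line f', of t]
    by (simp add: has_field_derivative_def blinfun.scaleR_right mult.commute[of _ "f' _ _"])
  have d1: "((\<lambda>t. f' (x + t *\<^sub>R v) v) has_real_derivative f'' (x + t *\<^sub>R v) v v) (at t)" for t
  proof -
    have "((\<lambda>t. f' (x + t *\<^sub>R v)) has_derivative (\<lambda>h. f'' (x + t *\<^sub>R v) (h *\<^sub>R v))) (at t)"
      using has_derivative_compose[OF line f'', of t] by simp
    from blinfun.bounded_linear_left[THEN bounded_linear.has_derivative, OF this]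
    show ?thesis
      by (simp add: has_field_derivative_def blinfun.scaleR_right blinfun.scaleR_left
          mult.commute[of _ "f'' _ _ _"])
  qed
  have "\<exists>t>0. t < 1 \<and> f (x + 1 *\<^sub>R v) =
     (\<Sum>m<2. diff m 0 / fact m * 1 ^ m) + diff 2 t / fact 2 * 1 ^ 2"
    by (rule Maclaurin[where f = "\<lambda>t. f (x + t *\<^sub>R v)"]) (auto simp: diff_def less_2_cases_iff d0 d1)
  then show ?thesis
    by (auto simp: diff_def numeral_2_eq_2)
qed

text \<open>The estimate must hold for all \<open>v\<close>, because a Gaussian increment is
  unbounded. If \<open>x + v\<close> stays in the larger ball, uniform continuity of
  \<open>f''\<close> gives the small multiple of \<open>|v|^2\<close>. If it leaves, the margin 1
  between the radii forces \<open>|v| \<ge> 1\<close>, and every term is absorbed by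
  \<open>|v|^4\<close>.\<close>

lemma taylor_remainder_cutoff:
  fixes f :: "'a::euclidean_space \<Rightarrow> real" and f' :: "'a \<Rightarrow> 'a \<Rightarrow>\<^sub>L real"
  assumes f': "\<And>x. (f has_derivative blinfun_apply (f' x)) (at x)"
    and f'': "\<And>x. (f' has_derivative blinfun_apply (f'' x)) (at x)"
    and cont: "continuous_on UNIV f''" and \<epsilon>: "\<epsilon> > 0"
  shows "\<exists>C\<ge>0. \<forall>x v. norm x \<le> r \<longrightarrow>
    \<bar>(if norm (x + v) \<le> r + 1 then f (x + v) else 0) - f x - f' x v - f'' x v v / 2\<bar>
      \<le> \<epsilon> * (norm v)\<^sup>2 + C * norm v ^ 4"
proof -
  let ?B = "cball (0::'a) (r + 1)"
  have cf: "continuous_on S f" and cf': "continuous_on S f'" for S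
    by (meson f' f'' has_derivative_continuous continuous_at_imp_continuous_on)+
  have bd: "\<exists>M>0. \<forall>x\<in>?B. norm (h x) \<le> M" if "continuous_on ?B h" for h :: "'a \<Rightarrow> 'b::real_normed_vector"
    using compact_imp_bounded[OF compact_continuous_image[OF that compact_cball]]
    by (simp add: bounded_pos)
  obtain M0 where M0: "M0 > 0" "\<And>x. x \<in> ?B \<Longrightarrow> norm (f x) \<le> M0" using bd[OF cf] by auto
  obtain M1 where M1: "M1 > 0" "\<And>x. x \<in> ?B \<Longrightarrow> norm (f' x) \<le> M1" using bd[OF cf'] by auto
  obtain M2 where M2: "M2 > 0" "\<And>x. x \<in> ?B \<Longrightarrow> norm (f'' x) \<le> M2"
    using bd[OF continuous_on_subset[OF cont]] by auto
  have "uniformly_continuous_on ?B f''"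
    by (intro compact_uniformly_continuous continuous_on_subset[OF cont]) auto
  then obtain \<delta> where \<delta>: "\<delta> > 0" "\<And>x y. x \<in> ?B \<Longrightarrow> y \<in> ?B \<Longrightarrow> dist y x < \<delta> \<Longrightarrow> dist (f'' y) (f'' x) < \<epsilon>"
    using \<epsilon> unfolding uniformly_continuous_on_def by metis
  have two: "\<bar>T v v\<bar> \<le> norm T * (norm v)\<^sup>2" for T :: "'a \<Rightarrow>\<^sub>L 'a \<Rightarrow>\<^sub>L real" and v
    using abs_blinfun2_le[of T v v] by (simp add: power2_eq_square mult.assoc)
  \<comment> \<open>The first summand pays for \<open>|v| \<ge> \<delta>\<close> inside the larger
    ball, where \<open>(|v| / \<delta>)^2 \<ge> 1\<close>; the second pays for leaving that
    ball.\<close>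
  define C where "C = 2 * M2 / \<delta>\<^sup>2 + (M0 + M1 + M2)"
  have "\<bar>(if norm (x + v) \<le> r + 1 then f (x + v) else 0) - f x - f' x v - f'' x v v / 2\<bar>
      \<le> \<epsilon> * (norm v)\<^sup>2 + C * norm v ^ 4" if x: "norm x \<le> r" for x v
  proof (cases "norm (x + v) \<le> r + 1")
    case True
    obtain \<theta> where \<theta>: "0 < \<theta>" "\<theta> < 1" "f (x + v) = f x + f' x v + f'' (x + \<theta> *\<^sub>R v) v v / 2"
      using taylor_second_order[OF f' f''] by blast
    let ?y = "x + \<theta> *\<^sub>R v"
    have "?y = (1 - \<theta>) *\<^sub>R x + \<theta> *\<^sub>R (x + v)" by (simp add: algebra_simps)
    moreover have "(1 - \<theta>) *\<^sub>R x + \<theta> *\<^sub>R (x + v) \<in> ?B"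
      using x True \<theta> by (intro convexD[OF convex_cball]) auto
    ultimately have y: "?y \<in> ?B" by simp
    have "norm (f'' ?y - f'' x) \<le> \<epsilon> + 2 * M2 / \<delta>\<^sup>2 * (norm v)\<^sup>2"
    proof (cases "norm v < \<delta>")
      case True
      have "dist ?y x < \<delta>" using \<theta> True by (simp add: dist_norm) (smt (verit) mult_left_le_one_le norm_ge_zero)
      then have "dist (f'' ?y) (f'' x) < \<epsilon>" using y x by (intro \<delta>(2)) auto
      then show ?thesis using M2 \<delta> by (simp add: dist_norm add_increasing2)
    next
      case False
      have "norm (f'' ?y - f'' x) \<le> M2 + M2"
        using M2(2)[OF y] M2(2)[of x] x norm_triangle_ineq4[of "f'' ?y" "f'' x"] by simp
      also have "2 * M2 * 1 \<le> 2 * M2 * ((norm v)\<^sup>2 / \<delta>\<^sup>2)"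
        using False M2 \<delta> by (intro mult_left_mono) (auto simp: power_mono)
      then have "M2 + M2 \<le> \<epsilon> + 2 * M2 / \<delta>\<^sup>2 * (norm v)\<^sup>2" using \<epsilon> by simp
      finally show ?thesis .
    qed
    then have "\<bar>(f'' ?y - f'' x) v v\<bar> \<le> (\<epsilon> + 2 * M2 / \<delta>\<^sup>2 * (norm v)\<^sup>2) * (norm v)\<^sup>2"
      by (intro order_trans[OF two] mult_right_mono) auto
    also have "\<dots> = \<epsilon> * (norm v)\<^sup>2 + 2 * M2 / \<delta>\<^sup>2 * norm v ^ 4"
      by (simp add: algebra_simps power4_eq_xxxx power2_eq_square)
    also have "\<dots> \<le> \<epsilon> * (norm v)\<^sup>2 + C * norm v ^ 4"
      unfolding C_def using M0 M1 M2 by (intro add_left_mono mult_right_mono) auto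
    finally show ?thesis
      using True \<theta>(3) by (simp add: blinfun.diff_left)
  next
    case False
    then have v: "norm v \<ge> 1" using x norm_triangle_ineq[of x v] by simp
    have b0: "\<bar>f x\<bar> \<le> M0 * norm v ^ 4"
      using M0 M0(2)[of x] x one_le_power[OF v, of 4] by (simp add: order_trans[OF _ mult_left_mono[of 1]])
    have b1: "\<bar>f' x v\<bar> \<le> M1 * norm v ^ 4"
    proof -
      have "\<bar>f' x v\<bar> \<le> norm (f' x) * norm v ^ 1" using norm_blinfun[of "f' x" v] by simp
      also have "\<dots> \<le> M1 * norm v ^ 4"
        using M1 M1(2)[of x] x v by (intro mult_mono power_increasing) auto
      finally show ?thesis .
    qed
    have b2: "\<bar>f'' x v v\<bar> \<le> M2 * norm v ^ 4"
    proof -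
      have "\<bar>f'' x v v\<bar> \<le> norm (f'' x) * norm v ^ 2" using two[of "f'' x" v] by simp
      also have "\<dots> \<le> M2 * norm v ^ 4"
        using M2 M2(2)[of x] x v by (intro mult_mono power_increasing) auto
      finally show ?thesis .
    qed
    have "\<bar>0 - f x - f' x v - f'' x v v / 2\<bar> \<le> \<bar>f x\<bar> + \<bar>f' x v\<bar> + \<bar>f'' x v v\<bar>"
      by linarith
    also have "\<dots> \<le> M0 * norm v ^ 4 + M1 * norm v ^ 4 + M2 * norm v ^ 4"
      by (intro add_mono b0 b1 b2)
    also have "\<dots> = (M0 + M1 + M2) * norm v ^ 4" by (simp add: algebra_simps)
    also have "\<dots> \<le> C * norm v ^ 4"
      unfolding C_def using M2 by (intro mult_right_mono) auto
    also have "\<dots> \<le> \<epsilon> * (norm v)\<^sup>2 + C * norm v ^ 4" using \<epsilon> by simp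
    finally show ?thesis using False by simp
  qed
  moreover have "C \<ge> 0" using M0 M1 M2 by (simp add: C_def)
  ultimately show ?thesis by blast
qed

text \<open>In the application \<open>w\<close> is the Gaussian part of a step and \<open>b\<close>
  its drift, of size \<open>h\<close>. Keeping only \<open>f'' x w w\<close> leaves cross terms of
  order \<open>h^(3/2)\<close>; Young's inequality splits them into a small multiple of
  \<open>|w|^2\<close> and a large multiple of \<open>|b|^2\<close>, which is of order
  \<open>h^2\<close>.\<close>

lemma taylor_remainder_split:
  fixes f :: "'a::euclidean_space \<Rightarrow> real" and f' :: "'a \<Rightarrow> 'a \<Rightarrow>\<^sub>L real"
  assumes f': "\<And>x. (f has_derivative blinfun_apply (f' x)) (at x)"
    and f'': "\<And>x. (f' has_derivative blinfun_apply (f'' x)) (at x)"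
    and cont: "continuous_on UNIV f''" and \<epsilon>: "\<epsilon> > 0"
  shows "\<exists>C\<ge>0. \<forall>x w b. norm x \<le> r \<longrightarrow>
    \<bar>(if norm (x + w - b) \<le> r + 1 then f (x + w - b) else 0) - f x - f' x (w - b) - f'' x w w / 2\<bar>
      \<le> \<epsilon> * (norm w)\<^sup>2 + C * (norm w ^ 4 + (norm b)\<^sup>2 + norm b ^ 4)"
proof -
  have "compact (f'' ` cball 0 r)"
    by (intro compact_continuous_image continuous_on_subset[OF cont]) auto
  then obtain M where M: "M > 0" "\<And>x. norm x \<le> r \<Longrightarrow> norm (f'' x) \<le> M"
    using compact_imp_bounded[of "f'' ` cball 0 r"] by (auto simp: bounded_pos)
  \<comment> \<open>The contribution \<open>2 e\<close> from squaring \<open>w - b\<close> and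
    \<open>M e\<close> from the cross terms must add up to \<open>\<epsilon>\<close>.\<close>
  define e where "e = \<epsilon> / (2 + M)"
  have e: "e > 0" "\<epsilon> = 2 * e + M * e" 
  proof -
    show "e > 0" using \<epsilon> M by (simp add: e_def)
    have "(2 + M) * e = \<epsilon>" using M by (simp add: e_def)
    then show "\<epsilon> = 2 * e + M * e" by (simp add: distrib_right)
  qed
  obtain C where C: "C \<ge> 0" "\<And>x v. norm x \<le> r \<Longrightarrow>
    \<bar>(if norm (x + v) \<le> r + 1 then f (x + v) else 0) - f x - f' x v - f'' x v v / 2\<bar>
      \<le> e * (norm v)\<^sup>2 + C * norm v ^ 4"
    using taylor_remainder_cutoff[OF f' f'' cont e(1), of r] by blast
  define D where "D = 2 * e + M / e + M + 8 * C"
  have D: "D \<ge> 0" "8 * C \<le> D" "2 * e + M / e + M \<le> D" using e C M by (auto simp: D_def)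
  have "\<bar>(if norm (x + w - b) \<le> r + 1 then f (x + w - b) else 0) - f x - f' x (w - b) - f'' x w w / 2\<bar>
      \<le> \<epsilon> * (norm w)\<^sup>2 + D * (norm w ^ 4 + (norm b)\<^sup>2 + norm b ^ 4)" if x: "norm x \<le> r" for x w b
  proof -
    define A where "A = (if norm (x + w - b) \<le> r + 1 then f (x + w - b) else 0) - f x - f' x (w - b)"
    define p q where "p = norm w" and "q = norm b"
    have pq: "p \<ge> 0" "q \<ge> 0" by (auto simp: p_def q_def)
    have n: "norm (w - b) \<le> p + q" unfolding p_def q_def by (rule norm_triangle_ineq4)
    have sq: "(p + q)\<^sup>2 \<le> 2 * p\<^sup>2 + 2 * q\<^sup>2"
      using sum_squares_bound[of p q] by (simp add: power2_sum)
    have s2: "(norm (w - b))\<^sup>2 \<le> 2 * p\<^sup>2 + 2 * q\<^sup>2"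
      using power_mono[OF n, of 2] sq by simp
    have "norm (w - b) ^ 4 = ((norm (w - b))\<^sup>2)\<^sup>2" by (simp flip: power_mult)
    also have "\<dots> \<le> (2 * p\<^sup>2 + 2 * q\<^sup>2)\<^sup>2" using s2 by (intro power_mono) auto
    also have "\<dots> \<le> 2 * (2 * p\<^sup>2)\<^sup>2 + 2 * (2 * q\<^sup>2)\<^sup>2"
      using sum_squares_bound[of "2 * p\<^sup>2" "2 * q\<^sup>2"] by (simp only: power2_sum)
    also have "\<dots> = 8 * p ^ 4 + 8 * q ^ 4" by (simp add: power_mult_distrib flip: power_mult)
    finally have s4: "norm (w - b) ^ 4 \<le> 8 * p ^ 4 + 8 * q ^ 4" .
    have "\<bar>A - f'' x (w - b) (w - b) / 2\<bar> \<le> e * (norm (w - b))\<^sup>2 + C * norm (w - b) ^ 4"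
      using C(2)[OF x, of "w - b"] unfolding A_def add_diff_eq .
    also have "\<dots> \<le> e * (2 * p\<^sup>2 + 2 * q\<^sup>2) + C * (8 * p ^ 4 + 8 * q ^ 4)"
      using e C by (intro add_mono mult_left_mono s2 s4) auto
    finally have 1: "\<bar>A - f'' x (w - b) (w - b) / 2\<bar> \<le> e * (2 * p\<^sup>2 + 2 * q\<^sup>2) + C * (8 * p ^ 4 + 8 * q ^ 4)" .
    have bb: "\<bar>f'' x y z\<bar> \<le> M * (norm y * norm z)" for y z
      using order_trans[OF abs_blinfun2_le mult_right_mono[OF mult_right_mono[OF M(2)[OF x]]]]
      by (simp add: mult.assoc)
    have pqe: "p * q \<le> e * p\<^sup>2 + q\<^sup>2 / e"
    proof -
      have "2 * (sqrt e * p) * (q / sqrt e) \<le> (sqrt e * p)\<^sup>2 + (q / sqrt e)\<^sup>2"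
        by (rule sum_squares_bound)
      then have "2 * (p * q) \<le> e * p\<^sup>2 + q\<^sup>2 / e"
        using e by (simp add: power_mult_distrib power_divide)
      moreover have "0 \<le> p * q" using pq by simp
      ultimately show ?thesis by linarith
    qed
    have "f'' x w w - f'' x (w - b) (w - b) = f'' x w b + f'' x b w - f'' x b b"
      by (simp add: blinfun.bilinear_simps)
    moreover have "\<bar>f'' x w b\<bar> \<le> M * (p * q)" "\<bar>f'' x b w\<bar> \<le> M * (p * q)" "\<bar>f'' x b b\<bar> \<le> M * q\<^sup>2"
      using bb[of w b] bb[of b w] bb[of b b] by (simp_all add: p_def q_def mult_ac power2_eq_square)
    ultimately have "\<bar>f'' x w w / 2 - f'' x (w - b) (w - b) / 2\<bar> \<le> M * (p * q) + M * q\<^sup>2"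
      by linarith
    also have "\<dots> \<le> M * (e * p\<^sup>2 + q\<^sup>2 / e) + M * q\<^sup>2"
      using M pqe by (intro add_mono mult_left_mono) auto
    finally have "\<bar>A - f'' x w w / 2\<bar> \<le> (e * (2 * p\<^sup>2 + 2 * q\<^sup>2) + C * (8 * p ^ 4 + 8 * q ^ 4)) + (M * (e * p\<^sup>2 + q\<^sup>2 / e) + M * q\<^sup>2)"
      using 1 by linarith
    also have "\<dots> = \<epsilon> * p\<^sup>2 + (8 * C * p ^ 4 + (2 * e + M / e + M) * q\<^sup>2 + 8 * C * q ^ 4)"
      by (simp add: e(2) algebra_simps)
    also have "\<dots> \<le> \<epsilon> * p\<^sup>2 + (D * p ^ 4 + D * q\<^sup>2 + D * q ^ 4)"
      using D by (intro add_mono mult_right_mono order_refl) auto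
    finally show ?thesis unfolding A_def p_def q_def by (simp add: distrib_left)
  qed
  then show ?thesis using D(1) by blast
qed

section \<open>The differential operator in terms of Frechet derivatives\<close>

lemma axis_axis_nth: "axis i (axis j 1) $ k $ l = (if k = i \<and> l = j then 1 else (0::real))"
  by (simp add: axis_def)

lemma matrix_axis_expansion: "A = (\<Sum>i\<in>UNIV. \<Sum>j\<in>UNIV. A $ i $ j *\<^sub>R axis i (axis j 1))"
  for A :: "real^'d^'n"
proof -
  have "(\<Sum>i\<in>UNIV. \<Sum>j\<in>UNIV. A $ i $ j * (if k = i \<and> l = j then 1 else 0)) = A $ k $ l" for k l
  proof -
    have "(\<Sum>j\<in>UNIV. A $ i $ j * (if k = i \<and> l = j then 1 else 0)) = (if k = i then A $ i $ l else 0)" for i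
      by (cases "k = i") (simp_all add: if_distrib[of "(*) _"] cong: if_cong)
    then show ?thesis by simp
  qed
  then show ?thesis by (simp add: vec_eq_iff axis_axis_nth)
qed

lemma linear_axis_expansion:
  fixes g :: "real^'d^'n \<Rightarrow> 'b::real_vector"
  assumes "linear g"
  shows "g A = (\<Sum>i\<in>UNIV. \<Sum>j\<in>UNIV. A $ i $ j *\<^sub>R g (axis i (axis j 1)))"
  by (subst matrix_axis_expansion[of A]) (simp add: linear_sum[OF assms] linear_scale[OF assms])

lemma partial_eq:
  assumes "(f has_derivative D) (at X)"
  shows "partial i j f X = D (axis i (axis j 1))"
proof -
  have "((\<lambda>h. X + h *\<^sub>R axis i (axis j 1)) has_derivative (\<lambda>h. h *\<^sub>R axis i (axis j 1))) (at 0)"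
    by (auto intro!: derivative_eq_intros)
  from has_derivative_compose[OF this, of f D] assms
  have "((\<lambda>h. f (X + h *\<^sub>R axis i (axis j 1))) has_derivative (\<lambda>h. D (h *\<^sub>R axis i (axis j 1)))) (at 0)"
    by simp
  moreover have "D (h *\<^sub>R axis i (axis j 1)) = D (axis i (axis j 1)) * h" for h
    using linear_scale[OF has_derivative_linear[OF assms]] by (simp add: mult.commute)
  ultimately have "((\<lambda>h. f (X + h *\<^sub>R axis i (axis j 1))) has_real_derivative D (axis i (axis j 1))) (at 0)"
    by (simp add: has_field_derivative_def)
  then show ?thesis unfolding partial_def by (rule DERIV_imp_deriv)
qed

text \<open>Partial derivatives are values of the Frechet derivatives at unit matrices. The outer
  operator \<open>partial i j\<close> differentiates \<open>f'\<close> and so supplies the first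
  argument of \<open>f''\<close>; the inner one supplies the second.\<close>

lemma OU_operator_eq:
  fixes f :: "real^'d^'n \<Rightarrow> real" and f' :: "real^'d^'n \<Rightarrow> (real^'d^'n) \<Rightarrow>\<^sub>L real"
  assumes f': "\<And>x. (f has_derivative blinfun_apply (f' x)) (at x)"
    and f'': "\<And>x. (f' has_derivative blinfun_apply (f'' x)) (at x)"
    and "sym_matrix \<Sigma>"
  shows "- trace (transpose X ** nabla f X) + trace (\<Sigma> ** nabla_quad \<Psi> f X) =
    - f' X X + (\<Sum>i\<in>UNIV. \<Sum>k\<in>UNIV. \<Sum>j\<in>UNIV. \<Sum>l\<in>UNIV.
      \<Psi> $ i $ k * \<Sigma> $ j $ l * f'' X (axis i (axis j 1)) (axis k (axis l 1)))"
proof -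
  have p1: "partial k l f = (\<lambda>X. f' X (axis k (axis l 1)))" for k l
    by (rule ext, rule partial_eq, rule f')
  have p2: "partial i j (partial k l f) X = f'' X (axis i (axis j 1)) (axis k (axis l 1))" for i j k l
    unfolding p1
    by (rule partial_eq, rule bounded_linear.has_derivative[OF blinfun.bounded_linear_left f''])
  have "f' X X = (\<Sum>i\<in>UNIV. \<Sum>j\<in>UNIV. X $ i $ j * f' X (axis i (axis j 1)))"
    using linear_axis_expansion[OF bounded_linear.linear[OF blinfun.bounded_linear_right], of "f' X" X]
    by simp
  then show ?thesis
    unfolding trace_nabla trace_nabla_quad[OF assms(3)] p2 by (simp add: p1)
qed

lemma sandwich_axis:
  fixes P :: "real^'n^'n" and Q :: "real^'d^'d"
  shows "P ** axis i (axis j 1) ** Q = (\<Sum>k\<in>UNIV. \<Sum>l\<in>UNIV. (P $ k $ i * Q $ j $ l) *\<^sub>R axis k (axis l 1))"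
proof -
  have 1: "(P ** axis i (axis j 1)) $ k $ m = (if m = j then P $ k $ i else 0)" for k m
  proof -
    have "(\<Sum>k'\<in>UNIV. P $ k $ k' * (if k' = i \<and> m = j then 1 else 0)) = (if m = j then P $ k $ i else 0)"
      by (cases "m = j") (simp_all add: if_distrib[of "(*) _"] cong: if_cong)
    then show ?thesis by (simp add: matrix_matrix_mult_def axis_axis_nth)
  qed
  have "(P ** axis i (axis j 1) ** Q) $ k $ l = P $ k $ i * Q $ j $ l" for k l
    unfolding matrix_matrix_mult_def[of "P ** axis i (axis j 1)" Q]
    by (simp add: 1 if_distrib[of "\<lambda>x. x * _"] cong: if_cong)
  then show ?thesis
    by (subst matrix_axis_expansion) simp
qed

text \<open>The unit matrices form an orthonormal basis, so the left side contracts \<open>T\<close>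
  with the covariance of \<open>P W Q\<close> for a matrix \<open>W\<close> of independent standard
  normal entries. As \<open>P\<close> and \<open>Q\<close> are symmetric roots, the entries of this
  covariance are \<open>\<Psi> $ i $ k * \<Sigma> $ j $ l\<close>, which is the content of
  \<open>cc\<close>.\<close>

lemma sum_bilinear_sandwich:
  fixes P :: "real^'n^'n" and Q :: "real^'d^'d"
    and T :: "(real^'d^'n) \<Rightarrow>\<^sub>L (real^'d^'n) \<Rightarrow>\<^sub>L real"
  assumes P: "transpose P = P" "P ** P = \<Psi>" and Q: "transpose Q = Q" "Q ** Q = \<Sigma>"
  shows "(\<Sum>i\<in>UNIV. \<Sum>j\<in>UNIV. T (P ** axis i (axis j 1) ** Q) (P ** axis i (axis j 1) ** Q)) =
    (\<Sum>i\<in>UNIV. \<Sum>k\<in>UNIV. \<Sum>j\<in>UNIV. \<Sum>l\<in>UNIV.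
      \<Psi> $ i $ k * \<Sigma> $ j $ l * T (axis i (axis j 1)) (axis k (axis l 1)))"
proof -
  define t where "t p q = T (axis (fst p) (axis (snd p) 1)) (axis (fst q) (axis (snd q) 1))"
    for p q :: "'n \<times> 'd"
  define c where "c a p = P $ fst p $ fst a * Q $ snd a $ snd p" for a p :: "'n \<times> 'd"
  have pair: "(\<Sum>p\<in>UNIV. F p) = (\<Sum>i\<in>UNIV. \<Sum>j\<in>UNIV. F (i, j))" for F :: "'n \<times> 'd \<Rightarrow> real"
    unfolding sum.cartesian_product UNIV_Times_UNIV by (rule sum.cong) auto
  have symP: "P $ k $ i = P $ i $ k" for i k
    using P(1) unfolding transpose_def vec_eq_iff by simp
  have symQ: "Q $ k $ i = Q $ i $ k" for i k
    using Q(1) unfolding transpose_def vec_eq_iff by simp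
  have cc: "(\<Sum>a\<in>UNIV. c a p * c a q) = \<Psi> $ fst p $ fst q * \<Sigma> $ snd p $ snd q" for p q
  proof -
    have "(\<Sum>a\<in>UNIV. c a p * c a q) =
        (\<Sum>i\<in>UNIV. \<Sum>j\<in>UNIV. (P $ fst p $ i * P $ i $ fst q) * (Q $ snd p $ j * Q $ j $ snd q))"
      unfolding sum.cartesian_product
      by (rule sum.cong) (auto simp: c_def symP[of "fst q"] symQ[of _ "snd p"])
    also have "\<dots> = (\<Sum>i\<in>UNIV. P $ fst p $ i * P $ i $ fst q) * (\<Sum>j\<in>UNIV. Q $ snd p $ j * Q $ j $ snd q)"
      by (simp add: sum_product)
    finally show ?thesis by (simp add: P(2)[symmetric] Q(2)[symmetric] matrix_matrix_mult_def)
  qed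
  have expand: "P ** axis (fst a) (axis (snd a) 1) ** Q = (\<Sum>p\<in>UNIV. c a p *\<^sub>R axis (fst p) (axis (snd p) 1))" for a
    unfolding sandwich_axis sum.cartesian_product c_def by (rule sum.cong) auto
  have "(\<Sum>i\<in>UNIV. \<Sum>j\<in>UNIV. T (P ** axis i (axis j 1) ** Q) (P ** axis i (axis j 1) ** Q)) =
      (\<Sum>a\<in>UNIV. T (P ** axis (fst a) (axis (snd a) 1) ** Q) (P ** axis (fst a) (axis (snd a) 1) ** Q))"
    unfolding sum.cartesian_product by (rule sum.cong) auto
  also have "\<dots> = (\<Sum>a\<in>UNIV. \<Sum>q\<in>UNIV. \<Sum>p\<in>UNIV. c a p * c a q * t p q)"
    unfolding expand t_def
    by (simp add: blinfun.sum_left blinfun.sum_right blinfun.scaleR_left blinfun.scaleR_right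
        sum_distrib_left mult_ac)
  also have "\<dots> = (\<Sum>a\<in>UNIV. \<Sum>p\<in>UNIV. \<Sum>q\<in>UNIV. c a p * c a q * t p q)"
    by (rule sum.cong[OF refl], rule sum.swap)
  also have "\<dots> = (\<Sum>p\<in>UNIV. \<Sum>a\<in>UNIV. \<Sum>q\<in>UNIV. c a p * c a q * t p q)"
    by (rule sum.swap)
  also have "\<dots> = (\<Sum>p\<in>UNIV. \<Sum>q\<in>UNIV. \<Sum>a\<in>UNIV. c a p * c a q * t p q)"
    by (rule sum.cong[OF refl], rule sum.swap)
  also have "\<dots> = (\<Sum>p\<in>UNIV. \<Sum>q\<in>UNIV. \<Psi> $ fst p $ fst q * \<Sigma> $ snd p $ snd q * t p q)"
    by (simp add: cc flip: sum_distrib_right)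
  also have "\<dots> = (\<Sum>i\<in>UNIV. \<Sum>j\<in>UNIV. \<Sum>k\<in>UNIV. \<Sum>l\<in>UNIV.
      \<Psi> $ i $ k * \<Sigma> $ j $ l * T (axis i (axis j 1)) (axis k (axis l 1)))"
    by (simp only: pair t_def fst_conv snd_conv)
  also have "\<dots> = (\<Sum>i\<in>UNIV. \<Sum>k\<in>UNIV. \<Sum>j\<in>UNIV. \<Sum>l\<in>UNIV.
      \<Psi> $ i $ k * \<Sigma> $ j $ l * T (axis i (axis j 1)) (axis k (axis l 1)))"
    by (intro sum.cong refl) (rule sum.swap)
  finally show ?thesis .
qed

section \<open>Sums over a grid up to a stopping time\<close>

text \<open>The summands that are kept form an initial segment of the grid and telescope. Their end
  point \<open>\<sigma>\<close> is the first grid point not before \<open>T\<close>, or the last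
  grid point if there is none, so it overshoots by at most one mesh width. The outer
  \<open>max s\<close> covers \<open>T < s\<close>, where nothing is summed.\<close>

lemma stopped_sum_telescope:
  fixes p :: "real \<Rightarrow> real"
  assumes h: "h \<ge> 0"
  shows "\<exists>\<sigma>. (\<Sum>i<k. if s + real i * h < T then p (s + real (Suc i) * h) - p (s + real i * h) else 0) = p \<sigma> - p s
    \<and> \<sigma> \<le> s + real k * h \<and> max s (min (s + real k * h) T) \<le> \<sigma> \<and> \<sigma> \<le> max s (min (s + real k * h) T) + h"
proof (induction k)
  case 0
  then show ?case using h by (intro exI[of _ s]) auto
next
  case (Suc k)
  then obtain \<sigma> where \<sigma>: "(\<Sum>i<k. if s + real i * h < T then p (s + real (Suc i) * h) - p (s + real i * h) else 0) = p \<sigma> - p s"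
    "\<sigma> \<le> s + real k * h" "max s (min (s + real k * h) T) \<le> \<sigma>" "\<sigma> \<le> max s (min (s + real k * h) T) + h"
    by blast
  have next': "s + real (Suc k) * h = s + real k * h + h" by (simp add: algebra_simps)
  show ?case
  proof (cases "s + real k * h < T")
    case True
    \<comment> \<open>Since \<open>T\<close> lies beyond the current grid point, the bounds leave no
      other value, and the new summand continues the telescope.\<close>
    then have "\<sigma> = s + real k * h" using \<sigma> by auto
    moreover have "s \<le> s + real k * h" using h by simp
    ultimately show ?thesis
      using True \<sigma>(1) h unfolding next'
      by (intro exI[of _ "s + real k * h + h"]) (simp_all add: next' del: of_nat_Suc)
  next
    case False
    then show ?thesis
      using \<sigma> h unfolding next' by (intro exI[of _ \<sigma>]) auto
  qed
qed

text \<open>The telescoped sum evaluates \<open>p\<close> only at \<open>s\<close> and at points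
  that approach the stopping point from above. Continuity is therefore demanded at that point alone;
  the function to which this is applied may jump later on.\<close>

lemma stopped_sum_tendsto:
  fixes p :: "real \<Rightarrow> real"
  assumes st: "s \<le> t"
    and cont: "continuous (at (max s (min t T)) within {s..t}) p"
  shows "(\<lambda>m. \<Sum>i<Suc m. if s + real i * ((t - s) / real (Suc m)) < T
      then p (s + real (Suc i) * ((t - s) / real (Suc m))) - p (s + real i * ((t - s) / real (Suc m))) else 0)
    \<longlonglongrightarrow> p (max s (min t T)) - p s"
proof -
  let ?h = "\<lambda>m. (t - s) / real (Suc m)"
  let ?c = "max s (min t T)"
  have grid: "s + real (Suc m) * ?h m = t" for m by simp
  have "\<exists>\<sigma>. \<forall>m. (\<Sum>i<Suc m. if s + real i * ?h m < T
      then p (s + real (Suc i) * ?h m) - p (s + real i * ?h m) else 0) = p (\<sigma> m) - p s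
      \<and> \<sigma> m \<le> t \<and> ?c \<le> \<sigma> m \<and> \<sigma> m \<le> ?c + ?h m"
  proof (intro choice allI)
    fix m
    have "?h m \<ge> 0" using st by simp
    from stopped_sum_telescope[OF this, where k = "Suc m" and s = s and T = T and p = p]
    show "\<exists>\<sigma>. (\<Sum>i<Suc m. if s + real i * ?h m < T
      then p (s + real (Suc i) * ?h m) - p (s + real i * ?h m) else 0) = p \<sigma> - p s
      \<and> \<sigma> \<le> t \<and> ?c \<le> \<sigma> \<and> \<sigma> \<le> ?c + ?h m" unfolding grid by blast
  qed
  then obtain \<sigma> where \<sigma>: "\<And>m. (\<Sum>i<Suc m. if s + real i * ?h m < T
      then p (s + real (Suc i) * ?h m) - p (s + real i * ?h m) else 0) = p (\<sigma> m) - p s"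
      "\<And>m. \<sigma> m \<le> t" "\<And>m. ?c \<le> \<sigma> m" "\<And>m. \<sigma> m \<le> ?c + ?h m" by blast
  have "(\<lambda>m. ?h m) \<longlonglongrightarrow> 0" by real_asymp
  then have "(\<lambda>m. ?c + ?h m) \<longlonglongrightarrow> ?c + 0" by (intro tendsto_intros)
  then have "\<sigma> \<longlonglongrightarrow> ?c"
    by (intro tendsto_sandwich[of "\<lambda>_. ?c" \<sigma> sequentially "\<lambda>m. ?c + ?h m"] always_eventually allI \<sigma>) auto
  moreover have "\<sigma> m \<in> {s..t}" for m using \<sigma>(2,3)[of m] by auto
  ultimately have "(\<lambda>m. p (\<sigma> m)) \<longlonglongrightarrow> p ?c"
    using cont[unfolded continuous_within_sequentially] by (auto simp: o_def)
  then show ?thesis unfolding \<sigma>(1) by (intro tendsto_intros)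
qed

lemma set_lebesgue_integral_interval:
  fixes g :: "real \<Rightarrow> 'a::euclidean_space"
  assumes "continuous_on {a..b} g"
  shows "set_integrable lborel {a..b} g" "(LINT x:{a..b}|lborel. g x) = integral {a..b} g"
proof -
  show "set_integrable lborel {a..b} g" by (rule borel_integrable_atLeastAtMost'[OF assms])
  then show "(LINT x:{a..b}|lborel. g x) = integral {a..b} g"
    by (rule set_borel_integral_eq_integral(2))
qed

lemma integral_diff_initial:
  fixes g :: "real \<Rightarrow> 'a::euclidean_space"
  assumes "a \<le> u" "u \<le> v" "continuous_on {a..v} g"
  shows "integral {a..v} g - integral {a..u} g = integral {u..v} g"
  using Henstock_Kurzweil_Integration.integral_combine[OF assms(1,2) integrable_continuous_real[OF assms(3)]]
  by (simp add: algebra_simps)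

lemma grid_mem:
  assumes "s \<le> t" "i \<le> Suc m"
  shows "s + real i * ((t - s) / real (Suc m)) \<in> {s..t}"
proof -
  have "real i * ((t - s) / real (Suc m)) \<le> real (Suc m) * ((t - s) / real (Suc m))"
    using assms by (intro mult_right_mono) auto
  then show ?thesis using assms by simp
qed

lemma grid_Suc: "s + real (Suc i) * h = s + real i * h + (h::real)"
  by (simp add: algebra_simps)

text \<open>The integrand of each step has its first argument frozen at the left end point. On the
  diagonal the steps would telescope, with primitive \<open>p\<close>; by uniform continuity the
  error of freezing is a small multiple of the mesh in each step, so it vanishes in the sum.\<close>

lemma euler_sum_tendsto:
  fixes F :: "real \<Rightarrow> real" and g :: "real \<Rightarrow> real \<Rightarrow> real"
  assumes st: "s \<le> t" and g: "continuous_on ({s..t} \<times> {s..t}) (\<lambda>p. g (fst p) (snd p))"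
    and F: "continuous (at (max s (min t T)) within {s..t}) F"
  defines "x \<equiv> \<lambda>m i. s + real i * ((t - s) / real (Suc m))"
  shows "(\<lambda>m. \<Sum>i<Suc m. if x m i < T
      then F (x m (Suc i)) - F (x m i) + integral {x m i..x m (Suc i)} (g (x m i)) else 0)
    \<longlonglongrightarrow> F (max s (min t T)) - F s + integral {s..max s (min t T)} (\<lambda>r. g r r)"
proof -
  let ?c = "max s (min t T)"
  have c: "?c \<in> {s..t}" using st by auto
  define \<gamma> where "\<gamma> r = g r r" for r
  have \<gamma>: "continuous_on {s..t} \<gamma>"
    unfolding \<gamma>_def by (rule continuous_on_compose2[OF g, where f = "\<lambda>r. (r, r)", simplified]) (auto intro!: continuous_intros)
  have gq: "continuous_on {s..t} (g q)" if "q \<in> {s..t}" for q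
    by (rule continuous_on_compose2[OF g, where f = "\<lambda>r. (q, r)", simplified]) (use that in \<open>auto intro!: continuous_intros\<close>)
  define p where "p u = F u + integral {s..u} \<gamma>" for u
  have x: "x m i \<in> {s..t}" if "i \<le> Suc m" for m i
    unfolding x_def by (rule grid_mem[OF st that])
  have xS: "x m (Suc i) = x m i + (t - s) / real (Suc m)" for m i
    unfolding x_def by (rule grid_Suc)
  have mono: "x m i \<le> x m (Suc i)" for m i unfolding xS using st by simp
  have "continuous (at ?c within {s..t}) p"
    unfolding p_def using c indefinite_integral_continuous_1[OF integrable_continuous_real[OF \<gamma>]]
    by (intro continuous_intros F) (auto simp: continuous_on_eq_continuous_within)
  from stopped_sum_tendsto[OF st this]
  have main: "(\<lambda>m. \<Sum>i<Suc m. if x m i < T then p (x m (Suc i)) - p (x m i) else 0)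
      \<longlonglongrightarrow> p ?c - p s" unfolding x_def .
  define d where "d m i = (if x m i < T then integral {x m i..x m (Suc i)} (\<lambda>r. g (x m i) r - \<gamma> r) else 0)" for m i
  have "(\<lambda>m. \<Sum>i<Suc m. d m i) \<longlonglongrightarrow> 0"
  proof (rule LIMSEQ_I)
    fix e :: real assume e: "e > 0"
    \<comment> \<open>The \<open>+ 1\<close> covers \<open>s = t\<close> and makes the bound on the
      total error strict.\<close>
    define \<eta> where "\<eta> = e / (t - s + 1)"
    have \<eta>: "\<eta> > 0" "\<eta> * (t - s) < e" using e st by (auto simp: \<eta>_def field_simps)
    have "uniformly_continuous_on ({s..t} \<times> {s..t}) (\<lambda>p. g (fst p) (snd p))"
      by (intro compact_uniformly_continuous g compact_Times compact_Icc)
    then obtain \<delta> where \<delta>: "\<delta> > 0" "\<And>p p'. p \<in> {s..t} \<times> {s..t} \<Longrightarrow> p' \<in> {s..t} \<times> {s..t} \<Longrightarrow> dist p' p < \<delta> \<Longrightarrow>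
        dist (g (fst p') (snd p')) (g (fst p) (snd p)) < \<eta>"
      using \<eta>(1) unfolding uniformly_continuous_on_def by metis
    have "(\<lambda>m. (t - s) / real (Suc m)) \<longlonglongrightarrow> 0" by real_asymp
    then have "\<forall>\<^sub>F m in sequentially. (t - s) / real (Suc m) < \<delta>"
      using \<delta>(1) by (rule order_tendstoD)
    then obtain m0 where m0: "\<And>m. m \<ge> m0 \<Longrightarrow> (t - s) / real (Suc m) < \<delta>"
      by (auto simp: eventually_sequentially)
    show "\<exists>m0. \<forall>m\<ge>m0. norm ((\<Sum>i<Suc m. d m i) - 0) < e"
    proof (intro exI allI impI)
      fix m assume m: "m0 \<le> m"
      have "norm (d m i) \<le> \<eta> * ((t - s) / real (Suc m))" if i: "i < Suc m" for i
      proof (cases "x m i < T")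
        case False
        then show ?thesis using \<eta> st by (simp add: d_def)
      next
        case True
        have sub: "{x m i..x m (Suc i)} \<subseteq> {s..t}" using x[of i m] x[of "Suc i" m] i by auto
        have "norm (integral {x m i..x m (Suc i)} (\<lambda>r. g (x m i) r - \<gamma> r)) \<le> \<eta> * (x m (Suc i) - x m i)"
        proof (rule integral_bound[OF mono])
          show "continuous_on {x m i..x m (Suc i)} (\<lambda>r. g (x m i) r - \<gamma> r)"
            using i by (intro continuous_intros continuous_on_subset[OF gq sub] continuous_on_subset[OF \<gamma> sub] x) auto
          fix r assume r: "r \<in> {x m i..x m (Suc i)}"
          have "dist (x m i, r) (r, r) < \<delta>"
            using r m0[OF m] by (auto simp: dist_prod_def dist_real_def xS)
          then have "dist (g (x m i) r) (g r r) < \<eta>"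
            using \<delta>(2)[of "(r, r)" "(x m i, r)"] r sub x[of i m] i by auto
          then show "norm (g (x m i) r - \<gamma> r) \<le> \<eta>" by (simp add: \<gamma>_def dist_norm)
        qed
        then show ?thesis using True by (simp add: d_def xS)
      qed
      then have "norm (\<Sum>i<Suc m. d m i) \<le> (\<Sum>i<Suc m. \<eta> * ((t - s) / real (Suc m)))"
        by (intro sum_norm_le) auto
      also have "\<dots> = \<eta> * (t - s)" by simp
      also have "\<dots> < e" by (rule \<eta>)
      finally show "norm ((\<Sum>i<Suc m. d m i) - 0) < e" by simp
    qed
  qed
  from tendsto_add[OF main this]
  have lim: "(\<lambda>m. \<Sum>i<Suc m. (if x m i < T then p (x m (Suc i)) - p (x m i) else 0) + d m i) \<longlonglongrightarrow> p ?c - p s"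
    by (simp only: sum.distrib add_0_right)
  have step: "(if x m i < T then p (x m (Suc i)) - p (x m i) else 0) + d m i =
      (if x m i < T then F (x m (Suc i)) - F (x m i) + integral {x m i..x m (Suc i)} (g (x m i)) else 0)"
    if i: "i < Suc m" for m i
  proof -
    have sub: "{x m i..x m (Suc i)} \<subseteq> {s..t}" and le: "s \<le> x m i" and sub': "{s..x m (Suc i)} \<subseteq> {s..t}"
      using x[of i m] x[of "Suc i" m] i by auto
    have "integral {s..x m (Suc i)} \<gamma> - integral {s..x m i} \<gamma> = integral {x m i..x m (Suc i)} \<gamma>"
      by (rule integral_diff_initial[OF le mono continuous_on_subset[OF \<gamma> sub']])
    moreover have "integral {x m i..x m (Suc i)} (\<lambda>r. g (x m i) r - \<gamma> r) =
        integral {x m i..x m (Suc i)} (g (x m i)) - integral {x m i..x m (Suc i)} \<gamma>"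
      using i by (intro Henstock_Kurzweil_Integration.integral_diff integrable_continuous_real
          continuous_on_subset[OF gq sub] continuous_on_subset[OF \<gamma> sub] x) auto
    ultimately show ?thesis by (simp add: d_def p_def)
  qed
  have "(\<Sum>i<Suc m. (if x m i < T then p (x m (Suc i)) - p (x m i) else 0) + d m i) = (\<Sum>i<Suc m. if x m i < T
      then F (x m (Suc i)) - F (x m i) + integral {x m i..x m (Suc i)} (g (x m i)) else 0)" for m
    by (rule sum.cong[OF refl], rule step) simp
  then have "(\<lambda>m. \<Sum>i<Suc m. if x m i < T
      then F (x m (Suc i)) - F (x m i) + integral {x m i..x m (Suc i)} (g (x m i)) else 0) \<longlonglongrightarrow> p ?c - p s"
    using lim by (simp only:)
  moreover have "p ?c - p s = F ?c - F s + integral {s..?c} (\<lambda>r. g r r)"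
    by (simp add: p_def \<gamma>_def[abs_def])
  ultimately show ?thesis by (simp only:)
qed

lemma euler_sum_bound:
  fixes F :: "real \<Rightarrow> real" and g :: "real \<Rightarrow> real \<Rightarrow> real"
  assumes st: "s \<le> t" and F: "\<And>u. u \<in> {s..t} \<Longrightarrow> \<bar>F u\<bar> \<le> K0"
    and g: "\<And>q. q \<in> {s..t} \<Longrightarrow> continuous_on {s..t} (g q)"
    and K1: "\<And>q r. q \<in> {s..t} \<Longrightarrow> r \<in> {s..t} \<Longrightarrow> q < T \<Longrightarrow> \<bar>g q r\<bar> \<le> K1" "K1 \<ge> 0"
  defines "x \<equiv> \<lambda>m i. s + real i * ((t - s) / real (Suc m))"
  shows "\<bar>\<Sum>i<Suc m. if x m i < T
      then F (x m (Suc i)) - F (x m i) + integral {x m i..x m (Suc i)} (g (x m i)) else 0\<bar>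
    \<le> 2 * K0 + K1 * (t - s)"
proof -
  have x: "x m i \<in> {s..t}" if "i \<le> Suc m" for m i
    unfolding x_def by (rule grid_mem[OF st that])
  have xS: "x m (Suc i) = x m i + (t - s) / real (Suc m)" for m i
    unfolding x_def by (rule grid_Suc)
  have mono: "x m i \<le> x m (Suc i)" for m i unfolding xS using st by simp
  define I where "I i = (if x m i < T then integral {x m i..x m (Suc i)} (g (x m i)) else 0)" for i
  have h: "(t - s) / real (Suc m) \<ge> 0" using st by simp
  obtain \<sigma> where \<sigma>: "(\<Sum>i<Suc m. if x m i < T then F (x m (Suc i)) - F (x m i) else 0) = F \<sigma> - F s"
      "\<sigma> \<le> x m (Suc m)" "s \<le> \<sigma>"
    using stopped_sum_telescope[OF h, where k = "Suc m" and s = s and T = T and p = F] unfolding x_def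
    by (auto simp del: of_nat_Suc sum.lessThan_Suc)
  have "\<bar>I i\<bar> \<le> K1 * ((t - s) / real (Suc m))" if i: "i < Suc m" for i
  proof (cases "x m i < T")
    case False
    then show ?thesis using K1(2) st by (simp add: I_def)
  next
    case True
    have sub: "{x m i..x m (Suc i)} \<subseteq> {s..t}" using x[of i m] x[of "Suc i" m] i by auto
    have "norm (integral {x m i..x m (Suc i)} (g (x m i))) \<le> K1 * (x m (Suc i) - x m i)"
      using i True K1(1)[OF x] sub
      by (intro integral_bound[OF mono] continuous_on_subset[OF g sub] x) auto
    then show ?thesis using True by (simp add: I_def xS)
  qed
  then have "\<bar>\<Sum>i<Suc m. I i\<bar> \<le> (\<Sum>i<Suc m. K1 * ((t - s) / real (Suc m)))"
    by (intro order_trans[OF sum_abs sum_mono]) auto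
  also have "\<dots> = K1 * (t - s)" by simp
  finally have "\<bar>\<Sum>i<Suc m. I i\<bar> \<le> K1 * (t - s)" .
  moreover have "(\<Sum>i<Suc m. if x m i < T
      then F (x m (Suc i)) - F (x m i) + integral {x m i..x m (Suc i)} (g (x m i)) else 0) =
      (\<Sum>i<Suc m. if x m i < T then F (x m (Suc i)) - F (x m i) else 0) + (\<Sum>i<Suc m. I i)"
    unfolding sum.distrib[symmetric] I_def by (intro sum.cong) auto
  moreover have "\<bar>F \<sigma> - F s\<bar> \<le> 2 * K0"
    using F[of \<sigma>] F[of s] \<sigma>(2,3) x[of "Suc m" m] st by (auto simp: abs_le_iff)
  ultimately show ?thesis unfolding \<sigma>(1) by linarith
qed

section \<open>Processes with continuous paths\<close>

text \<open>Rounding the time down to multiples of \<open>1 / Suc m\<close> leaves countably many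
  measurable sections, hence a jointly measurable approximation, and continuity of the paths gives
  the limit. The clamp to \<open>[0, T]\<close> extends the process to all real times without
  leaving the range in which it is measurable.\<close>

lemma jointly_measurable_continuous_paths:
  fixes Z :: "real \<Rightarrow> 'w \<Rightarrow> 'a::{metric_space, second_countable_topology}"
  assumes T: "T \<ge> 0"
    and meas: "\<And>r. 0 \<le> r \<Longrightarrow> r \<le> T \<Longrightarrow> Z r \<in> borel_measurable N"
    and cont: "\<And>\<omega>. \<omega> \<in> space N \<Longrightarrow> continuous_on {0..T} (\<lambda>r. Z r \<omega>)"
  shows "(\<lambda>(\<omega>, r). Z (max 0 (min T r)) \<omega>) \<in> borel_measurable (N \<Otimes>\<^sub>M lborel)"
proof -
  define c where "c r = max 0 (min T r)" for r
  have c: "c r \<in> {0..T}" for r using T by (auto simp: c_def)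
  have "(\<lambda>x. Z (c (snd x)) (fst x)) \<in> borel_measurable (N \<Otimes>\<^sub>M lborel)"
  proof (rule borel_measurable_LIMSEQ_metric)
    fix m :: nat
    have [measurable]: "Z (c r) \<in> borel_measurable N" for r
      using c[of r] by (intro meas) auto
    show "(\<lambda>x. Z (c (of_int \<lfloor>real (Suc m) * snd x\<rfloor> / real (Suc m))) (fst x)) \<in> borel_measurable (N \<Otimes>\<^sub>M lborel)"
      by (rule measurable_compose_countable[where f = "\<lambda>k x. Z (c (of_int k / real (Suc m))) (fst x)"]) measurable
  next
    fix x :: "'w \<times> real" assume x: "x \<in> space (N \<Otimes>\<^sub>M lborel)"
    obtain \<omega> r where x': "x = (\<omega>, r)" "\<omega> \<in> space N" using x by (cases x) (auto simp: space_pair_measure)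
    have "(\<lambda>m. of_int \<lfloor>real (Suc m) * r\<rfloor> / real (Suc m)) \<longlonglongrightarrow> r"
    proof (rule tendsto_sandwich)
      show "(\<lambda>m. r - 1 / real (Suc m)) \<longlonglongrightarrow> r" by real_asymp
      show "\<forall>\<^sub>F m in sequentially. r - 1 / real (Suc m) \<le> of_int \<lfloor>real (Suc m) * r\<rfloor> / real (Suc m)"
      proof (intro always_eventually allI)
        fix m
        have "real (Suc m) * r - 1 \<le> of_int \<lfloor>real (Suc m) * r\<rfloor>" by linarith
        then have "(real (Suc m) * r - 1) / real (Suc m) \<le> of_int \<lfloor>real (Suc m) * r\<rfloor> / real (Suc m)"
          by (rule divide_right_mono) simp
        then show "r - 1 / real (Suc m) \<le> of_int \<lfloor>real (Suc m) * r\<rfloor> / real (Suc m)"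
          by (simp add: diff_divide_distrib)
      qed
      show "\<forall>\<^sub>F m in sequentially. of_int \<lfloor>real (Suc m) * r\<rfloor> / real (Suc m) \<le> r"
      proof (intro always_eventually allI)
        fix m
        have "of_int \<lfloor>real (Suc m) * r\<rfloor> / real (Suc m) \<le> (real (Suc m) * r) / real (Suc m)"
          by (rule divide_right_mono) linarith+
        then show "of_int \<lfloor>real (Suc m) * r\<rfloor> / real (Suc m) \<le> r" by simp
      qed
    qed simp
    then have "(\<lambda>m. c (of_int \<lfloor>real (Suc m) * r\<rfloor> / real (Suc m))) \<longlonglongrightarrow> c r"
      unfolding c_def by (intro tendsto_intros)
    then show "(\<lambda>m. Z (c (of_int \<lfloor>real (Suc m) * snd x\<rfloor> / real (Suc m))) (fst x)) \<longlonglongrightarrow> Z (c (snd x)) (fst x)"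
      unfolding x' fst_conv snd_conv
      by (intro continuous_on_tendsto_compose[OF cont[OF x'(2)]] c always_eventually allI)
  qed
  then show ?thesis by (simp add: c_def case_prod_beta')
qed

text \<open>With \<open>N = F t\<close> and \<open>T = t\<close> this is what makes time integrals
  up to \<open>t\<close> adapted.\<close>

lemma integral_continuous_paths_measurable:
  fixes Z :: "real \<Rightarrow> 'w \<Rightarrow> 'a::euclidean_space"
  assumes "T \<ge> 0"
    and "\<And>r. 0 \<le> r \<Longrightarrow> r \<le> T \<Longrightarrow> Z r \<in> borel_measurable N"
    and "\<And>\<omega>. \<omega> \<in> space N \<Longrightarrow> continuous_on {0..T} (\<lambda>r. Z r \<omega>)"
    and S: "S \<subseteq> {0..T}" "S \<in> sets borel"
  shows "(\<lambda>\<omega>. LINT r:S|lborel. Z r \<omega>) \<in> borel_measurable N"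
proof -
  have [measurable]: "(\<lambda>(\<omega>, r). Z (max 0 (min T r)) \<omega>) \<in> borel_measurable (N \<Otimes>\<^sub>M lborel)"
    using assms(1-3) by (rule jointly_measurable_continuous_paths)
  have [measurable]: "S \<in> sets borel" by (rule S)
  have "(\<lambda>\<omega>. LINT r|lborel. indicator S r *\<^sub>R Z (max 0 (min T r)) \<omega>) \<in> borel_measurable N"
    by measurable
  also have "(\<lambda>\<omega>. LINT r|lborel. indicator S r *\<^sub>R Z (max 0 (min T r)) \<omega>) = (\<lambda>\<omega>. LINT r:S|lborel. Z r \<omega>)"
    unfolding set_lebesgue_integral_def using S(1)
    by (intro ext Bochner_Integration.integral_cong) (auto simp: indicator_def subset_iff)
  finally show ?thesis .
qed

text \<open>Inserting the level \<open>a\<close> itself makes the infimum range over a nonempty set and the hitting time finite.\<close>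

definition hitting_time :: "(real \<Rightarrow> 'w \<Rightarrow> 'a::real_normed_vector) \<Rightarrow> real \<Rightarrow> 'w \<Rightarrow> real" where
  "hitting_time X a \<omega> = Inf (insert a {t. 0 \<le> t \<and> a \<le> norm (X t \<omega>)})"

context
  fixes X :: "real \<Rightarrow> 'w \<Rightarrow> 'a::real_normed_vector" and a :: real and \<omega> :: 'w
  assumes cont: "continuous_on {0..} (\<lambda>t. X t \<omega>)" and a: "a \<ge> 0"
begin

lemma hitting_time_mem:
  "hitting_time X a \<omega> = a \<or> (0 \<le> hitting_time X a \<omega> \<and> a \<le> norm (X (hitting_time X a \<omega>) \<omega>))"
proof -
  have "{t. 0 \<le> t \<and> a \<le> norm (X t \<omega>)} = {0..} \<inter> (\<lambda>t. norm (X t \<omega>)) -` {a..}" by auto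
  also have "closed \<dots>"
    by (intro continuous_closed_preimage continuous_intros cont)
  finally have "closed (insert a {t. 0 \<le> t \<and> a \<le> norm (X t \<omega>)})" by simp
  moreover have "bdd_below (insert a {t. 0 \<le> t \<and> a \<le> norm (X t \<omega>)})"
    by (rule bdd_belowI[of _ 0]) (use a in auto)
  ultimately have "Inf (insert a {t. 0 \<le> t \<and> a \<le> norm (X t \<omega>)}) \<in> insert a {t. 0 \<le> t \<and> a \<le> norm (X t \<omega>)}"
    by (intro closed_contains_Inf) auto
  then show ?thesis by (auto simp: hitting_time_def)
qed

lemma hitting_time_nonneg: "0 \<le> hitting_time X a \<omega>"
  unfolding hitting_time_def by (rule cInf_greatest) (use a in auto)

lemma hitting_time_le: "hitting_time X a \<omega> \<le> t \<longleftrightarrow> a \<le> t \<or> (\<exists>r\<in>{0..t}. a \<le> norm (X r \<omega>))"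
proof -
  have bdd: "bdd_below (insert a {t. 0 \<le> t \<and> a \<le> norm (X t \<omega>)})"
    by (rule bdd_belowI[of _ 0]) (use a in auto)
  have "hitting_time X a \<omega> \<le> r" if "r = a \<or> 0 \<le> r \<and> a \<le> norm (X r \<omega>)" for r
    unfolding hitting_time_def by (rule cInf_lower[OF _ bdd]) (use that in auto)
  then show ?thesis using hitting_time_mem by fastforce
qed

lemma norm_before_hitting_time:
  assumes "0 \<le> r" "r < hitting_time X a \<omega>"
  shows "norm (X r \<omega>) < a"
  using hitting_time_le[of r] assms by force

text \<open>Positivity of the hitting time excludes a start outside the ball, for which the bound
  would fail at time 0. The strict bound before the hitting time then extends to the closed interval
  by continuity.\<close>

lemma norm_until_hitting_time:
  assumes "0 \<le> r" "r \<le> hitting_time X a \<omega>" "0 < hitting_time X a \<omega>"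
  shows "norm (X r \<omega>) \<le> a"
proof -
  let ?T = "hitting_time X a \<omega>"
  have "closure {0..<?T} = {0..?T}" using assms(3) by simp
  moreover have "continuous_on {0..?T} (\<lambda>t. norm (X t \<omega>))"
    by (intro continuous_intros continuous_on_subset[OF cont]) auto
  ultimately show ?thesis
    using continuous_le_on_closure[of "{0..<?T}" "\<lambda>t. norm (X t \<omega>)" r a] assms
      norm_before_hitting_time by (force intro: less_imp_le)
qed

end

lemma hitting_time_mono:
  assumes "continuous_on {0..} (\<lambda>t. X t \<omega>)" "0 \<le> a" "a \<le> b"
  shows "hitting_time X a \<omega> \<le> hitting_time X b \<omega>"
  using hitting_time_le[where X = X and \<omega> = \<omega>, OF assms(1,2), of "hitting_time X b \<omega>"]
    hitting_time_le[where X = X and \<omega> = \<omega> and a = b, OF assms(1), of "hitting_time X b \<omega>"] assms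
  by (auto intro: order_trans)

lemma hitting_time_tendsto_infinity:
  fixes X :: "real \<Rightarrow> 'w \<Rightarrow> 'a::real_normed_vector"
  assumes "continuous_on {0..} (\<lambda>t. X t \<omega>)"
  shows "filterlim (\<lambda>n. hitting_time X (real n) \<omega>) at_top sequentially"
  unfolding filterlim_at_top
proof
  fix K :: real
  have "compact ((\<lambda>t. X t \<omega>) ` {0..K})"
    by (intro compact_continuous_image continuous_on_subset[OF assms]) auto
  then obtain b where b: "\<And>t. t \<in> {0..K} \<Longrightarrow> norm (X t \<omega>) \<le> b"
    using compact_imp_bounded[of "(\<lambda>t. X t \<omega>) ` {0..K}"] unfolding bounded_iff by (meson imageI)
  \<comment> \<open>A level \<open>n > K\<close> rules out that the inserted level itself is the
    infimum by time \<open>K\<close>, and \<open>n > b\<close> rules out that the path reaches norm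
    \<open>n\<close> by then.\<close>
  have "\<forall>\<^sub>F n in sequentially. max b K < real n"
    by (rule eventually_gt_at_top[THEN filterlim_real_sequentially[unfolded filterlim_iff, rule_format]])
  then show "\<forall>\<^sub>F n in sequentially. K \<le> hitting_time X (real n) \<omega>"
  proof eventually_elim
    case (elim n)
    then have "\<not> hitting_time X (real n) \<omega> \<le> K"
      using b by (subst hitting_time_le[where X = X and \<omega> = \<omega>, OF assms]) force+
    then show ?case by simp
  qed
qed

lemma adapted_measurable_later:
  assumes "filtration \<Omega> F" "adapted F Y" "0 \<le> r" "r \<le> t"
  shows "Y r \<in> borel_measurable (F t)"
proof (rule measurable_from_subalg)
  interpret filtration \<Omega> F by fact
  show "subalgebra (F t) (F r)"
    using sets_F_mono[OF assms(4)] by (auto simp: subalgebra_def space_F)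
  show "Y r \<in> borel_measurable (F r)" using assms(2,3) by (simp add: adapted_def)
qed

text \<open>The filtration may fail to be right-continuous, so the event has to be decided by the
  path on \<open>[0, t]\<close>. By continuity and compactness the level \<open>a\<close> is reached
  there exactly if, for every \<open>k\<close>, some rational time clamped to \<open>[0, t]\<close>
  carries a norm above \<open>a - 1 / Suc k\<close>; this is a countable condition.\<close>

lemma stopping_time_hitting_time:
  fixes X :: "real \<Rightarrow> 'w \<Rightarrow> 'a::{real_normed_vector, second_countable_topology}"
  assumes "filtration \<Omega> F" "adapted F X" "a \<ge> 0"
    and cont: "\<And>\<omega>. \<omega> \<in> \<Omega> \<Longrightarrow> continuous_on {0..} (\<lambda>t. X t \<omega>)"
  shows "stopping_time F (hitting_time X a)"
proof
  interpret filtration \<Omega> F by fact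
  fix t
  show "Measurable.pred (F t) (\<lambda>\<omega>. hitting_time X a \<omega> \<le> t)"
  proof (cases "0 \<le> t \<and> t < a")
    case False
    have "\<forall>\<omega>\<in>space (F t). (hitting_time X a \<omega> \<le> t) = (a \<le> t)"
      using False assms(3) by (auto simp: space_F hitting_time_le[where X = X, OF cont])
    then show ?thesis
      by (subst measurable_cong[where g = "\<lambda>_. a \<le> t"]) auto
  next
    case True
    define c where "c r = max 0 (min t r)" for r
    have c: "c r \<in> {0..t}" "r \<in> {0..t} \<Longrightarrow> c r = r" for r using True by (auto simp: c_def)
    have eq: "(hitting_time X a \<omega> \<le> t) \<longleftrightarrow> (\<forall>k::nat. \<exists>q::rat. norm (X (c (of_rat q)) \<omega>) > a - 1 / Suc k)"
      if "\<omega> \<in> \<Omega>" for \<omega>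
    proof -
      have "continuous_on UNIV (\<lambda>r. X (c r) \<omega>)"
        by (rule continuous_on_compose2[OF cont[OF that]]) (use c(1) in \<open>auto simp: c_def intro!: continuous_intros\<close>)
      then have pc: "continuous_on UNIV (\<lambda>r. norm (X (c r) \<omega>))" by (intro continuous_intros)
      have "(hitting_time X a \<omega> \<le> t) \<longleftrightarrow> (\<exists>r\<in>{0..t}. a \<le> norm (X r \<omega>))"
        using True assms(3) by (simp add: hitting_time_le[where X = X, OF cont[OF that]])
      also have "\<dots> \<longleftrightarrow> (\<forall>k::nat. \<exists>q::rat. norm (X (c (of_rat q)) \<omega>) > a - 1 / Suc k)"
      proof safe
        fix r k assume r: "r \<in> {0..t}" "a \<le> norm (X r \<omega>)"
        have "open {u. norm (X (c u) \<omega>) > a - 1 / Suc k}"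
          by (intro open_Collect_less continuous_on_const pc)
        moreover have "r \<in> {u. norm (X (c u) \<omega>) > a - 1 / Suc k}"
          using r c(2)[OF r(1)] zero_less_one by (simp only: mem_Collect_eq) (smt (verit) divide_pos_pos of_nat_0_less_iff zero_less_Suc)
        ultimately obtain e where e: "e > 0" "ball r e \<subseteq> {u. norm (X (c u) \<omega>) > a - 1 / Suc k}"
          using open_contains_ball by blast
        obtain q where "r < of_rat q" "of_rat q < r + e" using of_rat_dense[of r "r + e"] e(1) by auto
        then have "of_rat q \<in> ball r e" by (simp add: dist_real_def)
        then show "\<exists>q. a - 1 / Suc k < norm (X (c (of_rat q)) \<omega>)" using e by blast
      next
        assume *: "\<forall>k::nat. \<exists>q::rat. norm (X (c (of_rat q)) \<omega>) > a - 1 / Suc k"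
        have "\<exists>m\<in>{0..t}. \<forall>r\<in>{0..t}. norm (X (c r) \<omega>) \<le> norm (X (c m) \<omega>)"
          using True by (intro continuous_attains_sup continuous_on_subset[OF pc]) auto
        then obtain m where m: "m \<in> {0..t}" "\<And>r. r \<in> {0..t} \<Longrightarrow> norm (X r \<omega>) \<le> norm (X m \<omega>)"
          using c(2) by metis
        have "a - 1 / Suc k \<le> norm (X m \<omega>)" for k
          using * m(2)[OF c(1)] by (meson less_imp_le order_trans)
        moreover have "(\<lambda>k. a - 1 / Suc k) \<longlonglongrightarrow> a" by real_asymp
        ultimately have "a \<le> norm (X m \<omega>)" by (meson LIMSEQ_le_const2)
        then show "\<exists>r\<in>{0..t}. a \<le> norm (X r \<omega>)" using m(1) by blast
      qed
      finally show ?thesis .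
    qed
    have [measurable]: "X (c r) \<in> borel_measurable (F t)" for r
      using c(1)[of r] by (intro adapted_measurable_later[OF assms(1,2)]) auto
    show ?thesis
      by (subst measurable_cong[OF eq]) (auto simp: space_F)
  qed
qed

section \<open>Brownian increments\<close>

context prob_space
begin

lemma indep_set_indep_var:
  assumes "subalgebra M N" "subalgebra M N'" "H \<in> N \<rightarrow>\<^sub>M S" "K \<in> N' \<rightarrow>\<^sub>M S'"
    and "indep_set (sets N) (sets N')"
  shows "indep_var S H S' K"
  unfolding indep_var_eq
proof (intro conjI)
  show "random_variable S H" using assms(1,3) by (rule measurable_from_subalg)
  show "random_variable S' K" using assms(2,4) by (rule measurable_from_subalg)
  have "sigma_sets (space M) {H -` A \<inter> space M |A. A \<in> sets S} \<subseteq> sets N"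
    if "subalgebra M N" "H \<in> N \<rightarrow>\<^sub>M S" for N H and S :: "'b measure"
  proof (rule sets.sigma_sets_subset')
    show "{H -` A \<inter> space M |A. A \<in> sets S} \<subseteq> sets N"
      using that by (auto simp: subalgebra_def dest: measurable_sets)
    show "space M \<in> sets N" using that(1) sets.top[of N] by (simp add: subalgebra_def)
  qed
  from this[OF assms(1,3)] this[OF assms(2,4)]
  show "indep_set (sigma_sets (space M) {H -` A \<inter> space M |A. A \<in> sets S})
     (sigma_sets (space M) {K -` A \<inter> space M |A. A \<in> sets S'})"
    using assms(5) unfolding indep_sets2_eq by blast
qed

lemma indep_vars_expectation_mult:
  fixes X :: "'i \<Rightarrow> 'a \<Rightarrow> real"
  assumes "indep_vars (\<lambda>_. borel) X I" "i \<in> I" "j \<in> I" "i \<noteq> j" "integrable M (X i)" "integrable M (X j)"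
  shows "expectation (\<lambda>\<omega>. X i \<omega> * X j \<omega>) = expectation (X i) * expectation (X j)"
proof -
  have "indep_vars (\<lambda>_. borel) X {i, j}"
    by (rule indep_vars_subset[OF assms(1)]) (use assms in auto)
  then have "expectation (\<lambda>\<omega>. \<Prod>k\<in>{i, j}. X k \<omega>) = (\<Prod>k\<in>{i, j}. expectation (X k))"
    by (rule indep_vars_lebesgue_integral[rotated]) (use assms in auto)
  then show ?thesis using assms(4) by simp
qed

lemma normal_increment_moments:
  fixes Y :: "'a \<Rightarrow> real"
  assumes Y: "distributed M lborel Y (normal_density 0 \<sigma>)" and \<sigma>: "\<sigma> > 0"
  shows "integrable M (\<lambda>\<omega>. Y \<omega> ^ k)" "expectation Y = 0" "expectation (\<lambda>\<omega>. Y \<omega> ^ 2) = \<sigma>\<^sup>2"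
    "expectation (\<lambda>\<omega>. Y \<omega> ^ 4) = 3 * \<sigma> ^ 4"
proof -
  have eq: "expectation (\<lambda>\<omega>. Y \<omega> ^ k) = (LINT x|lborel. normal_density 0 \<sigma> x * (x - 0) ^ k)" for k
    using distributed_integral[OF Y, of "\<lambda>x. x ^ k"] by simp
  show "integrable M (\<lambda>\<omega>. Y \<omega> ^ k)"
    using distributed_integrable[OF Y, of "\<lambda>x. x ^ k"] integrable_normal_moment[OF \<sigma>, of 0 k] by simp
  show "expectation Y = 0"
    using eq[of 1] integral_normal_moment_odd[OF \<sigma>, of 0 0] by simp
  show "expectation (\<lambda>\<omega>. Y \<omega> ^ 2) = \<sigma>\<^sup>2"
    using eq[of 2] integral_normal_moment_even[OF \<sigma>, of 0 1] by simp
  show "expectation (\<lambda>\<omega>. Y \<omega> ^ 4) = 3 * \<sigma> ^ 4"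
    using eq[of 4] integral_normal_moment_even[OF \<sigma>, of 0 2]
    by (simp add: power_divide fact_numeral power2_eq_square power4_eq_xxxx)
qed

end

lemma norm_power2_matrix: "(norm A)\<^sup>2 = (\<Sum>i\<in>UNIV. \<Sum>j\<in>UNIV. (A $ i $ j)\<^sup>2)"
  for A :: "real^'d^'n"
  by (simp add: norm_vec_def L2_set_def sum_nonneg)

text \<open>Cauchy-Schwarz over the entries. It gives away a constant, but leaves only fourth powers
  of single entries, whose means are known.\<close>

lemma norm_power4_matrix_le:
  "norm A ^ 4 \<le> real (CARD('n) * CARD('d)) * (\<Sum>i\<in>UNIV. \<Sum>j\<in>UNIV. (A $ i $ j) ^ 4)"
  for A :: "real^'d^'n"
proof -
  have "norm A ^ 4 = (\<Sum>p\<in>UNIV. (A $ fst p $ snd p)\<^sup>2)\<^sup>2"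
    using arg_cong[OF norm_power2_matrix[of A], of "\<lambda>x. x\<^sup>2"]
    by (simp add: sum.cartesian_product case_prod_beta flip: power_mult)
  also have "\<dots> \<le> (\<Sum>p\<in>UNIV. ((A $ fst p $ snd p)\<^sup>2)\<^sup>2) * real (card (UNIV :: ('n \<times> 'd) set))"
    by (rule sum_squared_le_sum_of_squares)
  also have "\<dots> = real (CARD('n) * CARD('d)) * (\<Sum>i\<in>UNIV. \<Sum>j\<in>UNIV. (A $ i $ j) ^ 4)"
    by (simp add: sum.cartesian_product case_prod_beta flip: power_mult)
  finally show ?thesis .
qed

section \<open>One Brownian increment seen from the past\<close>

text \<open>\<open>N\<close> stands for the information at the start of a grid step and
  \<open>h\<close> for its length. The one-step estimates are made in this setting, free of the time
  index.\<close>

locale brownian_increment = prob_space M for M :: "'w measure" +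
  fixes N :: "'w measure" and \<Delta> :: "'w \<Rightarrow> real^'d^'n" and h :: real
  assumes sub: "subalgebra M N" and h: "h > 0"
    and indep_past: "indep_set (sets N) (sets (vimage_algebra (space M) \<Delta> borel))"
    and indep_entries: "indep_vars (\<lambda>_. borel) (\<lambda>(i, j) \<omega>. \<Delta> \<omega> $ i $ j) UNIV"
    and normal_entries: "\<And>i j. distributed M lborel (\<lambda>\<omega>. \<Delta> \<omega> $ i $ j) (normal_density 0 (sqrt h))"
    and meas [measurable]: "\<Delta> \<in> borel_measurable M"
begin

lemma entry_moments:
  "integrable M (\<lambda>\<omega>. (\<Delta> \<omega> $ i $ j) ^ k)" "expectation (\<lambda>\<omega>. \<Delta> \<omega> $ i $ j) = 0"
  "expectation (\<lambda>\<omega>. (\<Delta> \<omega> $ i $ j)\<^sup>2) = h" "expectation (\<lambda>\<omega>. (\<Delta> \<omega> $ i $ j) ^ 4) = 3 * h\<^sup>2"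
proof -
  have "sqrt h > 0" using h by simp
  note * = normal_increment_moments[OF normal_entries this, of i j]
  have "sqrt h ^ 4 = ((sqrt h)\<^sup>2)\<^sup>2" by (simp only: flip: power_mult) simp
  then have "sqrt h ^ 4 = h\<^sup>2" using h by simp
  then show "integrable M (\<lambda>\<omega>. (\<Delta> \<omega> $ i $ j) ^ k)" "expectation (\<lambda>\<omega>. \<Delta> \<omega> $ i $ j) = 0"
    "expectation (\<lambda>\<omega>. (\<Delta> \<omega> $ i $ j)\<^sup>2) = h" "expectation (\<lambda>\<omega>. (\<Delta> \<omega> $ i $ j) ^ 4) = 3 * h\<^sup>2"
    using * h by auto
qed

lemma entry_measurable [measurable]: "(\<lambda>\<omega>. \<Delta> \<omega> $ i $ j) \<in> borel_measurable M"
  using distributed_measurable[OF normal_entries] by simp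

lemma integrable_entry_mult: "integrable M (\<lambda>\<omega>. \<Delta> \<omega> $ i $ j * \<Delta> \<omega> $ k $ l)"
proof (rule Bochner_Integration.integrable_bound)
  show "integrable M (\<lambda>\<omega>. (\<Delta> \<omega> $ i $ j)\<^sup>2 + (\<Delta> \<omega> $ k $ l)\<^sup>2)"
    by (intro Bochner_Integration.integrable_add entry_moments)
  have "\<bar>x * y\<bar> \<le> x\<^sup>2 + y\<^sup>2" for x y :: real
  proof -
    have "2 * (\<bar>x\<bar> * \<bar>y\<bar>) \<le> x\<^sup>2 + y\<^sup>2" "0 \<le> \<bar>x\<bar> * \<bar>y\<bar>"
      using sum_squares_bound[of "\<bar>x\<bar>" "\<bar>y\<bar>"] by auto
    then show ?thesis unfolding abs_mult by linarith
  qed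
  then show "AE \<omega> in M. norm (\<Delta> \<omega> $ i $ j * \<Delta> \<omega> $ k $ l) \<le> norm ((\<Delta> \<omega> $ i $ j)\<^sup>2 + (\<Delta> \<omega> $ k $ l)\<^sup>2)"
    by (intro AE_I2) simp
qed measurable

lemma entry_covariance:
  "expectation (\<lambda>\<omega>. \<Delta> \<omega> $ i $ j * \<Delta> \<omega> $ k $ l) = (if (i, j) = (k, l) then h else 0)"
proof (cases "(i, j) = (k, l)")
  case True
  then show ?thesis using entry_moments(3)[of i j] by (simp add: power2_eq_square)
next
  case False
  have "expectation (\<lambda>\<omega>. \<Delta> \<omega> $ i $ j * \<Delta> \<omega> $ k $ l) = 0"
    using indep_vars_expectation_mult[OF indep_entries, of "(i, j)" "(k, l)"] False
      entry_moments(1)[of i j 1] entry_moments(1)[of k l 1] by (simp add: entry_moments(2))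
  then show ?thesis using False by (simp only: if_False)
qed

lemma norm_moments:
  "integrable M (\<lambda>\<omega>. (norm (\<Delta> \<omega>))\<^sup>2)" "integrable M (\<lambda>\<omega>. norm (\<Delta> \<omega>) ^ 4)"
  "expectation (\<lambda>\<omega>. (norm (\<Delta> \<omega>))\<^sup>2) = real (CARD('n) * CARD('d)) * h"
  "expectation (\<lambda>\<omega>. norm (\<Delta> \<omega>) ^ 4) \<le> 3 * (real (CARD('n) * CARD('d)))\<^sup>2 * h\<^sup>2"
proof -
  let ?S = "\<lambda>\<omega>. real (CARD('n) * CARD('d)) * (\<Sum>i\<in>UNIV. \<Sum>j\<in>UNIV. (\<Delta> \<omega> $ i $ j) ^ 4)"
  show "integrable M (\<lambda>\<omega>. (norm (\<Delta> \<omega>))\<^sup>2)"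
    unfolding norm_power2_matrix by (intro Bochner_Integration.integrable_sum entry_moments)
  show "expectation (\<lambda>\<omega>. (norm (\<Delta> \<omega>))\<^sup>2) = real (CARD('n) * CARD('d)) * h"
    unfolding norm_power2_matrix
    by (simp add: Bochner_Integration.integral_sum entry_moments)
  have S: "integrable M ?S"
    by (intro Bochner_Integration.integrable_mult_right Bochner_Integration.integrable_sum entry_moments)
  show int4: "integrable M (\<lambda>\<omega>. norm (\<Delta> \<omega>) ^ 4)"
  proof (rule Bochner_Integration.integrable_bound[OF S])
    show "AE \<omega> in M. norm (norm (\<Delta> \<omega>) ^ 4) \<le> norm (?S \<omega>)"
      using order_trans[OF norm_power4_matrix_le abs_ge_self] by (intro AE_I2) simp
  qed measurable
  have "expectation (\<lambda>\<omega>. norm (\<Delta> \<omega>) ^ 4) \<le> expectation ?S"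
    by (intro integral_mono int4 S norm_power4_matrix_le)
  also have "\<dots> = 3 * (real (CARD('n) * CARD('d)))\<^sup>2 * h\<^sup>2"
    by (simp add: Bochner_Integration.integral_sum entry_moments Bochner_Integration.integrable_sum
        power2_eq_square)
  finally show "expectation (\<lambda>\<omega>. norm (\<Delta> \<omega>) ^ 4) \<le> 3 * (real (CARD('n) * CARD('d)))\<^sup>2 * h\<^sup>2" .
qed

text \<open>\<open>H\<close> and \<open>\<phi> (\<Delta> \<omega>)\<close> are measurable with
  respect to independent \<sigma>-algebras, so the expectation factorises; the bound on
  \<open>H\<close> supplies its integrability.\<close>

lemma expectation_past_mult:
  fixes H :: "'w \<Rightarrow> real" and \<phi> :: "real^'d^'n \<Rightarrow> real"
  assumes H: "H \<in> borel_measurable N" "\<And>\<omega>. \<omega> \<in> space M \<Longrightarrow> \<bar>H \<omega>\<bar> \<le> c"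
    and \<phi> [measurable]: "\<phi> \<in> borel_measurable borel" and int: "integrable M (\<lambda>\<omega>. \<phi> (\<Delta> \<omega>))"
  shows "integrable M (\<lambda>\<omega>. H \<omega> * \<phi> (\<Delta> \<omega>))"
    "expectation (\<lambda>\<omega>. H \<omega> * \<phi> (\<Delta> \<omega>)) = expectation H * expectation (\<lambda>\<omega>. \<phi> (\<Delta> \<omega>))"
proof -
  have V: "\<Delta> \<in> borel_measurable (vimage_algebra (space M) \<Delta> borel)"
    by (rule measurable_vimage_algebra1) simp
  have "sets (vimage_algebra (space M) \<Delta> borel) \<subseteq> sets M"
    using indep_past by (simp add: indep_sets2_eq)
  then have "subalgebra M (vimage_algebra (space M) \<Delta> borel)"
    by (simp add: subalgebra_def)
  from indep_set_indep_var[OF sub this H(1) measurable_compose[OF V \<phi>] indep_past]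
  have ind: "indep_var borel H borel (\<lambda>\<omega>. \<phi> (\<Delta> \<omega>))" .
  have "H \<in> borel_measurable M" using sub H(1) by (rule measurable_from_subalg)
  then have "integrable M H"
    using H(2) by (intro integrable_const_bound[where B = c]) auto
  from indep_var_integrable[OF ind this int] indep_var_lebesgue_integral[OF ind this int]
  show "integrable M (\<lambda>\<omega>. H \<omega> * \<phi> (\<Delta> \<omega>))"
    "expectation (\<lambda>\<omega>. H \<omega> * \<phi> (\<Delta> \<omega>)) = expectation H * expectation (\<lambda>\<omega>. \<phi> (\<Delta> \<omega>))" by auto
qed

end

context brownian_increment
begin

text \<open>In terms of the entries of \<open>\<Delta>\<close>, each coefficient is a bounded
  variable of the past. The linear terms have mean 0, the off-diagonal products have mean 0, and the
  squares have mean \<open>h\<close>, which the subtracted trace cancels.\<close>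

lemma one_step_mean_zero:
  fixes G :: "'w set" and a :: "'w \<Rightarrow> 'a::euclidean_space" and L :: "real^'d^'n \<Rightarrow> 'a"
    and D1 :: "'a \<Rightarrow> 'a \<Rightarrow>\<^sub>L real" and D2 :: "'a \<Rightarrow> 'a \<Rightarrow>\<^sub>L 'a \<Rightarrow>\<^sub>L real"
  assumes G: "G \<in> sets N" and a: "a \<in> borel_measurable N" "\<And>\<omega>. \<omega> \<in> G \<Longrightarrow> norm (a \<omega>) \<le> r"
    and L: "linear L" and D1: "continuous_on UNIV D1" and D2: "continuous_on UNIV D2"
  defines "A \<equiv> \<lambda>\<omega>. indicator G \<omega> * (D1 (a \<omega>) (L (\<Delta> \<omega>)) + D2 (a \<omega>) (L (\<Delta> \<omega>)) (L (\<Delta> \<omega>)) / 2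
      - h * ((\<Sum>i\<in>UNIV. \<Sum>j\<in>UNIV. D2 (a \<omega>) (L (axis i (axis j 1))) (L (axis i (axis j 1)))) / 2))"
  shows "integrable M A" "expectation A = 0"
proof -
  define E where "E p = L (axis (fst p) (axis (snd p) 1))" for p :: "'n \<times> 'd"
  define \<delta> where "\<delta> p \<omega> = \<Delta> \<omega> $ fst p $ snd p" for p :: "'n \<times> 'd" and \<omega>
  define H1 where "H1 p \<omega> = indicator G \<omega> * D1 (a \<omega>) (E p)" for p and \<omega>
  define H2 where "H2 p q \<omega> = indicator G \<omega> * D2 (a \<omega>) (E p) (E q)" for p q and \<omega>
  have LE: "L (\<Delta> \<omega>) = (\<Sum>p\<in>UNIV. \<delta> p \<omega> *\<^sub>R E p)" for \<omega>
    unfolding linear_axis_expansion[OF L, of "\<Delta> \<omega>"] sum.cartesian_product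
    by (rule sum.cong) (auto simp: \<delta>_def E_def)
  have A: "A \<omega> = (\<Sum>p\<in>UNIV. H1 p \<omega> * \<delta> p \<omega>)
      + (\<Sum>p\<in>UNIV. \<Sum>q\<in>UNIV. H2 p q \<omega> * (\<delta> p \<omega> * \<delta> q \<omega>)) / 2 - h * (\<Sum>p\<in>UNIV. H2 p p \<omega>) / 2" for \<omega>
  proof -
    have "D1 (a \<omega>) (L (\<Delta> \<omega>)) = (\<Sum>p\<in>UNIV. \<delta> p \<omega> * D1 (a \<omega>) (E p))"
      by (simp add: LE blinfun.sum_right blinfun.scaleR_right)
    moreover have "D2 (a \<omega>) (L (\<Delta> \<omega>)) (L (\<Delta> \<omega>)) = (\<Sum>p\<in>UNIV. \<Sum>q\<in>UNIV. \<delta> p \<omega> * \<delta> q \<omega> * D2 (a \<omega>) (E p) (E q))"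
    proof -
      have "D2 (a \<omega>) (L (\<Delta> \<omega>)) (L (\<Delta> \<omega>)) = (\<Sum>q\<in>UNIV. \<Sum>p\<in>UNIV. \<delta> p \<omega> * \<delta> q \<omega> * D2 (a \<omega>) (E p) (E q))"
      by (simp add: LE blinfun.sum_right blinfun.sum_left blinfun.scaleR_left blinfun.scaleR_right
          sum_distrib_left mult_ac)
      also have "\<dots> = (\<Sum>p\<in>UNIV. \<Sum>q\<in>UNIV. \<delta> p \<omega> * \<delta> q \<omega> * D2 (a \<omega>) (E p) (E q))"
        by (rule sum.swap)
      finally show ?thesis .
    qed
    moreover have "(\<Sum>i\<in>UNIV. \<Sum>j\<in>UNIV. D2 (a \<omega>) (L (axis i (axis j 1))) (L (axis i (axis j 1))))
        = (\<Sum>p\<in>UNIV. D2 (a \<omega>) (E p) (E p))"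
      unfolding sum.cartesian_product by (rule sum.cong) (auto simp: E_def)
    ultimately show ?thesis
      unfolding A_def H1_def H2_def
      by (cases "\<omega> \<in> G") (simp_all add: mult_ac)
  qed
  \<comment> \<open>On \<open>G\<close> the point \<open>a \<omega>\<close> stays in a fixed ball,
    where a continuous coefficient is bounded; off \<open>G\<close> the indicator removes
    it.\<close>
  have past: "\<exists>c. (\<lambda>\<omega>. indicator G \<omega> * g (a \<omega>)) \<in> borel_measurable N \<and>
      (\<forall>\<omega>. \<bar>indicator G \<omega> * g (a \<omega>)\<bar> \<le> c)" if g: "continuous_on UNIV g" for g :: "'a \<Rightarrow> real"
  proof -
    have [measurable]: "a \<in> borel_measurable N" "G \<in> sets N" "g \<in> borel_measurable borel"
      using a(1) G borel_measurable_continuous_onI[OF g] by auto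
    obtain c where c: "\<And>x. norm x \<le> r \<Longrightarrow> \<bar>g x\<bar> \<le> c" using continuous_bounded_cball[OF g] by blast
    have "\<bar>indicator G \<omega> * g (a \<omega>)\<bar> \<le> \<bar>c\<bar>" for \<omega>
      using order_trans[OF c[OF a(2)] abs_ge_self] by (cases "\<omega> \<in> G") auto
    moreover have "(\<lambda>\<omega>. indicator G \<omega> * g (a \<omega>)) \<in> borel_measurable N" by measurable
    ultimately show ?thesis by blast
  qed
  have entry: "(\<lambda>x :: real^'d^'n. x $ i $ j) \<in> borel_measurable borel" for i j
    by (intro borel_measurable_continuous_onI continuous_intros)
  have H1: "integrable M (\<lambda>\<omega>. H1 p \<omega> * \<delta> p \<omega>)" "expectation (\<lambda>\<omega>. H1 p \<omega> * \<delta> p \<omega>) = 0" for p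
  proof -
    have "continuous_on UNIV (\<lambda>x. D1 x (E p))" by (intro continuous_intros D1)
    then obtain c where c: "H1 p \<in> borel_measurable N" "\<And>\<omega>. \<bar>H1 p \<omega>\<bar> \<le> c"
      using past unfolding H1_def by blast
    have int: "integrable M (\<lambda>\<omega>. \<Delta> \<omega> $ fst p $ snd p)" using entry_moments(1)[of _ _ 1] by simp
    from expectation_past_mult[OF c entry int]
    show "integrable M (\<lambda>\<omega>. H1 p \<omega> * \<delta> p \<omega>)" "expectation (\<lambda>\<omega>. H1 p \<omega> * \<delta> p \<omega>) = 0"
      by (simp_all add: \<delta>_def entry_moments)
  qed
  have H2: "integrable M (\<lambda>\<omega>. H2 p q \<omega> * (\<delta> p \<omega> * \<delta> q \<omega>))" "integrable M (H2 p q)"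
    "expectation (\<lambda>\<omega>. H2 p q \<omega> * (\<delta> p \<omega> * \<delta> q \<omega>)) = (if p = q then h * expectation (H2 p p) else 0)" for p q
  proof -
    have "continuous_on UNIV (\<lambda>x. D2 x (E p) (E q))" by (intro continuous_intros D2)
    then obtain c where c: "H2 p q \<in> borel_measurable N" "\<And>\<omega>. \<bar>H2 p q \<omega>\<bar> \<le> c"
      using past unfolding H2_def by blast
    have "H2 p q \<in> borel_measurable M" using sub c(1) by (rule measurable_from_subalg)
    then show "integrable M (H2 p q)"
      using c(2) by (intro integrable_const_bound[where B = c]) auto
    have "(\<lambda>x :: real^'d^'n. x $ fst p $ snd p * x $ fst q $ snd q) \<in> borel_measurable borel"
      by (intro borel_measurable_times entry)
    note * = expectation_past_mult[OF c this integrable_entry_mult]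
    show "integrable M (\<lambda>\<omega>. H2 p q \<omega> * (\<delta> p \<omega> * \<delta> q \<omega>))" using *(1) by (simp add: \<delta>_def)
    show "expectation (\<lambda>\<omega>. H2 p q \<omega> * (\<delta> p \<omega> * \<delta> q \<omega>)) = (if p = q then h * expectation (H2 p p) else 0)"
      using *(2) unfolding \<delta>_def entry_covariance
      by (cases "p = q") (simp_all add: mult.commute)
  qed
  show "integrable M A" unfolding A
    by (intro Bochner_Integration.integrable_diff Bochner_Integration.integrable_add
        Bochner_Integration.integrable_sum integrable_divide_zero integrable_mult_right H1 H2)
  have "expectation A = (\<Sum>p\<in>UNIV. expectation (\<lambda>\<omega>. H1 p \<omega> * \<delta> p \<omega>))
      + (\<Sum>p\<in>UNIV. \<Sum>q\<in>UNIV. expectation (\<lambda>\<omega>. H2 p q \<omega> * (\<delta> p \<omega> * \<delta> q \<omega>))) / 2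
      - h * (\<Sum>p\<in>UNIV. expectation (H2 p p)) / 2"
    unfolding A
    by (simp add: Bochner_Integration.integral_diff Bochner_Integration.integral_add
        Bochner_Integration.integral_sum Bochner_Integration.integrable_sum H1 H2)
  then show "expectation A = 0" by (simp add: H1 H2 sum_distrib_left)
qed

text \<open>After subtraction of the mean-zero part \<open>A\<close>, exactly the Taylor remainder
  is left: the two trace terms cancel, and \<open>f' (a \<omega>) (b \<omega>)\<close> completes the
  linear term to \<open>f'\<close> at \<open>w - b\<close>. Its bound is integrated with the moments
  of the increment, and \<open>h \<le> 1\<close> reduces \<open>|b|^4\<close> to order
  \<open>h^2\<close>.\<close>

lemma one_step_remainder:
  fixes f :: "'a::euclidean_space \<Rightarrow> real" and f' :: "'a \<Rightarrow> 'a \<Rightarrow>\<^sub>L real"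
    and L :: "real^'d^'n \<Rightarrow> 'a" and a b Y :: "'w \<Rightarrow> 'a"
  assumes f': "\<And>x. (f has_derivative blinfun_apply (f' x)) (at x)"
    and f'': "\<And>x. (f' has_derivative blinfun_apply (f'' x)) (at x)"
    and cont: "continuous_on UNIV f''" and L: "linear L" "\<And>x. norm (L x) \<le> \<kappa> * norm x"
    and C: "\<And>x w b. norm x \<le> r \<Longrightarrow>
      \<bar>(if norm (x + w - b) \<le> r + 1 then f (x + w - b) else 0) - f x - f' x (w - b) - f'' x w w / 2\<bar>
        \<le> \<epsilon> * (norm w)\<^sup>2 + C * (norm w ^ 4 + (norm b)\<^sup>2 + norm b ^ 4)" "C \<ge> 0" "\<epsilon> \<ge> 0"
    and G: "G \<in> sets N" and a: "a \<in> borel_measurable N" "\<And>\<omega>. \<omega> \<in> G \<Longrightarrow> norm (a \<omega>) \<le> r"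
    and [measurable]: "b \<in> borel_measurable M" "Y \<in> borel_measurable M"
    and b: "\<And>\<omega>. \<omega> \<in> G \<Longrightarrow> norm (b \<omega>) \<le> r * h"
    and Y: "AE \<omega> in M. \<omega> \<in> G \<longrightarrow> Y \<omega> = a \<omega> + L (\<Delta> \<omega>) - b \<omega>"
    and "\<kappa> \<ge> 0" "r \<ge> 0" "h \<le> 1"
  defines "Z \<equiv> \<lambda>\<omega>. indicator G \<omega> * ((if norm (Y \<omega>) \<le> r + 1 then f (Y \<omega>) else 0) - f (a \<omega>) + f' (a \<omega>) (b \<omega>)
      - h * ((\<Sum>i\<in>UNIV. \<Sum>j\<in>UNIV. f'' (a \<omega>) (L (axis i (axis j 1))) (L (axis i (axis j 1)))) / 2))"
  shows "integrable M Z" "\<bar>expectation Z\<bar> \<le> \<epsilon> * (\<kappa>\<^sup>2 * real (CARD('n) * CARD('d))) * h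
    + C * (3 * \<kappa> ^ 4 * (real (CARD('n) * CARD('d)))\<^sup>2 + r\<^sup>2 + r ^ 4) * h\<^sup>2"
proof -
  have cf: "continuous_on UNIV f" and cf': "continuous_on UNIV f'"
    by (meson f' f'' has_derivative_continuous continuous_at_imp_continuous_on)+
  define A where "A = (\<lambda>\<omega>. indicator G \<omega> * (f' (a \<omega>) (L (\<Delta> \<omega>)) + f'' (a \<omega>) (L (\<Delta> \<omega>)) (L (\<Delta> \<omega>)) / 2
      - h * ((\<Sum>i\<in>UNIV. \<Sum>j\<in>UNIV. f'' (a \<omega>) (L (axis i (axis j 1))) (L (axis i (axis j 1)))) / 2)))"
  have A: "integrable M A" "expectation A = 0"
    using one_step_mean_zero[OF G a L(1) cf' cont] unfolding A_def by blast+
  \<comment> \<open>The pathwise remainder bound after \<open>w\<close> and \<open>b\<close> are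
    replaced by \<open>\<kappa> |\<Delta>|\<close> and \<open>r h\<close>.\<close>
  define R where "R \<omega> = \<epsilon> * \<kappa>\<^sup>2 * (norm (\<Delta> \<omega>))\<^sup>2 + C * \<kappa> ^ 4 * norm (\<Delta> \<omega>) ^ 4 + C * (r\<^sup>2 + r ^ 4) * h\<^sup>2" for \<omega>
  have R: "integrable M R"
    unfolding R_def by (intro Bochner_Integration.integrable_add integrable_mult_right norm_moments) simp
  have ZA: "AE \<omega> in M. \<bar>Z \<omega> - A \<omega>\<bar> \<le> R \<omega>"
    using Y
  proof eventually_elim
    case (elim \<omega>)
    show ?case
    proof (cases "\<omega> \<in> G")
      case False
      then show ?thesis using C(2,3) by (simp add: Z_def A_def R_def)
    next
      case True
      let ?w = "L (\<Delta> \<omega>)"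
      have h0: "0 \<le> h" using h by simp
      have w: "norm ?w \<le> \<kappa> * norm (\<Delta> \<omega>)" by (rule L)
      have bh: "(norm (b \<omega>))\<^sup>2 \<le> r\<^sup>2 * h\<^sup>2" "norm (b \<omega>) ^ 4 \<le> r ^ 4 * h\<^sup>2"
      proof -
        show "(norm (b \<omega>))\<^sup>2 \<le> r\<^sup>2 * h\<^sup>2"
          using power_mono[OF b[OF True], of 2] by (simp add: power_mult_distrib)
        have "norm (b \<omega>) ^ 4 \<le> r ^ 4 * h ^ 4"
          using power_mono[OF b[OF True], of 4] by (simp add: power_mult_distrib)
        also have "\<dots> \<le> r ^ 4 * h\<^sup>2"
          using \<open>h \<le> 1\<close> h0 by (intro mult_left_mono power_decreasing) auto
        finally show "norm (b \<omega>) ^ 4 \<le> r ^ 4 * h\<^sup>2" .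
      qed
      let ?c = "if norm (a \<omega> + ?w - b \<omega>) \<le> r + 1 then f (a \<omega> + ?w - b \<omega>) else 0"
      have "Z \<omega> - A \<omega> = ?c - f (a \<omega>) - f' (a \<omega>) (?w - b \<omega>) - f'' (a \<omega>) ?w ?w / 2"
        unfolding Z_def A_def elim[rule_format, OF True] indicator_simps(1)[OF True] blinfun.diff_right mult_1
        by linarith
      then have "\<bar>Z \<omega> - A \<omega>\<bar> = \<bar>?c - f (a \<omega>) - f' (a \<omega>) (?w - b \<omega>) - f'' (a \<omega>) ?w ?w / 2\<bar>"
        by (rule arg_cong)
      also have "\<dots> \<le> \<epsilon> * (norm ?w)\<^sup>2 + C * (norm ?w ^ 4 + (norm (b \<omega>))\<^sup>2 + norm (b \<omega>) ^ 4)"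
        by (rule C(1)[OF a(2)[OF True]])
      also have "\<dots> \<le> \<epsilon> * (\<kappa> * norm (\<Delta> \<omega>))\<^sup>2 + C * ((\<kappa> * norm (\<Delta> \<omega>)) ^ 4 + r\<^sup>2 * h\<^sup>2 + r ^ 4 * h\<^sup>2)"
        using C(2,3) by (intro add_mono mult_left_mono power_mono w bh) auto
      also have "\<dots> = R \<omega>"
        by (simp add: R_def power_mult_distrib algebra_simps)
      finally show ?thesis .
    qed
  qed
  have Z [measurable]: "Z \<in> borel_measurable M"
  proof -
    have [measurable]: "a \<in> borel_measurable M" "G \<in> sets M"
      using a(1) G sub by (auto intro: measurable_from_subalg simp: subalgebra_def)
    have [measurable]: "f \<in> borel_measurable borel"
      by (rule borel_measurable_continuous_onI[OF cf])
    have "continuous_on UNIV (\<lambda>p. f' (fst p) (snd p))"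
      by (intro continuous_intros continuous_on_compose2[OF cf']) auto
    then have "(\<lambda>p. f' (fst p) (snd p)) \<in> borel_measurable borel"
      by (rule borel_measurable_continuous_onI)
    from measurable_compose[OF borel_measurable_Pair this, of a M b]
    have [measurable]: "(\<lambda>\<omega>. f' (a \<omega>) (b \<omega>)) \<in> borel_measurable M"
      by simp
    have [measurable]: "(\<lambda>x. f'' x y z) \<in> borel_measurable borel" for y z
      by (intro borel_measurable_continuous_onI continuous_intros cont)
    show ?thesis unfolding Z_def by measurable
  qed
  have ZAint: "integrable M (\<lambda>\<omega>. Z \<omega> - A \<omega>)"
    by (rule Bochner_Integration.integrable_bound[OF R])
      (use ZA A(1) in \<open>auto intro!: borel_measurable_diff elim!: eventually_mono\<close>)
  then show intZ: "integrable M Z"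
    using Bochner_Integration.integrable_add[OF ZAint A(1)] by simp
  then have "\<bar>expectation Z\<bar> = \<bar>expectation (\<lambda>\<omega>. Z \<omega> - A \<omega>)\<bar>"
    using A by (simp add: Bochner_Integration.integral_diff)
  also have "\<dots> \<le> expectation (\<lambda>\<omega>. \<bar>Z \<omega> - A \<omega>\<bar>)" by (rule integral_abs_bound)
  also have "\<dots> \<le> expectation R"
    by (rule integral_mono_AE) (use ZA ZAint R in auto)
  also have "\<dots> = \<epsilon> * \<kappa>\<^sup>2 * expectation (\<lambda>\<omega>. (norm (\<Delta> \<omega>))\<^sup>2) + C * \<kappa> ^ 4 * expectation (\<lambda>\<omega>. norm (\<Delta> \<omega>) ^ 4)
      + C * (r\<^sup>2 + r ^ 4) * h\<^sup>2"
    unfolding R_def by (simp add: norm_moments prob_space)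
  also have "\<dots> \<le> \<epsilon> * \<kappa>\<^sup>2 * (real (CARD('n) * CARD('d)) * h)
      + C * \<kappa> ^ 4 * (3 * (real (CARD('n) * CARD('d)))\<^sup>2 * h\<^sup>2) + C * (r\<^sup>2 + r ^ 4) * h\<^sup>2"
    using C by (intro add_mono mult_left_mono norm_moments(4) order_refl) (auto simp: norm_moments(3))
  finally show "\<bar>expectation Z\<bar> \<le> \<epsilon> * (\<kappa>\<^sup>2 * real (CARD('n) * CARD('d))) * h
    + C * (3 * \<kappa> ^ 4 * (real (CARD('n) * CARD('d)))\<^sup>2 + r\<^sup>2 + r ^ 4) * h\<^sup>2"
    by (simp add: algebra_simps)
qed

end

section \<open>The matrix Ornstein--Uhlenbeck process\<close>

locale matrix_OU_C2 = filtered_prob_space M F for M :: "'w measure" and F :: "real \<Rightarrow> 'w measure" +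
  fixes \<Psi> :: "real^'n^'n" and \<Sigma> :: "real^'d^'d" and X0 :: "real^'d^'n"
    and B X :: "real \<Rightarrow> 'w \<Rightarrow> real^'d^'n" and f :: "real^'d^'n \<Rightarrow> real"
    and f' :: "real^'d^'n \<Rightarrow> (real^'d^'n) \<Rightarrow>\<^sub>L real"
    and f'' :: "real^'d^'n \<Rightarrow> (real^'d^'n) \<Rightarrow>\<^sub>L (real^'d^'n) \<Rightarrow>\<^sub>L real"
  assumes \<Psi>: "pos_def \<Psi>" and \<Sigma>: "pos_def \<Sigma>"
    and brownian: "matrix_brownian_motion M F B"
    and OU: "matrix_OU_process M F B \<Psi> \<Sigma> X0 X"
    and f': "\<And>x. (f has_derivative blinfun_apply (f' x)) (at x)"
    and f'': "\<And>x. (f' has_derivative blinfun_apply (f'' x)) (at x)"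
    and cont_f'': "continuous_on UNIV f''"
begin

section \<open>The generator and the compensated process\<close>

definition "L A = sqrt 2 *\<^sub>R (matrix_sqrt \<Psi> ** A ** matrix_sqrt \<Sigma>)"

text \<open>The second order drift of Ito's formula: half the trace of \<open>f''\<close> against
  the covariance of the noise.\<close>

definition "L2 x = (\<Sum>i\<in>UNIV. \<Sum>j\<in>UNIV. f'' x (L (axis i (axis j 1))) (L (axis i (axis j 1)))) / 2"

definition "gen x = L2 x - f' x x"

definition "compensated t \<omega> = f (X t \<omega>) - f (X 0 \<omega>) - (LINT s:{0..t}|lborel. gen (X s \<omega>))"

text \<open>The factor \<open>sqrt 2\<close> occurs in both arguments of \<open>f''\<close> and
  cancels the half in \<open>L2\<close>; what remains is the contraction with the squares of the two
  matrix roots.\<close>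

lemma gen_eq: "gen = (\<lambda>Y. - trace (transpose Y ** nabla f Y) + trace (\<Sigma> ** nabla_quad \<Psi> f Y))"
proof
  fix x
  have "sym_matrix \<Sigma>" using \<Sigma> by (simp add: pos_def_def)
  have "f'' x (L A) (L A) = 2 * f'' x (matrix_sqrt \<Psi> ** A ** matrix_sqrt \<Sigma>) (matrix_sqrt \<Psi> ** A ** matrix_sqrt \<Sigma>)" for A
    by (simp add: L_def blinfun.scaleR_left blinfun.scaleR_right)
  then have "L2 x = (\<Sum>i\<in>UNIV. \<Sum>j\<in>UNIV. f'' x (matrix_sqrt \<Psi> ** axis i (axis j 1) ** matrix_sqrt \<Sigma>)
      (matrix_sqrt \<Psi> ** axis i (axis j 1) ** matrix_sqrt \<Sigma>))"
    by (simp add: L2_def flip: sum_distrib_left)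
  also have "\<dots> = (\<Sum>i\<in>UNIV. \<Sum>k\<in>UNIV. \<Sum>j\<in>UNIV. \<Sum>l\<in>UNIV.
      \<Psi> $ i $ k * \<Sigma> $ j $ l * f'' x (axis i (axis j 1)) (axis k (axis l 1)))"
    by (rule sum_bilinear_sandwich) (intro matrix_sqrt \<Psi> \<Sigma>)+
  finally show "gen x = - trace (transpose x ** nabla f x) + trace (\<Sigma> ** nabla_quad \<Psi> f x)"
    unfolding OU_operator_eq[OF f' f'' \<open>sym_matrix \<Sigma>\<close>] gen_def by simp
qed

lemma cont_f: "continuous_on S f" and cont_f': "continuous_on S f'"
  by (meson f' f'' has_derivative_continuous continuous_at_imp_continuous_on)+

lemma cont_f'_apply: "continuous_on UNIV (\<lambda>p. f' (fst p) (snd p))"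
  by (intro continuous_intros continuous_on_compose2[OF cont_f'[of UNIV]]) auto

lemma cont_L2: "continuous_on S L2"
  unfolding L2_def[abs_def]
  by (intro continuous_intros continuous_on_subset[OF cont_f'']) auto

lemma cont_gen: "continuous_on S gen"
  unfolding gen_def[abs_def] by (intro continuous_intros cont_L2 cont_f')

lemma linear_L: "linear L"
proof (rule linearI)
  fix A A' :: "real^'d^'n" and c :: real
  have "(matrix_sqrt \<Psi> ** A + matrix_sqrt \<Psi> ** A') ** matrix_sqrt \<Sigma> =
      matrix_sqrt \<Psi> ** A ** matrix_sqrt \<Sigma> + matrix_sqrt \<Psi> ** A' ** matrix_sqrt \<Sigma>"
    unfolding matrix_matrix_mult_def[of _ "matrix_sqrt \<Sigma>"]
    by (simp add: vec_eq_iff distrib_right sum.distrib)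
  then show "L (A + A') = L A + L A'"
    by (simp only: L_def matrix_add_ldistrib scaleR_add_right)
  have "matrix_sqrt \<Psi> ** (c *\<^sub>R A) ** matrix_sqrt \<Sigma> = c *\<^sub>R (matrix_sqrt \<Psi> ** A ** matrix_sqrt \<Sigma>)"
    by (simp add: matrix_matrix_mult_def vec_eq_iff sum_distrib_left sum_distrib_right mult_ac)
  then show "L (c *\<^sub>R A) = c *\<^sub>R L A"
    by (simp only: L_def scaleR_left_commute)
qed

lemma norm_L: "norm (L A) \<le> onorm L * norm A"
  by (rule onorm) (simp add: linear_L linear_linear)

lemma onorm_L: "0 \<le> onorm L"
  by (rule onorm_pos_le) (simp add: linear_L linear_linear)

lemma adapted_X: "adapted F X"
  and paths_X: "\<omega> \<in> space M \<Longrightarrow> continuous_on {0..} (\<lambda>t. X t \<omega>)"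
  using OU by (auto simp: matrix_OU_process_def)

lemma continuous_on_X: "\<omega> \<in> space M \<Longrightarrow> S \<subseteq> {0..} \<Longrightarrow> continuous_on S (\<lambda>t. X t \<omega>)"
  using continuous_on_subset[OF paths_X] .

lemma X_measurable_later: "0 \<le> r \<Longrightarrow> r \<le> t \<Longrightarrow> X r \<in> borel_measurable (F t)"
  by (rule adapted_measurable_later[OF filtration_axioms adapted_X])

lemma continuous_on_comp_X:
  assumes "continuous_on UNIV c" "\<omega> \<in> space M" "S \<subseteq> {0..}"
  shows "continuous_on S (\<lambda>t. c (X t \<omega>))"
  by (rule continuous_on_compose2[OF assms(1) continuous_on_X[OF assms(2,3)]]) simp

lemma integral_X_measurable:
  fixes c :: "real^'d^'n \<Rightarrow> 'b::euclidean_space"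
  assumes c: "continuous_on UNIV c" and "0 \<le> u" "u \<le> v" "v \<le> t"
  shows "(\<lambda>\<omega>. LINT r:{u..v}|lborel. c (X r \<omega>)) \<in> borel_measurable (F t)"
proof (rule integral_continuous_paths_measurable[where T = t])
  show "(\<lambda>\<omega>. c (X r \<omega>)) \<in> borel_measurable (F t)" if "0 \<le> r" "r \<le> t" for r
    using measurable_compose[OF X_measurable_later[OF that] borel_measurable_continuous_onI[OF c]] .
  show "continuous_on {0..t} (\<lambda>r. c (X r \<omega>))" if "\<omega> \<in> space (F t)" for \<omega>
    using that by (intro continuous_on_comp_X c) (auto simp: space_F)
qed (use assms in auto)

lemma integral_X_eq:
  fixes c :: "real^'d^'n \<Rightarrow> 'b::euclidean_space"
  assumes "continuous_on UNIV c" "\<omega> \<in> space M" "0 \<le> u"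
  shows "(LINT r:{u..v}|lborel. c (X r \<omega>)) = integral {u..v} (\<lambda>r. c (X r \<omega>))"
  by (rule set_lebesgue_integral_interval(2)[OF continuous_on_comp_X]) (use assms in auto)

lemma compensated_eq: "\<omega> \<in> space M \<Longrightarrow>
  compensated t \<omega> = f (X t \<omega>) - f (X 0 \<omega>) - integral {0..t} (\<lambda>r. gen (X r \<omega>))"
  unfolding compensated_def by (simp add: integral_X_eq[OF cont_gen])

lemma continuous_on_integral_X:
  fixes c :: "real^'d^'n \<Rightarrow> 'b::euclidean_space"
  assumes "continuous_on UNIV c" "\<omega> \<in> space M"
  shows "continuous_on {0..} (\<lambda>t. integral {0..t} (\<lambda>r. c (X r \<omega>)))"
  unfolding continuous_on_eq_continuous_within
proof
  fix t :: real assume t: "t \<in> {0..}"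
  have "continuous_on {0..t + 1} (\<lambda>t. integral {0..t} (\<lambda>r. c (X r \<omega>)))"
    by (intro indefinite_integral_continuous_1 integrable_continuous_real continuous_on_comp_X assms) auto
  then have "continuous (at t within {0..t + 1}) (\<lambda>t. integral {0..t} (\<lambda>r. c (X r \<omega>)))"
    using t by (simp add: continuous_on_eq_continuous_within)
  moreover have "at t within {0..} = at t within {0..t + 1}"
    by (rule at_within_nhd[of _ "{..<t + 1}"]) auto
  ultimately show "continuous (at t within {0..}) (\<lambda>t. integral {0..t} (\<lambda>r. c (X r \<omega>)))"
    by simp
qed

lemma continuous_on_compensated: "\<omega> \<in> space M \<Longrightarrow> continuous_on {0..} (\<lambda>t. compensated t \<omega>)"
  by (simp add: compensated_eq)
    (intro continuous_intros continuous_on_integral_X cont_gen continuous_on_comp_X cont_f order_refl)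

lemma adapted_compensated: "adapted F compensated"
  unfolding adapted_def
proof (intro allI impI)
  fix t :: real assume t: "0 \<le> t"
  have [measurable]: "f \<in> borel_measurable borel" by (intro borel_measurable_continuous_onI cont_f)
  have [measurable]: "X 0 \<in> borel_measurable (F t)" "X t \<in> borel_measurable (F t)"
    "(\<lambda>\<omega>. LINT s:{0..t}|lborel. gen (X s \<omega>)) \<in> borel_measurable (F t)"
    using t by (auto intro: X_measurable_later integral_X_measurable cont_gen)
  show "compensated t \<in> borel_measurable (F t)" unfolding compensated_def[abs_def] by measurable
qed

lemma cadlag_compensated: "\<omega> \<in> space M \<Longrightarrow> cadlag (\<lambda>t. compensated t \<omega>)"
proof -
  assume "\<omega> \<in> space M"
  from continuous_on_compensated[OF this]
  have c: "((\<lambda>t. compensated t \<omega>) \<longlongrightarrow> compensated t \<omega>) (at t within {0..})" if "t \<ge> 0" for t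
    using that by (simp add: continuous_on_def)
  show ?thesis
    unfolding cadlag_def continuous_within
  proof safe
    fix t :: real assume "0 \<le> t"
    show "((\<lambda>t. compensated t \<omega>) \<longlongrightarrow> compensated t \<omega>) (at_right t)"
      by (rule tendsto_within_subset[OF c]) (use \<open>0 \<le> t\<close> in auto)
  next
    fix t :: real assume t: "0 < t"
    have "at t within {0..} = at t" using t by (intro at_within_interior) simp
    moreover have "((\<lambda>t. compensated t \<omega>) \<longlongrightarrow> compensated t \<omega>) (at t within {0..})"
      using t by (intro c) simp
    ultimately have "((\<lambda>t. compensated t \<omega>) \<longlongrightarrow> compensated t \<omega>) (at t)" by (simp only:)
    then have "((\<lambda>t. compensated t \<omega>) \<longlongrightarrow> compensated t \<omega>) (at_left t)"
      by (rule tendsto_within_subset) simp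
    then show "\<exists>l. ((\<lambda>t. compensated t \<omega>) \<longlongrightarrow> l) (at_left t)" by blast
  qed
qed

lemma brownian_increment:
  assumes "0 \<le> u" "u < v"
  shows "brownian_increment M (F u) (\<lambda>\<omega>. B v \<omega> - B u \<omega>) (v - u)"
proof -
  have "B r \<in> borel_measurable M" if "0 \<le> r" for r
    using brownian that by (intro measurable_from_subalg[OF subalgebra_F[of r]])
      (auto simp: matrix_brownian_motion_def adapted_def)
  then have "(\<lambda>\<omega>. B v \<omega> - B u \<omega>) \<in> borel_measurable M"
    using assms by (intro borel_measurable_diff) auto
  then show ?thesis
    using brownian assms subalgebra_F[of u] prob_space_axioms
    unfolding brownian_increment_def brownian_increment_axioms_def matrix_brownian_motion_def
    by auto
qed

text \<open>\<open>Y r\<close> is the process with the same driving noise as \<open>X\<close> but drift \<open>- trunc r X\<close>, which is bounded, so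
  its increments have all moments; it agrees with \<open>X\<close> until \<open>X\<close> reaches norm \<open>r\<close>. The function
  \<open>cutoff r\<close> need not be continuous: the Taylor estimate is only ever used at points of norm at most
  \<open>r\<close>, and from there a jump out of the ball of radius \<open>r + 1\<close> costs at most a multiple of the
  fourth power of its size.\<close>

definition "trunc r = closest_point (cball (0::real^'d^'n) r)"

definition "drift r u v \<omega> = (LINT q:{u..v}|lborel. trunc r (X q \<omega>))"

definition "Y r t \<omega> = X t \<omega> + (LINT q:{0..t}|lborel. X q \<omega> - trunc r (X q \<omega>))"

definition "cutoff r x = (if norm x \<le> r + 1 then f x else 0)"

text \<open>An increment minus its predicted mean, with the derivatives frozen at time
  \<open>u\<close>. The drift is kept as an integral over the step: it is not determined by the past
  of \<open>u\<close>, but it cancels the linear Taylor term in \<open>- drift\<close> exactly.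
  Writing \<open>f (X u \<omega>)\<close> in place of \<open>cutoff r (Y r u \<omega>)\<close>
  changes nothing before the hitting time.\<close>

definition "step r u v \<omega> = cutoff r (Y r v \<omega>) - f (X u \<omega>) + f' (X u \<omega>) (drift r u v \<omega>) - (v - u) * L2 (X u \<omega>)"

section \<open>The process with truncated drift\<close>

lemma trunc:
  assumes "r \<ge> 0"
  shows continuous_on_trunc: "continuous_on S (trunc r)"
    and norm_trunc: "norm (trunc r x) \<le> r" and trunc_id: "norm x \<le> r \<Longrightarrow> trunc r x = x"
proof -
  have "cball (0::real^'d^'n) r \<noteq> {}" using assms by simp
  then show "continuous_on S (trunc r)"
    unfolding trunc_def by (intro continuous_on_closest_point) auto
  show "norm (trunc r x) \<le> r"
    using closest_point_in_set[of "cball 0 r" x] assms by (simp add: trunc_def)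
  show "trunc r x = x" if "norm x \<le> r" using that by (simp add: trunc_def closest_point_self)
qed

lemma continuous_on_X_minus_trunc: "r \<ge> 0 \<Longrightarrow> continuous_on UNIV (\<lambda>x. x - trunc r x)"
  by (intro continuous_intros continuous_on_trunc)

lemma drift_eq: "r \<ge> 0 \<Longrightarrow> \<omega> \<in> space M \<Longrightarrow> 0 \<le> u \<Longrightarrow> drift r u v \<omega> = integral {u..v} (\<lambda>q. trunc r (X q \<omega>))"
  unfolding drift_def by (rule integral_X_eq[OF continuous_on_trunc])

lemma Y_eq: "r \<ge> 0 \<Longrightarrow> \<omega> \<in> space M \<Longrightarrow> Y r t \<omega> = X t \<omega> + integral {0..t} (\<lambda>q. X q \<omega> - trunc r (X q \<omega>))"
  unfolding Y_def by (subst integral_X_eq[OF continuous_on_X_minus_trunc]) auto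

lemma norm_drift:
  assumes "r \<ge> 0" "\<omega> \<in> space M" "0 \<le> u" "u \<le> v"
  shows "norm (drift r u v \<omega>) \<le> r * (v - u)"
  unfolding drift_eq[OF assms(1-3)] using assms
  by (intro integral_bound continuous_on_comp_X continuous_on_trunc norm_trunc) auto

lemma drift_measurable: "r \<ge> 0 \<Longrightarrow> 0 \<le> u \<Longrightarrow> u \<le> v \<Longrightarrow> drift r u v \<in> borel_measurable (F v)"
  unfolding drift_def[abs_def] by (intro integral_X_measurable continuous_on_trunc) auto

lemma Y_measurable:
  assumes "r \<ge> 0" "0 \<le> t"
  shows "Y r t \<in> borel_measurable (F t)"
proof -
  have [measurable]: "X t \<in> borel_measurable (F t)" using assms by (intro X_measurable_later) auto
  have [measurable]: "(\<lambda>\<omega>. LINT q:{0..t}|lborel. X q \<omega> - trunc r (X q \<omega>)) \<in> borel_measurable (F t)"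
    using assms by (intro integral_X_measurable[OF continuous_on_X_minus_trunc]) auto
  show ?thesis unfolding Y_def[abs_def] by measurable
qed

lemma norm_X_until:
  assumes "r \<ge> 0" "\<omega> \<in> space M" "0 \<le> q" "q \<le> hitting_time X r \<omega>" "0 < hitting_time X r \<omega>"
  shows "norm (X q \<omega>) \<le> r"
  using norm_until_hitting_time[where X = X and \<omega> = \<omega>, OF paths_X[OF assms(2)] assms(1,3-5)] .

lemma Y_eq_X:
  assumes "r \<ge> 0" "\<omega> \<in> space M" "0 \<le> t" "t \<le> hitting_time X r \<omega>" "0 < hitting_time X r \<omega>"
  shows "Y r t \<omega> = X t \<omega>"
proof -
  have "integral {0..t} (\<lambda>q. X q \<omega> - trunc r (X q \<omega>)) = integral {0..t} (\<lambda>q. 0)"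
    using assms by (intro integral_cong) (simp add: trunc_id norm_X_until)
  then show ?thesis using assms by (simp add: Y_eq)
qed

lemma continuous_on_Y:
  assumes "r \<ge> 0" "\<omega> \<in> space M"
  shows "continuous_on {0..} (\<lambda>t. Y r t \<omega>)"
  unfolding Y_eq[OF assms]
  by (intro continuous_intros paths_X continuous_on_integral_X[OF continuous_on_X_minus_trunc] assms)

text \<open>The correction integral in \<open>Y\<close> trades the drift \<open>- X\<close> for
  \<open>- trunc r X\<close>. The integrated equation holds for all times outside a single null set,
  which then serves all pairs \<open>u\<close>, \<open>v\<close> at once.\<close>

lemma Y_increment:
  assumes r: "r \<ge> 0"
  shows "AE \<omega> in M. \<forall>u v. 0 \<le> u \<longrightarrow> u \<le> v \<longrightarrow> Y r v \<omega> = Y r u \<omega> + L (B v \<omega> - B u \<omega>) - drift r u v \<omega>"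
proof -
  have "AE \<omega> in M. \<forall>t\<ge>0. X t \<omega> = X 0 \<omega> + (LINT s:{0..t}|lborel. - X s \<omega>) + L (B t \<omega> - B 0 \<omega>)"
    using OU unfolding matrix_OU_process_def L_def by blast
  with AE_space show ?thesis
  proof eventually_elim
    case (elim \<omega>)
    have cX: "continuous_on {0..t} (\<lambda>s. X s \<omega>)" for t
      by (intro continuous_on_X elim) auto
    have cT: "continuous_on {0..t} (\<lambda>s. trunc r (X s \<omega>))" for t
      by (intro continuous_on_comp_X continuous_on_trunc r elim) auto
    have Yt: "Y r t \<omega> = X 0 \<omega> + L (B t \<omega> - B 0 \<omega>) - integral {0..t} (\<lambda>s. trunc r (X s \<omega>))" if t: "t \<ge> 0" for t
    proof -
      have "(LINT s:{0..t}|lborel. - X s \<omega>) = - integral {0..t} (\<lambda>s. X s \<omega>)"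
        by (subst set_lebesgue_integral_interval(2)) (auto intro!: continuous_intros cX)
      moreover have "integral {0..t} (\<lambda>q. X q \<omega> - trunc r (X q \<omega>)) = integral {0..t} (\<lambda>q. X q \<omega>) - integral {0..t} (\<lambda>q. trunc r (X q \<omega>))"
        by (intro Henstock_Kurzweil_Integration.integral_diff integrable_continuous_real cX cT)
      ultimately show ?thesis
        using elim(2)[rule_format, OF t] Y_eq[OF r elim(1), of t] by simp
    qed
    show ?case
    proof (intro allI impI)
      fix u v :: real assume uv: "0 \<le> u" "u \<le> v"
      have "L (B v \<omega> - B u \<omega>) = L (B v \<omega> - B 0 \<omega>) - L (B u \<omega> - B 0 \<omega>)"
        by (simp add: linear_diff[OF linear_L])
      moreover have "drift r u v \<omega> = integral {0..v} (\<lambda>s. trunc r (X s \<omega>)) - integral {0..u} (\<lambda>s. trunc r (X s \<omega>))"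
        using uv by (simp add: drift_eq[OF r elim(1)] integral_diff_initial[OF _ _ cT])
      ultimately show "Y r v \<omega> = Y r u \<omega> + L (B v \<omega> - B u \<omega>) - drift r u v \<omega>"
        using uv by (simp add: Yt)
    qed
  qed
qed

section \<open>The expectation of one step\<close>

text \<open>\<open>K\<close> is chosen before \<open>u\<close>, \<open>v\<close> and
  \<open>G\<close>, so the bound can be summed over grids of any small mesh. On \<open>G\<close> the
  hitting time is still ahead, hence \<open>X u\<close> lies in the ball and \<open>Y r u\<close>
  equals \<open>X u\<close>.\<close>

lemma expectation_step:
  assumes r: "r \<ge> 0" and e: "e > 0"
  shows "\<exists>K\<ge>0. \<forall>u v G. 0 \<le> u \<longrightarrow> u < v \<longrightarrow> v - u \<le> 1 \<longrightarrow> G \<in> sets (F u) \<longrightarrow> (\<forall>\<omega>\<in>G. u < hitting_time X r \<omega>) \<longrightarrow>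
    integrable M (\<lambda>\<omega>. indicator G \<omega> * step r u v \<omega>) \<and>
    \<bar>expectation (\<lambda>\<omega>. indicator G \<omega> * step r u v \<omega>)\<bar> \<le> e * (v - u) + K * (v - u)\<^sup>2"
proof -
  define N where "N = real (CARD('n) * CARD('d))"
  \<comment> \<open>Compensates the factor with which the second moment of \<open>L\<close> applied
    to the increment enters; the \<open>+ 1\<close> prevents division by 0.\<close>
  define \<epsilon> where "\<epsilon> = e / ((onorm L)\<^sup>2 * N + 1)"
  have N: "N \<ge> 0" by (simp add: N_def)
  have c1: "(onorm L)\<^sup>2 * N + 1 > 0" using N by (intro add_nonneg_pos mult_nonneg_nonneg) auto
  then have \<epsilon>: "\<epsilon> > 0" using e by (simp add: \<epsilon>_def)
  have \<epsilon>e: "\<epsilon> * ((onorm L)\<^sup>2 * N) \<le> e"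
  proof -
    have "\<epsilon> * ((onorm L)\<^sup>2 * N) \<le> \<epsilon> * ((onorm L)\<^sup>2 * N + 1)" using \<epsilon> by simp
    also have "\<dots> = e" using c1 by (simp add: \<epsilon>_def)
    finally show ?thesis .
  qed
  obtain C where C: "C \<ge> 0" "\<And>x w b. norm x \<le> r \<Longrightarrow>
      \<bar>(if norm (x + w - b) \<le> r + 1 then f (x + w - b) else 0) - f x - f' x (w - b) - f'' x w w / 2\<bar>
        \<le> \<epsilon> * (norm w)\<^sup>2 + C * (norm w ^ 4 + (norm b)\<^sup>2 + norm b ^ 4)"
    using taylor_remainder_split[OF f' f'' cont_f'' \<epsilon>, of r] by blast
  define K where "K = C * (3 * onorm L ^ 4 * N\<^sup>2 + r\<^sup>2 + r ^ 4)"
  have "K \<ge> 0" using C(1) by (simp add: K_def)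
  moreover have "integrable M (\<lambda>\<omega>. indicator G \<omega> * step r u v \<omega>) \<and>
    \<bar>expectation (\<lambda>\<omega>. indicator G \<omega> * step r u v \<omega>)\<bar> \<le> e * (v - u) + K * (v - u)\<^sup>2"
    if u: "0 \<le> u" "u < v" "v - u \<le> 1" and G: "G \<in> sets (F u)" "\<And>\<omega>. \<omega> \<in> G \<Longrightarrow> u < hitting_time X r \<omega>" for u v G
  proof -
    interpret bi: brownian_increment M "F u" "\<lambda>\<omega>. B v \<omega> - B u \<omega>" "v - u"
      by (rule brownian_increment[OF u(1,2)])
    have GM: "\<omega> \<in> space M" if "\<omega> \<in> G" for \<omega>
      using that sets.sets_into_space[OF G(1)] by (auto simp: space_F)
    have XG: "norm (X u \<omega>) \<le> r" if "\<omega> \<in> G" for \<omega>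
      by (rule norm_X_until[OF r GM[OF that] u(1)]) (use G(2)[OF that] u in auto)
    have meas: "drift r u v \<in> borel_measurable M" "Y r v \<in> borel_measurable M"
      using drift_measurable[OF r, of u v] Y_measurable[OF r, of v] u
      by (auto intro: measurable_from_subalg[OF subalgebra_F])
    have dG: "norm (drift r u v \<omega>) \<le> r * (v - u)" if "\<omega> \<in> G" for \<omega>
      using norm_drift[OF r GM[OF that]] u by simp
    have YG: "AE \<omega> in M. \<omega> \<in> G \<longrightarrow> Y r v \<omega> = X u \<omega> + L (B v \<omega> - B u \<omega>) - drift r u v \<omega>"
      using Y_increment[OF r]
    proof eventually_elim
      case (elim \<omega>)
      show ?case
      proof
        assume "\<omega> \<in> G"
        then have "Y r u \<omega> = X u \<omega>"
          using G(2)[OF \<open>\<omega> \<in> G\<close>] u by (intro Y_eq_X r GM) auto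
        then show "Y r v \<omega> = X u \<omega> + L (B v \<omega> - B u \<omega>) - drift r u v \<omega>"
          using elim[rule_format, of u v] u by simp
      qed
    qed
    \<comment> \<open>The starting point is \<open>X u\<close>, the displacement \<open>b\<close> is
      the drift integral, and the end point is \<open>Y r v\<close>.\<close>
    note R = bi.one_step_remainder[OF f' f'' cont_f'' linear_L norm_L C(2) C(1) less_imp_le[OF \<epsilon>] G(1)
        X_measurable_later[OF u(1) order_refl] XG meas dG YG onorm_L r u(3),
        folded cutoff_def L2_def N_def, folded step_def]
    have "\<epsilon> * ((onorm L)\<^sup>2 * N) * (v - u) \<le> e * (v - u)"
      using \<epsilon>e u by (intro mult_right_mono) auto
    then show ?thesis using R unfolding K_def by linarith
  qed
  ultimately show ?thesis by blast
qed

text \<open>Brings a step into the form of the Euler sums: an increment of a path function plus the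
  integral of an integrand frozen at the left end point.\<close>

lemma step_eq:
  assumes r: "r \<ge> 0" and \<omega>: "\<omega> \<in> space M" and u: "0 \<le> u" "u \<le> v" "u < hitting_time X r \<omega>"
  shows "step r u v \<omega> = cutoff r (Y r v \<omega>) - cutoff r (Y r u \<omega>)
    + integral {u..v} (\<lambda>q. f' (X u \<omega>) (trunc r (X q \<omega>)) - L2 (X u \<omega>))"
proof -
  have "Y r u \<omega> = X u \<omega>" "norm (X u \<omega>) \<le> r"
    using u by (auto intro!: Y_eq_X norm_X_until r \<omega>)
  then have "cutoff r (Y r u \<omega>) = f (X u \<omega>)" by (simp add: cutoff_def)
  moreover have "continuous_on {u..v} (\<lambda>q. trunc r (X q \<omega>))"
    using u by (intro continuous_on_comp_X continuous_on_trunc r \<omega>) auto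
  then have int: "(\<lambda>q. trunc r (X q \<omega>)) integrable_on {u..v}" by (rule integrable_continuous_real)
  have "integral {u..v} (\<lambda>q. f' (X u \<omega>) (trunc r (X q \<omega>)) - L2 (X u \<omega>)) =
      integral {u..v} (\<lambda>q. f' (X u \<omega>) (trunc r (X q \<omega>))) - (v - u) * L2 (X u \<omega>)"
    using u integrable_linear[OF int blinfun.bounded_linear_right, of "f' (X u \<omega>)"]
    by (subst Henstock_Kurzweil_Integration.integral_diff) (auto simp: o_def)
  moreover have "integral {u..v} (\<lambda>q. f' (X u \<omega>) (trunc r (X q \<omega>))) = f' (X u \<omega>) (drift r u v \<omega>)"
    using integral_linear[OF int blinfun.bounded_linear_right, of "f' (X u \<omega>)"] u
    by (simp add: o_def drift_eq[OF r \<omega>])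
  ultimately show ?thesis by (simp add: step_def)
qed

section \<open>The stopped compensated process: bounds and measurability\<close>

lemma subalgebra_F_mono: "s \<le> t \<Longrightarrow> subalgebra (F t) (F s)"
  using sets_F_mono[of s t] by (auto simp: subalgebra_def space_F)

lemma stopping_time_X: "r \<ge> 0 \<Longrightarrow> stopping_time F (hitting_time X r)"
  using stopping_time_hitting_time[OF filtration_axioms adapted_X _ paths_X] .

lemma hitting_time_X_nonneg: "r \<ge> 0 \<Longrightarrow> \<omega> \<in> space M \<Longrightarrow> 0 \<le> hitting_time X r \<omega>"
  using hitting_time_nonneg[where X = X and \<omega> = \<omega>, OF paths_X] .

lemma before_hitting_time_measurable:
  assumes "r \<ge> 0" "u \<le> t"
  shows "Measurable.pred (F t) (\<lambda>\<omega>. u < hitting_time X r \<omega>)"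
  using measurable_from_subalg[OF subalgebra_F_mono[OF assms(2)] stopping_timeD2[OF stopping_time_X[OF assms(1)]]] .

lemma stopped_compensated_bounded:
  assumes r: "r \<ge> 0" and t: "t \<ge> 0"
  shows "\<exists>K. \<forall>\<omega>\<in>space M. \<bar>compensated (min t (hitting_time X r \<omega>)) \<omega>\<bar> \<le> K"
proof -
  obtain K0 where K0: "K0 \<ge> 0" "\<And>x. norm x \<le> r \<Longrightarrow> \<bar>f x\<bar> \<le> K0"
    using continuous_bounded_cball[OF cont_f] by blast
  obtain K1 where K1: "K1 \<ge> 0" "\<And>x. norm x \<le> r \<Longrightarrow> \<bar>gen x\<bar> \<le> K1"
    using continuous_bounded_cball[OF cont_gen] by blast
  have "\<bar>compensated (min t (hitting_time X r \<omega>)) \<omega>\<bar> \<le> 2 * K0 + K1 * t" if \<omega>: "\<omega> \<in> space M" for \<omega>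
  proof (cases "hitting_time X r \<omega> = 0")
    case True
    \<comment> \<open>Here the start may lie outside the ball, but the compensated process vanishes
      at time 0.\<close>
    then show ?thesis using t K0(1) K1(1) by (simp add: compensated_eq[OF \<omega>])
  next
    case False
    define c where "c = min t (hitting_time X r \<omega>)"
    have \<tau>: "0 < hitting_time X r \<omega>" using False hitting_time_X_nonneg[OF r \<omega>] by simp
    have c: "0 \<le> c" "c \<le> t" "c \<le> hitting_time X r \<omega>" using t \<tau> by (auto simp: c_def)
    have X: "norm (X q \<omega>) \<le> r" if "0 \<le> q" "q \<le> c" for q
      using norm_X_until[OF r \<omega> that(1) _ \<tau>] that c by simp
    have "norm (integral {0..c} (\<lambda>q. gen (X q \<omega>))) \<le> K1 * (c - 0)"
      using c(1) by (intro integral_bound continuous_on_comp_X cont_gen \<omega>) (auto intro!: K1 X)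
    also have "\<dots> \<le> K1 * t" using c K1 by (intro mult_left_mono) auto
    finally have "\<bar>integral {0..c} (\<lambda>q. gen (X q \<omega>))\<bar> \<le> K1 * t" by simp
    moreover have "\<bar>f (X c \<omega>)\<bar> \<le> K0" "\<bar>f (X 0 \<omega>)\<bar> \<le> K0" using c by (auto intro!: K0 X)
    ultimately show ?thesis unfolding compensated_eq[OF \<omega>] c_def[symmetric] by linarith
  qed
  then show ?thesis by blast
qed

text \<open>The stopped value is a pointwise limit of grid sums over \<open>[0, t]\<close>. Every
  summand is known at time \<open>t\<close>, since whether a step starts before the hitting time is
  decided at its left end point.\<close>

lemma stopped_compensated_measurable:
  assumes r: "r \<ge> 0" and t: "t \<ge> 0"
  shows "(\<lambda>\<omega>. compensated (min t (hitting_time X r \<omega>)) \<omega>) \<in> borel_measurable (F t)"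
proof -
  define x where "x m i = 0 + real i * ((t - 0) / real (Suc m))" for m i
  have x: "x m i \<in> {0..t}" if "i \<le> Suc m" for m i
    unfolding x_def by (rule grid_mem[OF t that])
  have comp: "compensated (x m i) \<in> borel_measurable (F t)" if "i \<le> Suc m" for m i
    using x[OF that] by (intro adapted_measurable_later[OF filtration_axioms adapted_compensated]) auto
  have "(\<lambda>\<omega>. compensated (min t (hitting_time X r \<omega>)) \<omega> - compensated 0 \<omega>) \<in> borel_measurable (F t)"
  proof (rule borel_measurable_LIMSEQ_metric)
    fix m
    show "(\<lambda>\<omega>. \<Sum>i<Suc m. if x m i < hitting_time X r \<omega>
        then compensated (x m (Suc i)) \<omega> - compensated (x m i) \<omega> else 0) \<in> borel_measurable (F t)"
    proof (rule borel_measurable_sum)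
      fix i assume i: "i \<in> {..<Suc m}"
      have [measurable]: "Measurable.pred (F t) (\<lambda>\<omega>. x m i < hitting_time X r \<omega>)"
        using x[of i m] i by (intro before_hitting_time_measurable r) auto
      have [measurable]: "compensated (x m i) \<in> borel_measurable (F t)" "compensated (x m (Suc i)) \<in> borel_measurable (F t)"
        using i by (auto intro: comp)
      show "(\<lambda>\<omega>. if x m i < hitting_time X r \<omega>
        then compensated (x m (Suc i)) \<omega> - compensated (x m i) \<omega> else 0) \<in> borel_measurable (F t)"
        by measurable
    qed
  next
    fix \<omega> assume "\<omega> \<in> space (F t)"
    then have \<omega>: "\<omega> \<in> space M" by (simp add: space_F)
    let ?c = "max 0 (min t (hitting_time X r \<omega>))"
    have c: "?c = min t (hitting_time X r \<omega>)" using hitting_time_X_nonneg[OF r \<omega>] t by simp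
    have "continuous_on {0..t} (\<lambda>u. compensated u \<omega>)"
      by (rule continuous_on_subset[OF continuous_on_compensated[OF \<omega>]]) auto
    then have "continuous (at ?c within {0..t}) (\<lambda>u. compensated u \<omega>)"
      using t by (auto simp: continuous_on_eq_continuous_within)
    from stopped_sum_tendsto[OF t this]
    show "(\<lambda>m. \<Sum>i<Suc m. if x m i < hitting_time X r \<omega>
        then compensated (x m (Suc i)) \<omega> - compensated (x m i) \<omega> else 0)
      \<longlonglongrightarrow> compensated (min t (hitting_time X r \<omega>)) \<omega> - compensated 0 \<omega>"
      unfolding x_def c .
  qed
  from borel_measurable_add[OF this adapted_measurable_later[OF filtration_axioms adapted_compensated order_refl t]]
  show ?thesis by simp
qed

lemma stopped_compensated_integrable:
  assumes "r \<ge> 0" "t \<ge> 0"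
  shows "integrable M (\<lambda>\<omega>. compensated (min t (hitting_time X r \<omega>)) \<omega>)"
proof -
  obtain K where "\<And>\<omega>. \<omega> \<in> space M \<Longrightarrow> \<bar>compensated (min t (hitting_time X r \<omega>)) \<omega>\<bar> \<le> K"
    using stopped_compensated_bounded[OF assms] by blast
  then show ?thesis
    using measurable_from_subalg[OF subalgebra_F stopped_compensated_measurable[OF assms]]
    by (intro integrable_const_bound[where B = K]) auto
qed

section \<open>Vanishing mesh: limit along paths and in expectation\<close>

lemma euler_sum_paths:
  assumes r: "r \<ge> 0" and st: "0 \<le> s" "s \<le> t" and \<omega>: "\<omega> \<in> space M" and \<tau>: "s < hitting_time X r \<omega>"
    and K: "\<And>y. norm y \<le> r + 1 \<Longrightarrow> \<bar>f y\<bar> \<le> K0" "K0 \<ge> 0"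
      "\<And>y z. norm y \<le> r \<Longrightarrow> norm z \<le> r \<Longrightarrow> \<bar>f' y z - L2 y\<bar> \<le> K1" "K1 \<ge> 0"
  defines "x \<equiv> \<lambda>m i. s + real i * ((t - s) / real (Suc m))"
  shows "(\<lambda>m. \<Sum>i<Suc m. if x m i < hitting_time X r \<omega> then step r (x m i) (x m (Suc i)) \<omega> else 0)
      \<longlonglongrightarrow> compensated (min t (hitting_time X r \<omega>)) \<omega> - compensated (min s (hitting_time X r \<omega>)) \<omega>" (is ?lim)
    and "\<bar>\<Sum>i<Suc m. if x m i < hitting_time X r \<omega> then step r (x m i) (x m (Suc i)) \<omega> else 0\<bar>
        \<le> 2 * K0 + K1 * (t - s)" (is ?bound)
proof -
  let ?T = "hitting_time X r \<omega>"
  define g where "g q u = f' (X q \<omega>) (trunc r (X u \<omega>)) - L2 (X q \<omega>)" for q u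
  define E where "E u = cutoff r (Y r u \<omega>)" for u
  have T0: "0 < ?T" using st \<tau> by simp
  have x: "x m i \<in> {s..t}" if "i \<le> Suc m" for m i
    unfolding x_def by (rule grid_mem[OF st(2) that])
  have xS: "x m (Suc i) = x m i + (t - s) / real (Suc m)" for m i
    unfolding x_def by (rule grid_Suc)
  have "(if x m i < ?T then step r (x m i) (x m (Suc i)) \<omega> else 0) =
      (if x m i < ?T then E (x m (Suc i)) - E (x m i) + integral {x m i..x m (Suc i)} (g (x m i)) else 0)"
    if i: "i < Suc m" for m i
    using step_eq[OF r \<omega>, of "x m i" "x m (Suc i)"] x[of i m] i st xS[of m i]
    by (auto simp: E_def g_def[abs_def])
  then have sums: "(\<Sum>i<Suc m. if x m i < ?T then step r (x m i) (x m (Suc i)) \<omega> else 0) =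
      (\<Sum>i<Suc m. if x m i < ?T then E (x m (Suc i)) - E (x m i) + integral {x m i..x m (Suc i)} (g (x m i)) else 0)" for m
    by (intro sum.cong) auto
  have cX: "continuous_on {s..t} (\<lambda>q. X q \<omega>)" using st by (intro continuous_on_X \<omega>) auto
  have cTX: "continuous_on {s..t} (\<lambda>q. trunc r (X q \<omega>))"
    using st by (intro continuous_on_comp_X continuous_on_trunc r \<omega>) auto
  have g: "continuous_on ({s..t} \<times> {s..t}) (\<lambda>p. g (fst p) (snd p))"
    unfolding g_def
    by (intro continuous_intros continuous_on_compose2[OF cont_f'[of UNIV]] continuous_on_compose2[OF cont_L2[of UNIV]]
        continuous_on_compose2[OF cX] continuous_on_compose2[OF cTX]) auto
  define c where "c = max s (min t ?T)"
  have c: "c \<in> {s..t}" "c = min t ?T" "c \<le> ?T" "0 \<le> c" using st \<tau> by (auto simp: c_def)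
  have Yc: "Y r u \<omega> = X u \<omega>" "norm (X u \<omega>) \<le> r" "E u = f (X u \<omega>)" if "0 \<le> u" "u \<le> c" for u
  proof -
    show "Y r u \<omega> = X u \<omega>" using Y_eq_X[OF r \<omega> that(1) _ T0] that c by simp
    moreover show "norm (X u \<omega>) \<le> r" using norm_X_until[OF r \<omega> that(1) _ T0] that c by simp
    ultimately show "E u = f (X u \<omega>)" by (simp add: E_def cutoff_def)
  qed
  have "continuous (at c within {s..t}) E"
    unfolding continuous_within
  proof -
    have "continuous_on {s..t} (\<lambda>u. Y r u \<omega>)"
      by (rule continuous_on_subset[OF continuous_on_Y[OF r \<omega>]]) (use st in auto)
    then have lim: "((\<lambda>u. Y r u \<omega>) \<longlongrightarrow> Y r c \<omega>) (at c within {s..t})"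
      using c(1) by (auto simp: continuous_on_def)
    \<comment> \<open>This is where the gap between the radii \<open>r\<close> and
      \<open>r + 1\<close> is used: near \<open>c\<close> the cutoff is inactive, so
      \<open>E\<close> is continuous at \<open>c\<close> although it may jump later.\<close>
    have "norm (Y r c \<omega>) < r + 1" using Yc(1,2)[of c] c by simp
    then have ev: "\<forall>\<^sub>F u in at c within {s..t}. norm (Y r u \<omega>) < r + 1"
      by (rule order_tendstoD(2)[OF tendsto_norm[OF lim]])
    have "((\<lambda>u. f (Y r u \<omega>)) \<longlongrightarrow> f (Y r c \<omega>)) (at c within {s..t})"
      by (rule continuous_on_tendsto_compose[OF cont_f[of UNIV] lim]) auto
    then have "((\<lambda>u. f (Y r u \<omega>)) \<longlongrightarrow> E c) (at c within {s..t})"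
      using Yc(1,3)[of c] c by simp
    then show "(E \<longlongrightarrow> E c) (at c within {s..t})"
    proof (rule Lim_transform_eventually)
      show "\<forall>\<^sub>F u in at c within {s..t}. f (Y r u \<omega>) = E u"
        using ev by eventually_elim (simp add: E_def cutoff_def)
    qed
  qed
  from euler_sum_tendsto[OF st(2) g this[unfolded c_def]]
  have lim: "(\<lambda>m. \<Sum>i<Suc m. if x m i < ?T then step r (x m i) (x m (Suc i)) \<omega> else 0)
      \<longlonglongrightarrow> E c - E s + integral {s..c} (\<lambda>q. g q q)"
    unfolding sums unfolding x_def c_def .
  \<comment> \<open>Up to \<open>c\<close> the path stays in the ball, so the truncation is inert
    and the diagonal of \<open>g\<close> is \<open>- gen\<close>.\<close>
  have "integral {s..c} (\<lambda>q. g q q) = integral {s..c} (\<lambda>q. - gen (X q \<omega>))"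
    using Yc(2) st by (intro integral_cong) (simp add: g_def gen_def trunc_id[OF r])
  also have "\<dots> = - integral {s..c} (\<lambda>q. gen (X q \<omega>))" by simp
  also have "integral {s..c} (\<lambda>q. gen (X q \<omega>)) = integral {0..c} (\<lambda>q. gen (X q \<omega>)) - integral {0..s} (\<lambda>q. gen (X q \<omega>))"
    using c st by (intro integral_diff_initial[symmetric] continuous_on_comp_X cont_gen \<omega>) auto
  finally have "E c - E s + integral {s..c} (\<lambda>q. g q q) = compensated c \<omega> - compensated s \<omega>"
    using Yc(3)[of c] Yc(3)[of s] c st by (simp add: compensated_eq[OF \<omega>])
  moreover have "min s ?T = s" using \<tau> by simp
  ultimately show ?lim using lim by (simp only: c(2))
  show ?bound
    unfolding sums unfolding x_def
  proof (rule euler_sum_bound[OF st(2)])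
    show "\<bar>E u\<bar> \<le> K0" for u using K(1,2) by (simp add: E_def cutoff_def)
    show "continuous_on {s..t} (g q)" if "q \<in> {s..t}" for q
      by (rule continuous_on_compose2[OF g, where f = "\<lambda>u. (q, u)", simplified]) (use that in \<open>auto intro!: continuous_intros\<close>)
    show "\<bar>g q u\<bar> \<le> K1" if "q \<in> {s..t}" "u \<in> {s..t}" "q < ?T" for q u
      unfolding g_def using that st by (intro K(3) norm_trunc[OF r] norm_X_until[OF r \<omega> _ _ T0]) auto
  qed (rule K)
qed

text \<open>There are \<open>Suc m\<close> steps of length \<open>h m\<close>, so the one-step
  bounds add up to \<open>(t - s) * (e + K * h m)\<close>. The sums \<open>S m\<close> do not
  involve \<open>e\<close>, and their expectations tend to that of \<open>D\<close>; letting the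
  mesh and then \<open>e\<close> tend to 0 gives expectation 0.\<close>

lemma stopped_compensated_increment:
  assumes r: "r \<ge> 0" and st: "0 \<le> s" "s \<le> t" and A: "A \<in> sets (F s)"
  shows "expectation (\<lambda>\<omega>. indicator A \<omega> * compensated (min t (hitting_time X r \<omega>)) \<omega>) =
    expectation (\<lambda>\<omega>. indicator A \<omega> * compensated (min s (hitting_time X r \<omega>)) \<omega>)"
proof (cases "s = t")
  case False
  then have lt: "s < t" using st by simp
  define h where "h m = (t - s) / real (Suc m)" for m
  define x where "x m i = s + real i * ((t - s) / real (Suc m))" for m i
  define G where "G m i = {\<omega> \<in> A. x m i < hitting_time X r \<omega>}" for m i
  define S where "S m \<omega> = (\<Sum>i<Suc m. indicator (G m i) \<omega> * step r (x m i) (x m (Suc i)) \<omega>)" for m \<omega>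
  define D where "D \<omega> = indicator A \<omega> * (compensated (min t (hitting_time X r \<omega>)) \<omega> - compensated (min s (hitting_time X r \<omega>)) \<omega>)" for \<omega>
  have x: "x m i \<in> {s..t}" if "i \<le> Suc m" for m i
    unfolding x_def by (rule grid_mem[OF st(2) that])
  have xS: "x m (Suc i) = x m i + h m" for m i
    unfolding x_def h_def by (rule grid_Suc)
  have h0: "h m > 0" for m using lt by (simp add: h_def)
  have AM [measurable]: "A \<in> sets M" using A subalgebra_F[of s] by (auto simp: subalgebra_def)
  have S_eq: "S m \<omega> = indicator A \<omega> * (\<Sum>i<Suc m. if x m i < hitting_time X r \<omega> then step r (x m i) (x m (Suc i)) \<omega> else 0)" for m \<omega>
    unfolding S_def sum_distrib_left by (intro sum.cong) (auto simp: G_def indicator_def)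
  \<comment> \<open>If the hitting time is not after \<open>s\<close>, no step starts before it, and
    the two stopped values in \<open>D\<close> coincide as well.\<close>
  have S0: "S m \<omega> = 0" if "hitting_time X r \<omega> \<le> s" for m \<omega>
  proof -
    have "\<not> x m i < hitting_time X r \<omega>" if "i < Suc m" for i
      using x[of i m] that \<open>hitting_time X r \<omega> \<le> s\<close> by auto
    then have "(\<Sum>i<Suc m. if x m i < hitting_time X r \<omega> then step r (x m i) (x m (Suc i)) \<omega> else 0) = 0"
      by (intro sum.neutral) auto
    then show ?thesis by (simp only: S_eq mult_zero_right)
  qed
  have G: "G m i \<in> sets (F (x m i))" if "i < Suc m" for m i
  proof -
    have "s \<le> x m i" using x[of i m] that by simp
    then have [measurable]: "A \<in> sets (F (x m i))" using A sets_F_mono by blast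
    have [measurable]: "Measurable.pred (F (x m i)) (\<lambda>\<omega>. x m i < hitting_time X r \<omega>)"
      by (rule before_hitting_time_measurable[OF r order_refl])
    have "G m i = A \<inter> {\<omega> \<in> space (F (x m i)). x m i < hitting_time X r \<omega>}"
      using sets.sets_into_space[OF A] by (auto simp: G_def space_F)
    also have "\<dots> \<in> sets (F (x m i))" by measurable
    finally show ?thesis .
  qed
  obtain K0 where K0: "K0 \<ge> 0" "\<And>y. norm y \<le> r + 1 \<Longrightarrow> \<bar>f y\<bar> \<le> K0"
    using continuous_bounded_cball[OF cont_f] by blast
  have "continuous_on UNIV (\<lambda>p. f' (fst p) (snd p) - L2 (fst p))"
    by (intro continuous_intros cont_f'_apply continuous_on_compose2[OF cont_L2[of UNIV]]) auto
  then obtain K1 where K1: "K1 \<ge> 0" "\<And>p. norm p \<le> r + r \<Longrightarrow> \<bar>f' (fst p) (snd p) - L2 (fst p)\<bar> \<le> K1"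
    using continuous_bounded_cball by blast
  have K1': "\<bar>f' y z - L2 y\<bar> \<le> K1" if "norm y \<le> r" "norm z \<le> r" for y z
    using K1(2)[of "(y, z)"] norm_Pair_le[of y z] that by simp
  have lim: "(\<lambda>m. S m \<omega>) \<longlonglongrightarrow> D \<omega>" if \<omega>: "\<omega> \<in> space M" for \<omega>
  proof (cases "hitting_time X r \<omega> \<le> s")
    case True
    then show ?thesis using st by (simp add: S0 D_def)
  next
    case False
    then have "s < hitting_time X r \<omega>" by simp
    from tendsto_mult_left[OF euler_sum_paths(1)[OF r st \<omega> this K0(2,1) K1' K1(1)], of "indicator A \<omega>"]
    show ?thesis unfolding S_eq D_def x_def .
  qed
  have bound: "\<bar>S m \<omega>\<bar> \<le> 2 * K0 + K1 * (t - s)" if \<omega>: "\<omega> \<in> space M" for m \<omega>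
  proof (cases "hitting_time X r \<omega> \<le> s \<or> \<omega> \<notin> A")
    case True
    then have "S m \<omega> = 0" by (rule disjE) (erule S0, simp add: S_eq)
    then show ?thesis using K0 K1 st by simp
  next
    case False
    then have "s < hitting_time X r \<omega>" by simp
    from euler_sum_paths(2)[OF r st \<omega> this K0(2,1) K1' K1(1)]
    show ?thesis using False unfolding S_eq x_def by (simp del: sum.lessThan_Suc)
  qed
  \<comment> \<open>Shifting the index by \<open>m0\<close> makes the mesh at most 1, as the
    one-step bound requires.\<close>
  define m0 where "m0 = nat \<lceil>t - s\<rceil>"
  have h1: "h (m + m0) \<le> 1" for m
  proof -
    have "t - s \<le> real (Suc (m + m0))" unfolding m0_def using lt by simp linarith
    then show ?thesis by (simp add: h_def)
  qed
  have S_int: "integrable M (S (m + m0)) \<and> \<bar>expectation (S (m + m0))\<bar> \<le> (t - s) * (e + K * h (m + m0))"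
    if K: "\<forall>u v G. 0 \<le> u \<longrightarrow> u < v \<longrightarrow> v - u \<le> 1 \<longrightarrow> G \<in> sets (F u) \<longrightarrow> (\<forall>\<omega>\<in>G. u < hitting_time X r \<omega>) \<longrightarrow>
      integrable M (\<lambda>\<omega>. indicator G \<omega> * step r u v \<omega>) \<and>
      \<bar>expectation (\<lambda>\<omega>. indicator G \<omega> * step r u v \<omega>)\<bar> \<le> e * (v - u) + K * (v - u)\<^sup>2" for e K m
  proof -
    let ?m = "m + m0"
    have one: "integrable M (\<lambda>\<omega>. indicator (G ?m i) \<omega> * step r (x ?m i) (x ?m (Suc i)) \<omega>)"
      "\<bar>expectation (\<lambda>\<omega>. indicator (G ?m i) \<omega> * step r (x ?m i) (x ?m (Suc i)) \<omega>)\<bar> \<le> e * h ?m + K * (h ?m)\<^sup>2"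
      if i: "i < Suc ?m" for i
    proof -
      have d: "x ?m (Suc i) - x ?m i = h ?m" by (simp add: xS)
      have "0 \<le> x ?m i" "x ?m i < x ?m (Suc i)" "x ?m (Suc i) - x ?m i \<le> 1"
        using x[of i ?m] i st h0[of ?m] h1[of m] by (auto simp: xS)
      moreover have "\<forall>\<omega>\<in>G ?m i. x ?m i < hitting_time X r \<omega>" by (simp add: G_def)
      ultimately show "integrable M (\<lambda>\<omega>. indicator (G ?m i) \<omega> * step r (x ?m i) (x ?m (Suc i)) \<omega>)"
        "\<bar>expectation (\<lambda>\<omega>. indicator (G ?m i) \<omega> * step r (x ?m i) (x ?m (Suc i)) \<omega>)\<bar> \<le> e * h ?m + K * (h ?m)\<^sup>2"
        using K G[OF i] unfolding d[symmetric] by blast+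
    qed
    have int: "integrable M (S ?m)"
      unfolding S_def by (intro Bochner_Integration.integrable_sum one) simp
    have "expectation (S ?m) = (\<Sum>i<Suc ?m. expectation (\<lambda>\<omega>. indicator (G ?m i) \<omega> * step r (x ?m i) (x ?m (Suc i)) \<omega>))"
      unfolding S_def by (intro Bochner_Integration.integral_sum one) simp
    then have "\<bar>expectation (S ?m)\<bar> \<le> (\<Sum>i<Suc ?m. e * h ?m + K * (h ?m)\<^sup>2)"
      by (simp only:) (intro order_trans[OF sum_abs sum_mono] one, simp)
    also have "\<dots> = (real (Suc ?m) * h ?m) * (e + K * h ?m)"
      by (simp add: algebra_simps power2_eq_square del: of_nat_Suc of_nat_add)
    also have "real (Suc ?m) * h ?m = t - s" by (simp add: h_def)
    finally show ?thesis using int by blast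
  qed
  have Dint: "integrable M (\<lambda>\<omega>. indicator A \<omega> * compensated (min u (hitting_time X r \<omega>)) \<omega>)" if "u \<ge> 0" for u
    using integrable_mult_indicator[OF AM stopped_compensated_integrable[OF r that]] by simp
  have conv: "(\<lambda>m. expectation (S (m + m0))) \<longlonglongrightarrow> expectation D"
  proof (rule integral_dominated_convergence[where w = "\<lambda>_. 2 * K0 + K1 * (t - s)"])
    \<comment> \<open>Only integrability of the sums is extracted here, so the tolerance 1 is an
      arbitrary choice.\<close>
    obtain K where "\<forall>u v G. 0 \<le> u \<longrightarrow> u < v \<longrightarrow> v - u \<le> 1 \<longrightarrow> G \<in> sets (F u) \<longrightarrow> (\<forall>\<omega>\<in>G. u < hitting_time X r \<omega>) \<longrightarrow>
      integrable M (\<lambda>\<omega>. indicator G \<omega> * step r u v \<omega>) \<and>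
      \<bar>expectation (\<lambda>\<omega>. indicator G \<omega> * step r u v \<omega>)\<bar> \<le> 1 * (v - u) + K * (v - u)\<^sup>2"
      using expectation_step[OF r zero_less_one] by blast
    from S_int[OF this] show "S (m + m0) \<in> borel_measurable M" for m by auto
    have "integrable M D"
      unfolding D_def right_diff_distrib using st by (intro Bochner_Integration.integrable_diff Dint) auto
    then show "D \<in> borel_measurable M" by simp
    show "AE \<omega> in M. (\<lambda>m. S (m + m0) \<omega>) \<longlonglongrightarrow> D \<omega>"
      using lim by (intro AE_I2 LIMSEQ_ignore_initial_segment)
  qed (use bound in \<open>auto intro!: AE_I2\<close>)
  have small: "\<bar>expectation D\<bar> \<le> (t - s) * e" if e: "e > 0" for e
  proof -
    obtain K where K: "\<forall>u v G. 0 \<le> u \<longrightarrow> u < v \<longrightarrow> v - u \<le> 1 \<longrightarrow> G \<in> sets (F u) \<longrightarrow> (\<forall>\<omega>\<in>G. u < hitting_time X r \<omega>) \<longrightarrow>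
      integrable M (\<lambda>\<omega>. indicator G \<omega> * step r u v \<omega>) \<and>
      \<bar>expectation (\<lambda>\<omega>. indicator G \<omega> * step r u v \<omega>)\<bar> \<le> e * (v - u) + K * (v - u)\<^sup>2"
      using expectation_step[OF r e] by blast
    have "(\<lambda>m. h m) \<longlonglongrightarrow> 0" unfolding h_def by real_asymp
    then have "(\<lambda>m. (t - s) * (e + K * h (m + m0))) \<longlonglongrightarrow> (t - s) * (e + K * 0)"
      by (intro tendsto_intros LIMSEQ_ignore_initial_segment)
    moreover have "(\<lambda>m. \<bar>expectation (S (m + m0))\<bar>) \<longlonglongrightarrow> \<bar>expectation D\<bar>"
      by (intro tendsto_intros conv)
    ultimately have "\<bar>expectation D\<bar> \<le> (t - s) * (e + K * 0)"
      using S_int[OF K] by (intro LIMSEQ_le[of "\<lambda>m. \<bar>expectation (S (m + m0))\<bar>"]) auto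
    then show ?thesis by simp
  qed
  have "\<bar>expectation D\<bar> \<le> y" if "y > 0" for y
    using small[of "y / (t - s)"] lt that by simp
  then have "expectation D = 0" by (metis abs_le_zero_iff field_le_epsilon add_0)
  then show ?thesis
    using st unfolding D_def right_diff_distrib
    by (subst (asm) Bochner_Integration.integral_diff) (auto intro: Dint)
qed simp

section \<open>Martingale property and localization\<close>

text \<open>Equal integrals over every event of \<open>F s\<close>, together with measurability of
  the earlier value, characterise the conditional expectation.\<close>

lemma stopped_compensated_martingale:
  assumes r: "r \<ge> 0"
  shows "continuous_time_martingale M F (\<lambda>t \<omega>. compensated (min t (hitting_time X r \<omega>)) \<omega>)"
  unfolding continuous_time_martingale_def adapted_def
proof (intro conjI allI impI)
  fix s t :: real assume st: "0 \<le> s" "s \<le> t"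
  interpret finite_measure_subalgebra M "F s"
    by unfold_locales (rule subalgebra_F)
  show "AE \<omega> in M. real_cond_exp M (F s) (\<lambda>\<omega>. compensated (min t (hitting_time X r \<omega>)) \<omega>) \<omega>
      = compensated (min s (hitting_time X r \<omega>)) \<omega>"
  proof (rule real_cond_exp_charact)
    fix A assume "A \<in> sets (F s)"
    from stopped_compensated_increment[OF r st this]
    show "(LINT \<omega>:A|M. compensated (min t (hitting_time X r \<omega>)) \<omega>) = (LINT \<omega>:A|M. compensated (min s (hitting_time X r \<omega>)) \<omega>)"
      by (simp add: set_lebesgue_integral_def)
  qed (use st in \<open>auto intro: stopped_compensated_integrable[OF r] stopped_compensated_measurable[OF r]\<close>)
qed (use stopped_compensated_integrable[OF r] stopped_compensated_measurable[OF r] in auto)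

text \<open>The hitting times of the levels \<open>real n\<close> localize: they increase with the
  level, and they tend to infinity because a continuous path is bounded on every compact time
  interval.\<close>

lemma local_martingale_compensated: "local_martingale M F compensated"
  unfolding local_martingale_def
proof (intro conjI ballI exI[of _ "\<lambda>n. hitting_time X (real n)"] allI)
  show "AE \<omega> in M. incseq (\<lambda>n. hitting_time X (real n) \<omega>) \<and>
      filterlim (\<lambda>n. hitting_time X (real n) \<omega>) at_top sequentially"
  proof (intro AE_I2 conjI)
    fix \<omega> assume "\<omega> \<in> space M"
    note paths = paths_X[OF this]
    show "incseq (\<lambda>n. hitting_time X (real n) \<omega>)"
      unfolding incseq_def using hitting_time_mono[where X = X and \<omega> = \<omega>, OF paths] by simp
    show "filterlim (\<lambda>n. hitting_time X (real n) \<omega>) at_top sequentially"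
      using hitting_time_tendsto_infinity[where X = X and \<omega> = \<omega>, OF paths] .
  qed
qed (simp_all add: adapted_compensated cadlag_compensated stopping_time_X hitting_time_X_nonneg stopped_compensated_martingale)

lemma extended_generator_gen: "extended_generator M F X f gen"
  unfolding extended_generator_def
proof (intro conjI)
  show "gen \<in> borel_measurable borel" by (rule borel_measurable_continuous_onI[OF cont_gen])
  show "AE \<omega> in M. \<forall>t\<ge>0. set_integrable lborel {0..t} (\<lambda>s. gen (X s \<omega>))"
    by (intro AE_I2 allI impI set_lebesgue_integral_interval(1) continuous_on_comp_X cont_gen) auto
  show "local_martingale M F (\<lambda>t \<omega>. f (X t \<omega>) - f (X 0 \<omega>) - (LINT s:{0..t}|lborel. gen (X s \<omega>)))"
    using local_martingale_compensated unfolding compensated_def[abs_def] .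
qed

end

theorem proposition1:
  fixes \<Psi> :: "real^'n^'n" and \<Sigma> :: "real^'d^'d" and X0 :: "real^'d^'n"
    and M :: "'w measure" and F :: "real \<Rightarrow> 'w measure"
    and B X :: "real \<Rightarrow> 'w \<Rightarrow> real^'d^'n" and f :: "real^'d^'n \<Rightarrow> real"
  assumes "pos_def \<Psi>" and "pos_def \<Sigma>"
    and "filtered_prob_space M F"
    and "matrix_brownian_motion M F B"
    and "matrix_OU_process M F B \<Psi> \<Sigma> X0 X"
    and "C2_function f"
  shows "extended_generator M F X f
    (\<lambda>Y. - trace (transpose Y ** nabla f Y) + trace (\<Sigma> ** nabla_quad \<Psi> f Y))"
proof -
  obtain f' f'' where "\<And>x. (f has_derivative blinfun_apply (f' x)) (at x)"
      "\<And>x. (f' has_derivative blinfun_apply (f'' x)) (at x)" "continuous_on UNIV f''"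
    using assms(6) unfolding C2_function_def by blast
  then interpret matrix_OU_C2 M F \<Psi> \<Sigma> X0 B X f f' f''
    using assms by (intro matrix_OU_C2.intro matrix_OU_C2_axioms.intro)
  show ?thesis using extended_generator_gen unfolding gen_eq .
qed

end
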